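(* Let $\rho_{A_1A_2A_3C}$ be any four-party quantum state. Then $$I(A_1:A_2:A_3|C)_{\rho}\;\geq\;D_{\mathsf{ALL}}\Big(\rho_{A_1A_2A_3C}\,\Big\|\,\int_{-\infty}^{\infty}\mathrm d\beta_0(t)\,\big(\mathcal R^{[t]}_{C\to A_3C}\circ\mathcal R^{[t]}_{C\to A_2C}\big)(\rho_{A_1C})\Big)$$ and $$I(A_1:A_2:A_3|C)_{\rho}\;\geq\;-\int_{-\infty}^{\infty}\mathrm d\beta_0(t)\,\log F\Big(\rho_{A_1A_2A_3C},\big(\mathcal R^{[t]}_{C\to A_3C}\circ\mathcal R^{[t]}_{C\to A_2C}\big)(\rho_{A_1C})\Big),$$ with, for $j\in\{2,3\}$, the maps $$\mathcal R^{[t]}_{C\to A_jC}(\cdot):=\rho_{A_jC}^{\frac{1+it}{2}}\rho_{C}^{-\frac{1+it}{2}}(\cdot)\rho_{C}^{-\frac{1-it}{2}}\rho_{A_jC}^{\frac{1-it}{2}},$$ and the probability density $\beta_0(t)=\frac{\pi}{2}(\cosh(\pi t)+1)^{-1}$ on $\mathbb R$. Moreover, the same bounds hold for any other ordering (permutation) of the systems $A_1,A_2,A_3$.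
   Context: All Hilbert spaces are finite-dimensional; quantum states are positive semidefinite operators of unit trace; marginals are denoted by subscripts and obtained by partial trace; identity operators are omitted, so the maps $\mathcal R^{[t]}_{C\to A_jC}$ act as the identity on all other systems. (Complex) powers and inverses of positive semidefinite operators are taken on the support (generalized inverse). $\log$ is the natural logarithm, and $\mathrm d\beta_0(t)$ means $\beta_0(t)\,\mathrm dt$. $H(A)_\rho=-\operatorname{tr}[\rho_A\log\rho_A]$, $I(A:B|C)_\rho=H(AC)_\rho+H(BC)_\rho-H(ABC)_\rho-H(C)_\rho$, and $I(A_1:A_2:A_3|C)_{\rho}:=I(A_1:A_2|C)_{\rho}+I(A_1A_2:A_3|C)_{\rho}$ (which is symmetric under permutations of $A_1,A_2,A_3$). $D_{\mathsf{ALL}}(\rho\|\sigma)=\sup_M\sum_z\operatorname{tr}[\rho M^z]\log\frac{\operatorname{tr}[\rho M^z]}{\operatorname{tr}[\sigma M^z]}$ is the measured relative entropy, the supremum over all POVMs $M=\{M^z\}_z$ (finite families of positive semidefinite operators summing to the identity), with the usual conventions ($0\log\frac0q=0$, value $+\infty$ if $\operatorname{tr}[\rho M^z]>0=\operatorname{tr}[\sigma M^z]$ for some $z$). $F(\rho,\sigma)=\|\sqrt\rho\sqrt\sigma\|_1^2$ is the quantum fidelity, with $\|\cdot\|_1$ the trace norm. *)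

theory Defs
  imports "HOL-Analysis.Analysis"
begin

text \<open>
  The Hilbert space of a system whose basis is indexed by a finite type \<open>'n\<close> is \<open>\<complex>\<^sup>n\<close>;
  the index type of a tensor product is the product of the index types.
\<close>

type_synonym 'n op = "complex^'n^'n"

definition cadj :: "'n::finite op \<Rightarrow> 'n op" where
  "cadj A = map_matrix cnj (transpose A)"

definition psd :: "'n::finite op \<Rightarrow> bool" where
  "psd A \<longleftrightarrow> cadj A = A \<and> (\<forall>v. 0 \<le> Re (\<Sum>i\<in>UNIV. cnj (v $ i) * (A *v v) $ i))"

definition state :: "'n::finite op \<Rightarrow> bool" where
  "state \<rho> \<longleftrightarrow> psd \<rho> \<and> trace \<rho> = 1"

subsection \<open>Functional calculus for Hermitian matrices\<close>

definition real_spectrum :: "'n::finite op \<Rightarrow> real set" where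
  "real_spectrum A = {l. \<exists>v. v \<noteq> 0 \<and> A *v v = l *\<^sub>R v}"

text \<open>The orthogonal projection onto the eigenspace of \<open>l\<close>.\<close>

definition eigproj :: "'n::finite op \<Rightarrow> real \<Rightarrow> 'n op" where
  "eigproj A l =
     (THE P. cadj P = P \<and> P ** P = P \<and> range ((*v) P) = {v. A *v v = l *\<^sub>R v})"

definition herm_fun :: "(real \<Rightarrow> complex) \<Rightarrow> 'n::finite op \<Rightarrow> 'n op" where
  "herm_fun f A = (\<Sum>l\<in>real_spectrum A. map_matrix ((*) (f l)) (eigproj A l))"

text \<open>
  For positive semidefinite \<open>A\<close> the following functions act on the support of \<open>A\<close> and
  vanish on its kernel, because \<open>0 powr z = 0\<close> for every \<open>z\<close> and \<open>ln 0 = 0\<close>.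
\<close>

definition op_power :: "'n::finite op \<Rightarrow> complex \<Rightarrow> 'n op" where
  "op_power A z = herm_fun (\<lambda>l. complex_of_real l powr z) A"

definition op_log :: "'n::finite op \<Rightarrow> 'n op" where
  "op_log A = herm_fun (\<lambda>l. complex_of_real (ln l)) A"

definition op_sqrt :: "'n::finite op \<Rightarrow> 'n op" where
  "op_sqrt A = herm_fun (\<lambda>l. complex_of_real (sqrt l)) A"

subsection \<open>Tensor products and marginals\<close>

text \<open>
  With a bijection \<open>f\<close> that rearranges tuples of indices, \<open>reindex f\<close> merely
  reorders and rebrackets tensor factors.
\<close>

definition reindex :: "('m \<Rightarrow> 'n) \<Rightarrow> 'n::finite op \<Rightarrow> 'm::finite op" where
  "reindex f M = (\<chi> i j. M $ f i $ f j)"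

definition ptrace1 :: "('x::finite \<times> 'y::finite) op \<Rightarrow> 'y op" where
  "ptrace1 M = (\<chi> i j. \<Sum>x\<in>UNIV. M $ (x, i) $ (x, j))"

text \<open>The operator \<open>1 \<otimes> M\<close>.\<close>

definition id_tensor :: "'y::finite op \<Rightarrow> ('x::finite \<times> 'y) op" where
  "id_tensor M = (\<chi> i j. if fst i = fst j then M $ snd i $ snd j else 0)"

subsection \<open>Entropic quantities\<close>

definition vn_entropy :: "'n::finite op \<Rightarrow> real" where
  "vn_entropy \<rho> = - Re (trace (\<rho> ** op_log \<rho>))"

text \<open>\<open>I(A:B|C)\<close> of an operator on \<open>ABC\<close>.\<close>

definition cond_mutual_info ::
  "(('a::finite \<times> 'b::finite) \<times> 'c::finite) op \<Rightarrow> real" where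
  "cond_mutual_info \<rho> =
     vn_entropy (ptrace1 (reindex (\<lambda>(b, (a, c)). ((a, b), c)) \<rho>))
     + vn_entropy (ptrace1 (reindex (\<lambda>(a, (b, c)). ((a, b), c)) \<rho>))
     - vn_entropy \<rho>
     - vn_entropy (ptrace1 \<rho>)"

text \<open>
  \<open>I(A1:A2:A3|C)\<close>: in the second summand, the product of \<open>A1\<close> and \<open>A2\<close> is a single system.
\<close>

definition cond_multi_info ::
  "((('a1::finite \<times> 'a2::finite) \<times> 'a3::finite) \<times> 'c::finite) op \<Rightarrow> real" where
  "cond_multi_info \<rho> =
     cond_mutual_info (ptrace1 (reindex (\<lambda>(a3, ((a1, a2), c)). (((a1, a2), a3), c)) \<rho>))
     + cond_mutual_info \<rho>"

definition povm :: "nat \<Rightarrow> (nat \<Rightarrow> 'n::finite op) \<Rightarrow> bool" where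
  "povm n M \<longleftrightarrow> (\<forall>z<n. psd (M z)) \<and> (\<Sum>z<n. M z) = mat 1"

definition kl_term :: "real \<Rightarrow> real \<Rightarrow> ereal" where
  "kl_term p q = (if p = 0 then 0 else if q = 0 then \<infinity> else ereal (p * ln (p / q)))"

definition measured_rel_entropy :: "'n::finite op \<Rightarrow> 'n op \<Rightarrow> ereal" where
  "measured_rel_entropy \<rho> \<sigma> =
     Sup {\<Sum>z<n. kl_term (Re (trace (\<rho> ** M z))) (Re (trace (\<sigma> ** M z))) | n M. povm n M}"

definition trace_norm :: "'n::finite op \<Rightarrow> real" where
  "trace_norm X = Re (trace (op_sqrt (cadj X ** X)))"

definition fidelity :: "'n::finite op \<Rightarrow> 'n op \<Rightarrow> real" where
  "fidelity \<rho> \<sigma> = (trace_norm (op_sqrt \<rho> ** op_sqrt \<sigma>))\<^sup>2"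

subsection \<open>Recovery maps\<close>

text \<open>
  For an operator \<open>\<sigma>\<close> on \<open>AC\<close>, the map \<open>C \<rightarrow> AC\<close> given by
  \<open>\<sigma>\<^sub>A\<^sub>C\<^bsup>(1+it)/2\<^esup> \<sigma>\<^sub>C\<^bsup>-(1+it)/2\<^esup> X \<sigma>\<^sub>C\<^bsup>-(1-it)/2\<^esup> \<sigma>\<^sub>A\<^sub>C\<^bsup>(1-it)/2\<^esup>\<close>,
  acting as the identity on a further system \<open>S\<close>.
\<close>

definition recovery ::
  "('a::finite \<times> 'c::finite) op \<Rightarrow> real \<Rightarrow> ('s::finite \<times> 'c) op \<Rightarrow> (('s \<times> 'a) \<times> 'c) op" where
  "recovery \<sigma> t X =
     (let z = (1 + \<i> * complex_of_real t) / 2;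
          w = (1 - \<i> * complex_of_real t) / 2;
          Y = id_tensor (op_power (ptrace1 \<sigma>) (- z)) ** X ** id_tensor (op_power (ptrace1 \<sigma>) (- w))
      in reindex (\<lambda>((s, a), c). (s, (a, c))) (id_tensor (op_power \<sigma> z))
         ** reindex (\<lambda>((s, a), c). (a, (s, c))) (id_tensor Y)
         ** reindex (\<lambda>((s, a), c). (s, (a, c))) (id_tensor (op_power \<sigma> w)))"

text \<open>
  The recovery map for \<open>A3\<close> after that for \<open>A2\<close>, applied to the marginal of \<open>\<rho>\<close> on \<open>A1 C\<close>.
\<close>

definition recovered ::
  "((('a1::finite \<times> 'a2::finite) \<times> 'a3::finite) \<times> 'c::finite) op \<Rightarrow> real
    \<Rightarrow> ((('a1 \<times> 'a2) \<times> 'a3) \<times> 'c) op" where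
  "recovered \<rho> t =
     (let \<rho>\<^sub>1 = ptrace1 (reindex (\<lambda>((a2, a3), (a1, c)). (((a1, a2), a3), c)) \<rho>);
          \<rho>\<^sub>2 = ptrace1 (reindex (\<lambda>((a1, a3), (a2, c)). (((a1, a2), a3), c)) \<rho>);
          \<rho>\<^sub>3 = ptrace1 (reindex (\<lambda>((a1, a2), (a3, c)). (((a1, a2), a3), c)) \<rho>)
      in recovery \<rho>\<^sub>3 t (recovery \<rho>\<^sub>2 t \<rho>\<^sub>1))"

definition \<beta>\<^sub>0 :: "real \<Rightarrow> real" where
  "\<beta>\<^sub>0 t = pi / 2 * inverse (cosh (pi * t) + 1)"

definition mean_recovered ::
  "((('a1::finite \<times> 'a2::finite) \<times> 'a3::finite) \<times> 'c::finite) op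
    \<Rightarrow> ((('a1 \<times> 'a2) \<times> 'a3) \<times> 'c) op" where
  "mean_recovered \<rho> = (LINT t|lborel. \<beta>\<^sub>0 t *\<^sub>R recovered \<rho> t)"

text \<open>
  The logarithm of a fidelity can be \<open>-\<infinity>\<close>, so it is integrated in the extended reals,
  as the difference of the integrals of the positive and negative parts
  (\<open>e2ennreal\<close> maps negative numbers to \<open>0\<close>).
\<close>

definition ln_ext :: "real \<Rightarrow> ereal" where
  "ln_ext x = (if x = 0 then -\<infinity> else ereal (ln x))"

definition ext_integral :: "(real \<Rightarrow> ereal) \<Rightarrow> ereal" where
  "ext_integral f =
     enn2ereal (\<integral>\<^sup>+t. e2ennreal (f t) \<partial>lborel) - enn2ereal (\<integral>\<^sup>+t. e2ennreal (- f t) \<partial>lborel)"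

definition mean_log_fidelity ::
  "((('a1::finite \<times> 'a2::finite) \<times> 'a3::finite) \<times> 'c::finite) op \<Rightarrow> ereal" where
  "mean_log_fidelity \<rho> = ext_integral (\<lambda>t. ereal (\<beta>\<^sub>0 t) * ln_ext (fidelity \<rho> (recovered \<rho> t)))"

subsection \<open>Reordering the systems \<open>A1\<close>, \<open>A2\<close>, \<open>A3\<close>\<close>

definition order132 ::
  "((('a1::finite \<times> 'a2::finite) \<times> 'a3::finite) \<times> 'c::finite) op
    \<Rightarrow> ((('a1 \<times> 'a3) \<times> 'a2) \<times> 'c) op" where
  "order132 = reindex (\<lambda>(((a1, a3), a2), c). (((a1, a2), a3), c))"

definition order213 ::
  "((('a1::finite \<times> 'a2::finite) \<times> 'a3::finite) \<times> 'c::finite) op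
    \<Rightarrow> ((('a2 \<times> 'a1) \<times> 'a3) \<times> 'c) op" where
  "order213 = reindex (\<lambda>(((a2, a1), a3), c). (((a1, a2), a3), c))"

definition order231 ::
  "((('a1::finite \<times> 'a2::finite) \<times> 'a3::finite) \<times> 'c::finite) op
    \<Rightarrow> ((('a2 \<times> 'a3) \<times> 'a1) \<times> 'c) op" where
  "order231 = reindex (\<lambda>(((a2, a3), a1), c). (((a1, a2), a3), c))"

definition order312 ::
  "((('a1::finite \<times> 'a2::finite) \<times> 'a3::finite) \<times> 'c::finite) op
    \<Rightarrow> ((('a3 \<times> 'a1) \<times> 'a2) \<times> 'c) op" where
  "order312 = reindex (\<lambda>(((a3, a1), a2), c). (((a1, a2), a3), c))"

definition order321 ::
  "((('a1::finite \<times> 'a2::finite) \<times> 'a3::finite) \<times> 'c::finite) op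
    \<Rightarrow> ((('a3 \<times> 'a2) \<times> 'a1) \<times> 'c) op" where
  "order321 = reindex (\<lambda>(((a3, a2), a1), c). (((a1, a2), a3), c))"

end

theory Submission
  imports Defs "HOL-Complex_Analysis.Residue_Theorem" "HOL-Real_Asymp.Real_Asymp"
begin

text \<open>
  The bounds come from a three-lines argument, differentiated at the boundary. For weights \<open>\<lambda>\<^sub>k\<close> and a
  POVM \<open>M\<close> put
  \<open>f(z) = \<Sum>\<^sub>k exp(\<lambda>\<^sub>k z/2) tr (\<rho>\<^bsup>1-z/2\<^esup> M\<^sub>k K(z))\<close>, where
  \<open>K(z) = \<rho>\<^sub>3\<^bsup>z/2\<^esup> \<rho>\<^sub>C\<^bsup>-z/2\<^esup> \<rho>\<^sub>2\<^bsup>z/2\<^esup> \<rho>\<^sub>C\<^bsup>-z/2\<^esup> \<rho>\<^sub>1\<^bsup>z/2\<^esup>\<close>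
  and \<open>\<rho>\<^sub>j\<close> is the marginal on \<open>A\<^sub>j C\<close>. Then \<open>f(0) = 1\<close>, \<open>|f| \<le> 1\<close> on \<open>Re z = 0\<close>,
  \<open>2 Re f'(0) = \<Sum>\<^sub>k \<lambda>\<^sub>k tr(\<rho> M\<^sub>k) - I(A\<^sub>1:A\<^sub>2:A\<^sub>3|C)\<close>, and \<open>K(1+it) K(1+it)\<^sup>*\<close> is the recovered
  state. Since \<open>\<beta>\<^sub>0\<close> is the normal derivative at \<open>0\<close> of the Poisson kernel of the strip,
  \<open>Re f'(0) \<le> \<integral> \<beta>\<^sub>0(t) ln |f(1+it)| dt\<close>. By the Cauchy-Schwarz inequality
  \<open>|f(1+it)|\<^sup>2 \<le> \<Sum>\<^sub>k exp(\<lambda>\<^sub>k) tr(M\<^sub>k K K\<^sup>*)\<close>, and Jensen's inequality with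
  \<open>\<lambda>\<^sub>k = ln (p\<^sub>k/q\<^sub>k)\<close> gives the first bound; for the trivial POVM with \<open>\<lambda> = 0\<close>,
  \<open>|f(1+it)|\<^sup>2\<close> is at most the fidelity, which gives the second.
\<close>

subsection \<open>The density \<open>\<beta>\<^sub>0\<close>\<close>

text \<open>Two obstacles shape the proof. First, the marginals may be singular. Since
  \<open>0 powr z = 0\<close>, \<open>op_power A 0\<close> is the support projection of
  \<open>A\<close> and not the identity; the value and the derivative at 0 come out right only
  because the support of \<rho> lies in the support of every embedded marginal. Second, the
  logarithm of |f| on the right edge is not bounded below, and its Poisson integral is not explicit.
  It is replaced by half of ln (|f|^2 + \<epsilon>), and this in turn, by Weierstrass approximation,
  by a polynomial in |f|^2 + \<epsilon>. All functions involved are then finite sums of terms c exp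
  (a z) with real a: entries of complex powers have this form, the frequencies being multiples of
  logarithms of eigenvalues, and products preserve it. For such sums the harmonic extension to the
  strip is elementary, and its derivative at 0 needs only the Fourier transform a / sinh a of the
  density.\<close>

lemma \<beta>\<^sub>0_altdef: "\<beta>\<^sub>0 t = pi / 4 / (cosh (pi * t / 2))\<^sup>2"
proof -
  have "cosh (pi * t) + 1 = 2 * (cosh (pi * t / 2))\<^sup>2"
    using cosh_double_cosh[of "pi * t / 2"] by simp
  then show ?thesis
    by (simp add: \<beta>\<^sub>0_def field_simps)
qed

lemma \<beta>\<^sub>0_pos: "0 < \<beta>\<^sub>0 t"
  by (simp add: \<beta>\<^sub>0_def add_pos_pos)

lemma continuous_\<beta>\<^sub>0: "continuous_on S \<beta>\<^sub>0"
  unfolding \<beta>\<^sub>0_altdef[abs_def] by (intro continuous_intros) auto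

lemma measurable_\<beta>\<^sub>0 [measurable]: "\<beta>\<^sub>0 \<in> borel_measurable borel"
  using continuous_\<beta>\<^sub>0 by (rule borel_measurable_continuous_onI)

text \<open>\<open>tanh (pi t / 2) / 2\<close> is an antiderivative with limits -1/2 and 1/2.
  Because the density is nonnegative, the fundamental theorem on the whole line yields integrability
  along with the value.\<close>

lemma integrable_\<beta>\<^sub>0: "integrable lborel \<beta>\<^sub>0"
  and integral_\<beta>\<^sub>0: "integral\<^sup>L lborel \<beta>\<^sub>0 = 1"
proof -
  let ?F = "\<lambda>t. tanh (pi / 2 * t) / 2"
  have deriv: "DERIV ?F t :> \<beta>\<^sub>0 t" for t
  proof -
    have "DERIV ?F t :> (1 - tanh (pi / 2 * t) ^ 2) * (pi / 2) / 2"
      by (auto intro!: derivative_eq_intros)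
    moreover have "1 - tanh (pi / 2 * t) ^ 2 = 1 / (cosh (pi / 2 * t))\<^sup>2"
    proof -
      have "1 - S / C = 1 / C" if "C = S + 1" "C > 0" for S C :: real
        using that by (simp add: field_simps)
      from this[OF cosh_square_eq] show ?thesis
        by (simp add: tanh_def power_divide)
    qed
    then have "(1 - tanh (pi / 2 * t) ^ 2) * (pi / 2) / 2 = \<beta>\<^sub>0 t"
      by (simp add: \<beta>\<^sub>0_altdef)
    ultimately show ?thesis by simp
  qed
  have top: "(?F \<longlongrightarrow> 1 / 2) at_top"
    by (intro tendsto_divide filterlim_compose[OF tanh_real_at_top]
        filterlim_tendsto_pos_mult_at_top[OF tendsto_const] tendsto_const filterlim_ident) auto
  have bot: "(?F \<longlongrightarrow> - 1 / 2) at_bot"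
    by (intro tendsto_divide filterlim_compose[OF tanh_real_at_bot]
        filterlim_tendsto_pos_mult_at_bot[OF tendsto_const] tendsto_const filterlim_ident) auto
  have A: "((?F \<circ> real_of_ereal) \<longlongrightarrow> - 1 / 2) (at_right (-\<infinity>))"
    and B: "((?F \<circ> real_of_ereal) \<longlongrightarrow> 1 / 2) (at_left \<infinity>)"
    using top bot by (simp_all add: ereal_tendsto_simps1)
  have cont: "isCont \<beta>\<^sub>0 x" for x
    using continuous_\<beta>\<^sub>0[of UNIV] by (simp add: continuous_on_eq_continuous_at)
  have ge: "AE x in lborel. -\<infinity> < ereal x \<longrightarrow> ereal x < \<infinity> \<longrightarrow> 0 \<le> \<beta>\<^sub>0 x"
    by (simp add: \<beta>\<^sub>0_pos less_imp_le)
  note * = interval_integral_FTC_nonneg[where F = ?F and f = \<beta>\<^sub>0, OF _ deriv cont ge A B, simplified]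
  show "integrable lborel \<beta>\<^sub>0"
    using *(1) by (simp add: set_integrable_def)
  show "integral\<^sup>L lborel \<beta>\<^sub>0 = 1"
    using *(2) by (simp add: interval_integral_to_infinity_eq interval_lebesgue_integral_def
        set_lebesgue_integral_def)
qed

lemma integrable_\<beta>\<^sub>0_bounded:
  fixes g :: "real \<Rightarrow> 'b::euclidean_space"
  assumes "continuous_on UNIV g" "\<And>t. norm (g t) \<le> B"
  shows "integrable lborel (\<lambda>t. \<beta>\<^sub>0 t *\<^sub>R g t)"
proof (rule Bochner_Integration.integrable_bound[of _ "\<lambda>t. B * \<beta>\<^sub>0 t"])
  show "integrable lborel (\<lambda>t. B * \<beta>\<^sub>0 t)"
    by (simp add: integrable_\<beta>\<^sub>0)
  show "(\<lambda>t. \<beta>\<^sub>0 t *\<^sub>R g t) \<in> borel_measurable lborel"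
    using assms(1) continuous_\<beta>\<^sub>0
    by (auto intro!: borel_measurable_continuous_onI continuous_intros)
  have B: "0 \<le> B"
    using assms(2)[of 0] norm_ge_zero order_trans by blast
  show "AE t in lborel. norm (\<beta>\<^sub>0 t *\<^sub>R g t) \<le> norm (B * \<beta>\<^sub>0 t)"
    using assms(2) B by (auto simp: abs_mult mult.commute[of B] intro!: mult_left_mono)
qed

text \<open>Contour integration only controls integrals over \<open>[-n, n]\<close>; dominated
  convergence identifies their limit with the Lebesgue integral.\<close>

lemma integral_symmetric_limit:
  fixes f :: "real \<Rightarrow> 'b::euclidean_space"
  assumes "integrable lborel f"
  shows "(\<lambda>n. integral {- real n..real n} f) \<longlonglongrightarrow> integral\<^sup>L lborel f"
proof -
  have eq: "integral {- real n..real n} f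
      = (LINT t|lborel. indicator {- real n..real n} t *\<^sub>R f t)" for n
  proof -
    have "set_integrable lborel {- real n..real n} f"
      unfolding set_integrable_def using assms by (intro integrable_mult_indicator) auto
    from set_borel_integral_eq_integral(2)[OF this] show ?thesis
      by (simp add: set_lebesgue_integral_def)
  qed
  show ?thesis
    unfolding eq
  proof (rule integral_dominated_convergence[where w = "\<lambda>t. norm (f t)"])
    show "f \<in> borel_measurable lborel"
      using assms by auto
    then show "(\<lambda>t. indicator {- real n..real n} t *\<^sub>R f t) \<in> borel_measurable lborel" for n
      by measurable
    show "integrable lborel (\<lambda>t. norm (f t))"
      using assms by simp
    show "AE t in lborel. (\<lambda>n. indicator {- real n..real n} t *\<^sub>R f t) \<longlonglongrightarrow> f t"
    proof (rule AE_I2)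
      fix t
      obtain N where N: "\<bar>t\<bar> \<le> real N"
        using real_arch_simple by blast
      have "indicator {- real n..real n} t *\<^sub>R f t = f t" if "n \<ge> N" for n
        using that N by (auto simp: indicator_def)
      then show "(\<lambda>n. indicator {- real n..real n} t *\<^sub>R f t) \<longlonglongrightarrow> f t"
        by (intro tendsto_eventually eventually_sequentiallyI[of N]) auto
    qed
    show "AE t in lborel. norm (indicator {- real n..real n} t *\<^sub>R f t) \<le> norm (f t)" for n
      by (auto simp: indicator_def)
  qed
qed

text \<open>
  Integrate \<open>sinh (a z) / sin\<^sup>2 (\<pi> z / 2)\<close> around the rectangle with corners \<open>\<plusminus>1 \<plusminus> \<i> n\<close>;
  the function is odd, so that both vertical sides contribute the same.
\<close>

lemma fourier_\<beta>\<^sub>0: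
  fixes a :: real
  assumes "a \<noteq> 0"
  shows "(LINT t|lborel. \<beta>\<^sub>0 t * cos (a * t)) = a / sinh a"
    and "(LINT t|lborel. \<beta>\<^sub>0 t * sin (a * t)) = 0"
proof -
  \<comment> \<open>On Re z = 1 the sine becomes \<open>cosh (pi t / 2)\<close>, so the factor
    \<open>pi / 4\<close> turns the quotient into the density times
    \<open>sinh (a z)\<close>.\<close>
  define \<phi> where "\<phi> z = sinh (of_real a * z) * (pi / 4) / (sin (pi * z / 2))\<^sup>2" for z :: complex
  have \<phi>_minus: "\<phi> (- z) = - \<phi> z" for z
    by (simp add: \<phi>_def)
  have \<phi>_one: "\<phi> (Complex 1 t) = of_real (\<beta>\<^sub>0 t) * sinh (Complex a (a * t))" for t
  proof -
    have "sin (pi * Complex 1 t / 2) = cos (\<i> * of_real (pi * t / 2))"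
    proof -
      have eq: "pi * Complex 1 t / 2 = of_real (pi / 2) + \<i> * of_real (pi * t / 2)"
        by (simp add: complex_eq_iff)
      show ?thesis
        unfolding eq sin_add sin_of_real cos_of_real by simp
    qed
    also have "\<dots> = of_real (cosh (pi * t / 2))"
      by (simp only: cosh_real[symmetric] cosh_field_def exp_minus)
    finally have "(sin (pi * Complex 1 t / 2))\<^sup>2 = of_real ((cosh (pi * t / 2))\<^sup>2)" by simp
    moreover have "of_real a * Complex 1 t = Complex a (a * t)"
      by (simp add: complex_eq_iff)
    ultimately show ?thesis
      by (simp add: \<phi>_def \<beta>\<^sub>0_altdef)
  qed
  have sin_zero: "z = 0" if sin0: "sin (pi * z / 2) = 0" and Re: "\<bar>Re z\<bar> < 2" for z :: complex
  proof -
    obtain n :: int where n: "pi * z / 2 = of_real (of_int n * pi)"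
      using sin0 unfolding Complex_Transcendental.sin_eq_0 by blast
    then have "z = 2 * of_int n"
      by (simp add: field_simps)
    with Re show ?thesis by (cases "n = 0") auto
  qed
  \<comment> \<open>The zeros of \<open>sin (pi z / 2)\<close> are the even integers, so in this
    strip 0 is the only singularity. It is a simple pole, as the zero of sinh cancels one order of
    the double zero below.\<close>
  let ?S = "{z. - 2 < Re z \<and> Re z < 2}"
  have S: "open ?S" "connected ?S"
  proof -
    have eq: "?S = {z. - 2 < Re z} \<inter> {z. Re z < 2}" by auto
    show "open ?S" unfolding eq by (intro open_Int open_halfspace_Re_gt open_halfspace_Re_lt)
    have "convex ?S" unfolding eq by (intro convex_Int convex_halfspace_Re_gt convex_halfspace_Re_lt)
    then show "connected ?S" by (rule convex_connected)
  qed
  have holo: "\<phi> holomorphic_on ?S - {0}"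
    unfolding \<phi>_def sinh_field_def using sin_zero by (intro holomorphic_intros) (auto simp: abs_less_iff)
  have residue: "residue \<phi> 0 = of_real (a / pi)"
  proof (rule residue_simple'[OF S(1) _ holo])
    have sh: "((\<lambda>z. sinh (of_real a * z) / z) \<longlongrightarrow> of_real a) (at (0::complex))"
    proof -
      have "((\<lambda>z. sinh (of_real a * z)) has_field_derivative of_real a) (at (0::complex))"
        by (auto intro!: derivative_eq_intros)
      then show ?thesis by (simp add: has_field_derivative_iff)
    qed
    have sn: "((\<lambda>z. sin (pi * z / 2) / z) \<longlongrightarrow> of_real pi / 2) (at (0::complex))"
    proof -
      have "((\<lambda>z. sin (pi * z / 2)) has_field_derivative of_real pi / 2) (at (0::complex))"
        by (auto intro!: derivative_eq_intros)
      then show ?thesis by (simp add: has_field_derivative_iff)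
    qed
    have lim: "((\<lambda>z. sinh (of_real a * z) / z * (pi / 4) / (sin (pi * z / 2) / z)\<^sup>2) \<longlongrightarrow>
        complex_of_real a * (of_real pi / 4) / (of_real pi / 2)\<^sup>2) (at (0::complex))"
      using tendsto_divide[OF tendsto_mult[OF sh tendsto_const[of "of_real pi / 4"]]
          tendsto_power[OF sn, of 2]] by simp
    have eq: "sinh (of_real a * z) / z * (pi / 4) / (sin (pi * z / 2) / z)\<^sup>2 = \<phi> z * (z - 0)" for z :: complex
    proof (cases "z = 0 \<or> sin (pi * z / 2) = 0")
      case False
      then show ?thesis by (simp add: \<phi>_def power2_eq_square)
    qed (auto simp: \<phi>_def)
    have "complex_of_real a * (of_real pi / 4) / (of_real pi / 2)\<^sup>2 = complex_of_real (a / pi)"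
      by (simp add: power2_eq_square)
    with lim show "((\<lambda>z. \<phi> z * (z - 0)) \<longlongrightarrow> complex_of_real (a / pi)) (at 0)"
      unfolding eq by simp
  qed auto
  define J where "J n = integral {- real n..real n} (\<lambda>t. \<phi> (Complex 1 t))" for n :: nat
  \<comment> \<open>Bound for \<phi> on the horizontal sides: \<open>cosh a\<close> dominates the
    numerator's sinh, and the squared modulus of the sine is at least
    \<open>(exp (pi n) - 2) / 4\<close>.\<close>
  define e where "e n = cosh a * pi / (exp (pi * real n) - 2)" for n :: nat
  have near: "norm (J n - of_real a) \<le> 2 * e n" if "n \<ge> 1" for n
  proof -
    define R where "R = real n"
    have R: "R \<ge> 1" using that by (simp add: R_def)
    define p1 p2 p3 p4 where "p1 = Complex (-1) (-R)" and "p2 = Complex 1 (-R)"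
      and "p3 = Complex 1 R" and "p4 = Complex (-1) R"
    have cont: "continuous_on A \<phi>" if "A \<subseteq> ?S - {0}" for A
      using holomorphic_on_subset[OF holo that] holomorphic_on_imp_continuous_on by blast
    have seg: "closed_segment p1 p2 \<subseteq> ?S - {0}" "closed_segment p2 p3 \<subseteq> ?S - {0}"
      "closed_segment p3 p4 \<subseteq> ?S - {0}" "closed_segment p4 p1 \<subseteq> ?S - {0}"
      using R by (auto simp: p1_def p2_def p3_def p4_def closed_segment_same_Re
          closed_segment_same_Im closed_segment_eq_real_ivl)
    note int = seg[THEN cont, THEN contour_integrable_continuous_linepath]
    have rp: "rectpath p1 p3 = linepath p1 p2 +++ linepath p2 p3 +++ linepath p3 p4 +++ linepath p4 p1"
      by (simp add: rectpath_def p1_def p2_def p3_def p4_def Let_def)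
    have in_cbox: "path_image (rectpath p1 p3) \<subseteq> ?S - {0}"
      using R by (subst path_image_rectpath) (auto simp: p1_def p3_def)
    have "contour_integral (rectpath p1 p3) \<phi>
        = 2 * pi * \<i> * (\<Sum>p\<in>{0}. winding_number (rectpath p1 p3) p * residue \<phi> p)"
    proof (rule Residue_theorem[OF S _ holo])
      show "\<forall>z. z \<notin> ?S \<longrightarrow> winding_number (rectpath p1 p3) z = 0"
      proof (intro allI impI)
        fix z assume z: "z \<notin> ?S"
        have "path_image (rectpath p1 p3) \<subseteq> cbox p1 p3"
          using R by (intro path_image_rectpath_subset_cbox) (auto simp: p1_def p3_def)
        moreover have "z \<notin> cbox p1 p3"
          using z by (auto simp: in_cbox_complex_iff p1_def p3_def)
        ultimately show "winding_number (rectpath p1 p3) z = 0"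
          by (intro winding_number_zero_outside[of _ "cbox p1 p3"]) auto
      qed
    qed (use in_cbox in auto)
    also have "\<dots> = 2 * \<i> * a"
      using R by (simp add: residue winding_number_rectpath in_box_complex_iff p1_def p3_def)
    finally have total: "contour_integral (rectpath p1 p3) \<phi> = 2 * \<i> * a" .
    have right: "contour_integral (linepath p2 p3) \<phi> = \<i> * J n"
      using R unfolding J_def
      by (subst contour_integral_linepath_same_Re[of _ 1]) (auto simp: p2_def p3_def R_def)
    have left: "contour_integral (linepath p4 p1) \<phi> = \<i> * J n"
    proof -
      have "contour_integral (linepath p4 p1) \<phi> = - contour_integral (linepath p1 p4) \<phi>"
        using seg(4) by (intro contour_integral_reverse_linepath cont)
      also have "contour_integral (linepath p1 p4) \<phi>
          = \<i> * integral {- R..R} (\<lambda>t. \<phi> (Complex (-1) t))"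
        using R by (subst contour_integral_linepath_same_Re[of _ "-1"]) (auto simp: p1_def p4_def)
      also have "(\<lambda>t. \<phi> (Complex (-1) t)) = (\<lambda>t. - \<phi> (Complex 1 (- t)))"
        by (auto simp: \<phi>_minus[symmetric] complex_eq_iff intro!: ext arg_cong[of _ _ \<phi>])
      also have "integral {- R..R} (\<lambda>t. - \<phi> (Complex 1 (- t))) = - J n"
        using Henstock_Kurzweil_Integration.integral_reflect_real[of R "- R" "\<lambda>t. \<phi> (Complex 1 t)"]
        by (simp add: J_def R_def)
      finally show ?thesis by simp
    qed
    have bound: "norm (\<phi> z) \<le> e n" if "\<bar>Re z\<bar> \<le> 1" "\<bar>Im z\<bar> = R" for z
    proof -
      have "norm (sinh (of_real a * z)) \<le> cosh a"
      proof -
        have "norm (sinh (of_real a * z)) \<le> (norm (exp (of_real a * z)) + norm (exp (- (of_real a * z)))) / 2"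
          unfolding sinh_field_def norm_divide by (simp only: divide_right_mono norm_triangle_ineq4 norm_numeral zero_le_numeral)
        also have "\<dots> = cosh (a * Re z)"
          by (simp add: cosh_field_def)
        also have "\<dots> = cosh (\<bar>a * Re z\<bar>)" by simp
        also have "\<dots> \<le> cosh \<bar>a\<bar>"
          using that(1) by (subst cosh_real_nonneg_le_iff) (auto simp: abs_mult mult_left_le)
        finally show ?thesis by simp
      qed
      moreover have "norm ((sin (pi * z / 2))\<^sup>2) \<ge> (exp (pi * R) - 2) / 4"
      proof -
        have aux: "(e - 2) / 4 \<le> x" if "4 * x = E - 2 * c" "e \<le> E" "c \<le> 1" for e x E c :: real
          using that by argo
        show ?thesis
        proof (rule aux)
          show "4 * norm ((sin (pi * z / 2))\<^sup>2)
              = (exp (pi * Im z) + exp (- (pi * Im z))) - 2 * cos (pi * Re z)"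
            by (simp add: norm_power norm_sin_squared exp_minus)
          show "exp (pi * R) \<le> exp (pi * Im z) + exp (- (pi * Im z))"
            using that(2) R by (cases "Im z \<ge> 0") auto
        qed simp
      qed
      moreover have "exp (pi * R) - 2 > 0"
        using exp_ge_add_one_self[of "pi * R"] pi_gt3 R
        by (smt (verit) mult_less_cancel_left2 mult_le_cancel_left1)
      ultimately have "norm (\<phi> z) \<le> cosh a * (pi / 4) / ((exp (pi * R) - 2) / 4)"
        unfolding \<phi>_def norm_divide norm_mult by (intro frac_le mult_mono) auto
      then show ?thesis by (simp add: e_def R_def)
    qed
    have e0: "0 \<le> e n"
      using order_trans[OF norm_ge_zero bound[of "Complex 0 R"]] R by simp
    have b1: "norm (contour_integral (linepath p1 p2) \<phi>) \<le> e n * 2"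
    proof -
      have "norm (contour_integral (linepath p1 p2) \<phi>) \<le> e n * norm (p2 - p1)"
        using int(1) e0
      proof (rule contour_integral_bound_linepath)
        fix z assume "z \<in> closed_segment p1 p2"
        then show "norm (\<phi> z) \<le> e n"
          using R by (intro bound) (auto simp: p1_def p2_def closed_segment_same_Im closed_segment_eq_real_ivl)
      qed
      also have "p2 - p1 = 2" by (simp add: p1_def p2_def complex_eq_iff)
      finally show ?thesis by simp
    qed
    have b3: "norm (contour_integral (linepath p3 p4) \<phi>) \<le> e n * 2"
    proof -
      have "norm (contour_integral (linepath p3 p4) \<phi>) \<le> e n * norm (p4 - p3)"
        using int(3) e0
      proof (rule contour_integral_bound_linepath)
        fix z assume "z \<in> closed_segment p3 p4"
        then show "norm (\<phi> z) \<le> e n"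
          using R by (intro bound) (auto simp: p3_def p4_def closed_segment_same_Im closed_segment_eq_real_ivl)
      qed
      also have "p4 - p3 = - 2" by (simp add: p3_def p4_def complex_eq_iff)
      finally show ?thesis by simp
    qed
    have "2 * \<i> * a = contour_integral (linepath p1 p2) \<phi> + (\<i> * J n
        + (contour_integral (linepath p3 p4) \<phi> + \<i> * J n))"
      unfolding total[symmetric] rp using int by (simp add: right left)
    then have "2 * \<i> * (J n - a) = - (contour_integral (linepath p1 p2) \<phi> + contour_integral (linepath p3 p4) \<phi>)"
      by (simp add: algebra_simps)
    then have "norm (2 * \<i> * (J n - a)) \<le> e n * 2 + e n * 2"
      using b1 b3 by (metis norm_minus_cancel norm_triangle_mono)
    then show ?thesis by (simp add: norm_mult)
  qed
  have "e \<longlonglongrightarrow> 0"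
    unfolding e_def by real_asymp
  then have "(\<lambda>n. 2 * e n) \<longlonglongrightarrow> 0"
    by (rule tendsto_mult_right_zero)
  then have "(\<lambda>n. J n - of_real a) \<longlonglongrightarrow> 0"
    by (rule Lim_null_comparison[rotated]) (use near in \<open>auto simp: eventually_sequentially\<close>)
  then have J1: "J \<longlonglongrightarrow> of_real a"
    by (simp add: LIM_zero_iff)
  \<comment> \<open>This is the density times \<open>sinh (a + i a t)\<close>, split into real and
    imaginary part. Its integral is the real number \<open>a\<close>, so the real part gives the
    cosine integral and the imaginary part the sine integral.\<close>
  let ?g = "\<lambda>t. \<beta>\<^sub>0 t *\<^sub>R Complex (sinh a * cos (a * t)) (cosh a * sin (a * t))"
  have integrable: "integrable lborel ?g"
  proof (rule integrable_\<beta>\<^sub>0_bounded)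
    show "continuous_on UNIV (\<lambda>t. Complex (sinh a * cos (a * t)) (cosh a * sin (a * t)))"
      unfolding Complex_eq by (intro continuous_intros)
    fix t
    have "norm (Complex (sinh a * cos (a * t)) (cosh a * sin (a * t)))
        \<le> \<bar>sinh a * cos (a * t)\<bar> + \<bar>cosh a * sin (a * t)\<bar>"
      using cmod_le[of "Complex (sinh a * cos (a * t)) (cosh a * sin (a * t))"] by simp
    also have "\<dots> \<le> \<bar>sinh a\<bar> + \<bar>cosh a\<bar>"
      by (intro add_mono) (auto simp: abs_mult mult_left_le)
    finally show "norm (Complex (sinh a * cos (a * t)) (cosh a * sin (a * t))) \<le> \<bar>sinh a\<bar> + \<bar>cosh a\<bar>" .
  qed
  have "(\<lambda>t. \<phi> (Complex 1 t)) = ?g"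
    by (auto simp: \<phi>_one complex_eq_iff fun_eq_iff sinh_field_def cosh_field_def Re_exp Im_exp algebra_simps)
  then have "J \<longlonglongrightarrow> integral\<^sup>L lborel ?g"
    using integral_symmetric_limit[OF integrable] by (simp add: J_def[abs_def])
  with J1 have eq: "integral\<^sup>L lborel ?g = of_real a"
    using LIMSEQ_unique by blast
  have "sinh a * (LINT t|lborel. \<beta>\<^sub>0 t * cos (a * t)) = (LINT t|lborel. \<beta>\<^sub>0 t * (sinh a * cos (a * t)))"
    by (subst Bochner_Integration.integral_mult_right_zero[symmetric]) (simp add: mult.left_commute)
  also have "\<dots> = Re (integral\<^sup>L lborel ?g)"
    using integral_Re[OF integrable] by simp
  finally show "(LINT t|lborel. \<beta>\<^sub>0 t * cos (a * t)) = a / sinh a"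
    using assms unfolding eq by (simp add: eq_divide_eq mult.commute)
  have "cosh a * (LINT t|lborel. \<beta>\<^sub>0 t * sin (a * t)) = (LINT t|lborel. \<beta>\<^sub>0 t * (cosh a * sin (a * t)))"
    by (subst Bochner_Integration.integral_mult_right_zero[symmetric]) (simp add: mult.left_commute)
  also have "\<dots> = Im (integral\<^sup>L lborel ?g)"
    using integral_Im[OF integrable] by simp
  finally show "(LINT t|lborel. \<beta>\<^sub>0 t * sin (a * t)) = 0"
    unfolding eq by simp
qed

subsection \<open>Exponential sums in the strip\<close>

text \<open>Real frequencies make these entire functions bounded on vertical strips. The class
  contains the entries of complex powers of psd matrices and is stable under everything done to them
  below.\<close>

inductive exp_sum :: "(complex \<Rightarrow> complex) \<Rightarrow> bool" where
  exp_sum_term: "exp_sum (\<lambda>z. c * exp (complex_of_real a * z))"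
| exp_sum_add: "exp_sum f \<Longrightarrow> exp_sum g \<Longrightarrow> exp_sum (\<lambda>z. f z + g z)"

lemma exp_sum_const: "exp_sum (\<lambda>z. c)"
  using exp_sum_term[of c 0] by simp

lemma exp_sum_cmult: "exp_sum f \<Longrightarrow> exp_sum (\<lambda>z. c * f z)"
proof (induction rule: exp_sum.induct)
  case (exp_sum_term d a)
  show ?case using exp_sum.exp_sum_term[of "c * d" a] by (simp add: mult.assoc)
next
  case (exp_sum_add f g)
  then show ?case using exp_sum.exp_sum_add by (simp add: distrib_left)
qed

lemma exp_sum_mult: "exp_sum f \<Longrightarrow> exp_sum g \<Longrightarrow> exp_sum (\<lambda>z. f z * g z)"
proof (induction rule: exp_sum.induct)
  case (exp_sum_term c a)
  from this show ?case
  proof (induction rule: exp_sum.induct)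
    case (exp_sum_term d b)
    have "(\<lambda>z. c * exp (of_real a * z) * (d * exp (of_real b * z)))
        = (\<lambda>z. c * d * exp (of_real (a + b) * z))"
      by (simp add: fun_eq_iff ring_distribs exp_add mult_ac)
    then show ?case using exp_sum.exp_sum_term[of "c * d" "a + b"] by simp
  next
    case (exp_sum_add f g)
    then show ?case using exp_sum.exp_sum_add by (simp add: distrib_left)
  qed
next
  case (exp_sum_add f h)
  then show ?case using exp_sum.exp_sum_add by (simp add: distrib_right)
qed

lemma exp_sum_sum: "(\<And>i. i \<in> S \<Longrightarrow> exp_sum (f i)) \<Longrightarrow> exp_sum (\<lambda>z. \<Sum>i\<in>S. f i z)"
  by (induction S rule: infinite_finite_induct) (auto intro: exp_sum_const exp_sum_add)

lemma exp_sum_power: "exp_sum f \<Longrightarrow> exp_sum (\<lambda>z. f z ^ n)"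
  by (induction n) (auto intro: exp_sum_const exp_sum_mult)

lemma exp_sum_shift: "exp_sum f \<Longrightarrow> exp_sum (\<lambda>z. f (1 + z))"
proof (induction rule: exp_sum.induct)
  case (exp_sum_term c a)
  show ?case
    using exp_sum.exp_sum_term[of "c * exp (of_real a)" a] by (simp add: distrib_left exp_add mult_ac)
qed (rule exp_sum_add)

text \<open>The reflection \<open>- cnj z\<close> fixes the imaginary axis, so multiplying
  \<open>f\<close> by this function gives a holomorphic function equal to |f|^2 on that
  axis.\<close>

lemma exp_sum_cnj: "exp_sum f \<Longrightarrow> exp_sum (\<lambda>z. cnj (f (- cnj z)))"
proof (induction rule: exp_sum.induct)
  case (exp_sum_term c a)
  show ?case
    using exp_sum.exp_sum_term[of "cnj c" "- a"] by (simp add: exp_cnj)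
next
  case (exp_sum_add f g)
  then show ?case using exp_sum.exp_sum_add by simp
qed

lemma exp_sum_holomorphic: "exp_sum f \<Longrightarrow> f holomorphic_on S"
  by (induction rule: exp_sum.induct) (auto intro!: holomorphic_intros)

lemma exp_sum_bounded:
  "exp_sum f \<Longrightarrow> \<exists>B. \<forall>z. 0 \<le> Re z \<longrightarrow> Re z \<le> 1 \<longrightarrow> norm (f z) \<le> B"
proof (induction rule: exp_sum.induct)
  case (exp_sum_term c a)
  have "norm (c * exp (of_real a * z)) \<le> norm c * exp \<bar>a\<bar>" if "0 \<le> Re z" "Re z \<le> 1" for z
  proof -
    have "a * Re z \<le> \<bar>a\<bar> * 1"
      using that by (intro mult_mono) auto
    then show ?thesis by (simp add: norm_mult mult_left_mono)
  qed
  then show ?case by blast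
next
  case (exp_sum_add f g)
  then obtain B C where
    B: "\<And>z. 0 \<le> Re z \<Longrightarrow> Re z \<le> 1 \<Longrightarrow> norm (f z) \<le> B" and
    C: "\<And>z. 0 \<le> Re z \<Longrightarrow> Re z \<le> 1 \<Longrightarrow> norm (g z) \<le> C"
    by blast
  have "norm (f z + g z) \<le> B + C" if "0 \<le> Re z" "Re z \<le> 1" for z
    using norm_triangle_mono[OF B C, of z z] that by simp
  then show ?case by blast
qed

text \<open>
  The Poisson integral of trigonometric boundary data is explicit: \<open>cos (a t)\<close> extends to the real
  part of \<open>sinh (a z) / sinh a\<close>, and \<open>- sin (a t)\<close> to that of \<open>\<i> (cosh (a z) - 1) / sinh a\<close>.
\<close>

lemma exp_sum_extension:
  "exp_sum k \<Longrightarrow> \<exists>h d B. h holomorphic_on UNIV \<and> h 0 = 0 \<and> (h has_field_derivative d) (at 0)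
    \<and> (\<forall>t. Re (h (\<i> * of_real t)) = 0) \<and> (\<forall>t. Re (h (1 + \<i> * of_real t)) = Re (k (\<i> * of_real t)))
    \<and> (\<forall>z. 0 \<le> Re z \<longrightarrow> Re z \<le> 1 \<longrightarrow> \<bar>Re (h z)\<bar> \<le> B)
    \<and> integrable lborel (\<lambda>t. \<beta>\<^sub>0 t * Re (k (\<i> * of_real t)))
    \<and> Re d = (LINT t|lborel. \<beta>\<^sub>0 t * Re (k (\<i> * of_real t)))"
proof (induction rule: exp_sum.induct)
  case (exp_sum_term c a)
  let ?k = "\<lambda>z. c * exp (of_real a * z)"
  have Re_k: "Re (?k (\<i> * of_real t)) = Re c * cos (a * t) - Im c * sin (a * t)" for t
    by (simp add: Re_exp Im_exp)
  have int_cos: "integrable lborel (\<lambda>t. \<beta>\<^sub>0 t * cos (a * t))"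
    using integrable_\<beta>\<^sub>0_bounded[of "\<lambda>t. cos (a * t)" 1] by (simp add: continuous_intros)
  have int_sin: "integrable lborel (\<lambda>t. \<beta>\<^sub>0 t * sin (a * t))"
    using integrable_\<beta>\<^sub>0_bounded[of "\<lambda>t. sin (a * t)" 1] by (simp add: continuous_intros)
  have split: "(\<lambda>t. \<beta>\<^sub>0 t * Re (?k (\<i> * of_real t)))
      = (\<lambda>t. Re c * (\<beta>\<^sub>0 t * cos (a * t)) - Im c * (\<beta>\<^sub>0 t * sin (a * t)))"
    unfolding Re_k by (simp add: fun_eq_iff algebra_simps)
  have int: "integrable lborel (\<lambda>t. \<beta>\<^sub>0 t * Re (?k (\<i> * of_real t)))"
    unfolding split using int_cos int_sin by (intro Bochner_Integration.integrable_diff) auto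
  have integral: "(LINT t|lborel. \<beta>\<^sub>0 t * Re (?k (\<i> * of_real t)))
      = Re c * (LINT t|lborel. \<beta>\<^sub>0 t * cos (a * t)) - Im c * (LINT t|lborel. \<beta>\<^sub>0 t * sin (a * t))"
    unfolding split using int_cos int_sin by (subst Bochner_Integration.integral_diff) auto
  show ?case
  proof (cases "a = 0")
    case True
    \<comment> \<open>At frequency 0 the profile \<open>sinh (a x) / sinh a\<close> degenerates to
      its limit \<open>x\<close>.\<close>
    let ?h = "\<lambda>z. of_real (Re c) * z"
    have mean: "Re (of_real (Re c)) = (LINT t|lborel. \<beta>\<^sub>0 t * Re (?k (\<i> * of_real t)))"
      using True by (simp add: integral integral_\<beta>\<^sub>0)
    have deriv: "(?h has_field_derivative of_real (Re c)) (at 0)"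
      by (auto intro!: derivative_eq_intros)
    have bound: "\<bar>Re (?h z)\<bar> \<le> \<bar>Re c\<bar>" if "0 \<le> Re z" "Re z \<le> 1" for z
      using that by (simp add: abs_mult mult_left_le)
    have right: "Re (?h (1 + \<i> * of_real t)) = Re (?k (\<i> * of_real t))" for t
      using True by simp
    show ?thesis
      by (rule exI[of _ ?h], rule exI[of _ "of_real (Re c)"], rule exI[of _ "\<bar>Re c\<bar>"])
         (use mean deriv bound int right in \<open>auto intro!: holomorphic_intros\<close>)
  next
    case False
    define r where "r = 1 / (2 * sinh a)"
    \<comment> \<open>With these constants
      \<open>h z = (c exp (a z) - cnj c exp (- a z)) / (2 sinh a) + c3\<close>. The constant
      \<open>c3\<close> is purely imaginary: it achieves \<open>h 0 = 0\<close> without changing the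
      real part.\<close>
    define c1 c2 c3 where "c1 = of_real r * Complex (Re c) (Im c)"
      and "c2 = of_real r * Complex (- Re c) (Im c)"
      and "c3 = - (c1 + c2)"
    define h where "h z = c1 * exp (of_real a * z) + (c2 * exp (of_real (- a) * z) + c3)" for z
    have sh: "sinh a \<noteq> 0" using False by simp
    have h: "exp_sum h"
      unfolding h_def by (intro exp_sum.intros exp_sum_const)
    have c3: "Re c3 = 0"
      by (simp add: c3_def c1_def c2_def)
    have Re_h: "Re (h z) = (Re c * cos (a * Im z) - Im c * sin (a * Im z)) * (sinh (a * Re z) / sinh a)" for z
    proof -
      have r1: "Re (c1 * exp (of_real a * z))
          = r * ((Re c * cos (a * Im z) - Im c * sin (a * Im z)) * exp (a * Re z))"
        unfolding c1_def mult.assoc[of "of_real r"] by (simp add: Re_exp Im_exp algebra_simps)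
      have r2: "Re (c2 * exp (of_real (- a) * z))
          = - (r * ((Re c * cos (a * Im z) - Im c * sin (a * Im z)) * exp (- (a * Re z))))"
        unfolding c2_def mult.assoc[of "of_real r"] by (simp add: Re_exp Im_exp algebra_simps)
      have r3: "sinh (a * Re z) / sinh a = r * (exp (a * Re z) - exp (- (a * Re z)))"
        by (simp add: r_def sinh_field_def[of "a * Re z"])
      show ?thesis
        unfolding h_def plus_complex.sel r1 r2 r3 c3 by (simp add: algebra_simps)
    qed
    have left: "Re (h (\<i> * of_real t)) = 0" for t
      by (simp add: Re_h)
    have right: "Re (h (1 + \<i> * of_real t)) = Re (?k (\<i> * of_real t))" for t
      using sh by (simp add: Re_h Re_exp Im_exp)
    have deriv: "(h has_field_derivative (c1 - c2) * of_real a) (at 0)"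
      unfolding h_def by (auto intro!: derivative_eq_intros simp: algebra_simps)
    \<comment> \<open>The imaginary part of \<open>c\<close> cancels in \<open>c1 - c2\<close>,
      matching the vanishing sine integral; what remains is \<open>Re c\<close> times
      \<open>a / sinh a\<close>.\<close>
    have mean: "Re ((c1 - c2) * of_real a) = (LINT t|lborel. \<beta>\<^sub>0 t * Re (?k (\<i> * of_real t)))"
    proof -
      have "c1 - c2 = of_real (Re c / sinh a)"
        by (simp add: c1_def c2_def complex_eq_iff r_def)
      then show ?thesis
        unfolding integral fourier_\<beta>\<^sub>0[OF False] by simp
    qed
    obtain B where B: "\<And>z. 0 \<le> Re z \<Longrightarrow> Re z \<le> 1 \<Longrightarrow> norm (h z) \<le> B"
      using exp_sum_bounded[OF h] by blast
    have bound: "\<bar>Re (h z)\<bar> \<le> B" if "0 \<le> Re z" "Re z \<le> 1" for z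
      using abs_Re_le_cmod[of "h z"] B[OF that] by linarith
    have h0: "h 0 = 0" by (simp add: h_def c3_def)
    show ?thesis
      by (intro exI[of _ h] exI[of _ "(c1 - c2) * of_real a"] exI[of _ B] conjI allI impI
          exp_sum_holomorphic h h0 deriv left right bound int mean)
  qed
next
  case (exp_sum_add f g)
  from exp_sum_add.IH(1) obtain h d B where f: "h holomorphic_on UNIV" "h 0 = 0"
      "(h has_field_derivative d) (at 0)" "\<And>t. Re (h (\<i> * of_real t)) = 0"
      "\<And>t. Re (h (1 + \<i> * of_real t)) = Re (f (\<i> * of_real t))"
      "\<And>z. 0 \<le> Re z \<Longrightarrow> Re z \<le> 1 \<Longrightarrow> \<bar>Re (h z)\<bar> \<le> B"
      "integrable lborel (\<lambda>t. \<beta>\<^sub>0 t * Re (f (\<i> * of_real t)))"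
      "Re d = (LINT t|lborel. \<beta>\<^sub>0 t * Re (f (\<i> * of_real t)))"
    by auto
  from exp_sum_add.IH(2) obtain h' d' B' where g: "h' holomorphic_on UNIV" "h' 0 = 0"
      "(h' has_field_derivative d') (at 0)" "\<And>t. Re (h' (\<i> * of_real t)) = 0"
      "\<And>t. Re (h' (1 + \<i> * of_real t)) = Re (g (\<i> * of_real t))"
      "\<And>z. 0 \<le> Re z \<Longrightarrow> Re z \<le> 1 \<Longrightarrow> \<bar>Re (h' z)\<bar> \<le> B'"
      "integrable lborel (\<lambda>t. \<beta>\<^sub>0 t * Re (g (\<i> * of_real t)))"
      "Re d' = (LINT t|lborel. \<beta>\<^sub>0 t * Re (g (\<i> * of_real t)))"
    by auto
  have bound: "\<bar>Re (h z + h' z)\<bar> \<le> B + B'" if "0 \<le> Re z" "Re z \<le> 1" for z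
    using f(6)[OF that] g(6)[OF that] by simp
  have int: "integrable lborel (\<lambda>t. \<beta>\<^sub>0 t * Re (f (\<i> * of_real t) + g (\<i> * of_real t)))"
    using Bochner_Integration.integrable_add[OF f(7) g(7)] by (simp add: distrib_left)
  have mean: "Re (d + d') = (LINT t|lborel. \<beta>\<^sub>0 t * Re (f (\<i> * of_real t) + g (\<i> * of_real t)))"
    using Bochner_Integration.integral_add[OF f(7) g(7)] f(8) g(8) by (simp add: distrib_left)
  have left: "Re (h (\<i> * of_real t) + h' (\<i> * of_real t)) = 0" for t
    by (simp add: f(4) g(4))
  have right: "Re (h (1 + \<i> * of_real t) + h' (1 + \<i> * of_real t))
      = Re (f (\<i> * of_real t) + g (\<i> * of_real t))" for t
    by (simp only: plus_complex.sel f(5) g(5))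
  have zero: "h 0 + h' 0 = 0" by (simp add: f(2) g(2))
  show ?case
    by (intro exI[of _ "\<lambda>z. h z + h' z"] exI[of _ "d + d'"] exI[of _ "B + B'"] conjI allI impI
        holomorphic_on_add f(1) g(1) zero DERIV_add f(3) g(3) left right bound int mean)
qed

text \<open>Phragmen-Lindelof: the factor \<open>exp (\<eta> (w^2 - 1))\<close> has modulus at most
  1 on the strip and decays like a Gaussian in Im w. Hence the maximum principle applies on a tall
  rectangle, and then \<eta> tends to 0.\<close>

lemma strip_max_principle:
  fixes G :: "complex \<Rightarrow> complex"
  assumes holo: "G holomorphic_on UNIV"
    and bounded: "\<And>w. 0 \<le> Re w \<Longrightarrow> Re w \<le> 1 \<Longrightarrow> norm (G w) \<le> B"
    and left: "\<And>w. Re w = 0 \<Longrightarrow> norm (G w) \<le> 1" and right: "\<And>w. Re w = 1 \<Longrightarrow> norm (G w) \<le> 1"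
    and z: "0 \<le> Re z" "Re z \<le> 1"
  shows "norm (G z) \<le> 1"
proof -
  define c where "c = Re (z\<^sup>2) - 1"
  have le: "norm (G z) * exp (\<eta> * c) \<le> 1" if \<eta>: "\<eta> > 0" for \<eta> :: real
  proof -
    define E where "E w = G w * exp (of_real \<eta> * (w\<^sup>2 - 1))" for w
    have norm_E: "norm (E w) = norm (G w) * exp (\<eta> * ((Re w)\<^sup>2 - (Im w)\<^sup>2 - 1))" for w
      by (simp add: E_def norm_mult power2_eq_square)
    have B: "0 \<le> B"
      using order_trans[OF norm_ge_zero bounded[of 0]] by simp
    have "eventually (\<lambda>R. B * exp (- \<eta> * R\<^sup>2) < 1) at_top"
    proof -
      have "((\<lambda>R. B * exp (- \<eta> * R\<^sup>2)) \<longlongrightarrow> 0) at_top"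
        using \<eta> by real_asymp
      then show ?thesis by (rule order_tendstoD) simp
    qed
    then obtain R0 where R0: "\<And>R. R \<ge> R0 \<Longrightarrow> B * exp (- \<eta> * R\<^sup>2) < 1"
      by (auto simp: eventually_at_top_linorder)
    define R where "R = max R0 (\<bar>Im z\<bar> + 1)"
    let ?S = "cbox (Complex 0 (- R)) (Complex 1 R)"
    have "norm (E z) \<le> 1"
    proof (rule maximum_modulus_frontier[where S = ?S and f = E and \<xi> = z])
      have "E holomorphic_on UNIV"
        unfolding E_def by (intro holomorphic_intros holo)
      then show "E holomorphic_on interior ?S" "continuous_on (closure ?S) E"
        using holomorphic_on_subset holomorphic_on_imp_continuous_on by blast+
      show "bounded ?S" by (rule bounded_cbox)
      show "z \<in> ?S"
        using z by (auto simp: in_cbox_complex_iff R_def)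
      fix w assume w: "w \<in> frontier ?S"
      then have "w \<in> ?S" "w \<notin> box (Complex 0 (- R)) (Complex 1 R)"
        by (auto simp: frontier_cbox)
      then have w: "0 \<le> Re w" "Re w \<le> 1" "Re w = 0 \<or> Re w = 1 \<or> \<bar>Im w\<bar> = R"
        by (auto simp: in_cbox_complex_iff in_box_complex_iff)
      have Rew: "(Re w)\<^sup>2 \<le> 1"
        using w by (simp add: power_le_one)
      from w(3) consider "Re w = 0 \<or> Re w = 1" | "\<bar>Im w\<bar> = R" by blast
      then show "norm (E w) \<le> 1"
      proof cases
        case 1
        then have "norm (G w) \<le> 1" using left right by blast
        moreover have "(Re w)\<^sup>2 - (Im w)\<^sup>2 \<le> 1"
          using Rew zero_le_power2[of "Im w"] by linarith
        then have "exp (\<eta> * ((Re w)\<^sup>2 - (Im w)\<^sup>2 - 1)) \<le> 1"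
          using \<eta> by (simp add: mult_le_0_iff)
        ultimately show ?thesis
          unfolding norm_E by (simp add: mult_le_one)
      next
        case 2
        have "\<eta> * ((Re w)\<^sup>2 - (Im w)\<^sup>2 - 1) \<le> \<eta> * (- R\<^sup>2)"
          using Rew \<eta> 2 by (intro mult_left_mono) (auto simp flip: 2)
        then have "norm (E w) \<le> B * exp (- \<eta> * R\<^sup>2)"
          unfolding norm_E using bounded[OF w(1,2)] B by (intro mult_mono) auto
        also have "\<dots> < 1" by (rule R0) (simp add: R_def)
        finally show ?thesis by simp
      qed
    qed
    then show ?thesis
      by (simp add: norm_E c_def power2_eq_square)
  qed
  have "((\<lambda>\<eta>. norm (G z) * exp (\<eta> * c)) \<longlongrightarrow> norm (G z) * exp (0 * c)) (at_right 0)"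
    by (intro tendsto_intros)
  then have "norm (G z) * exp (0 * c) \<le> 1"
    by (rule tendsto_upperbound)
       (use le in \<open>auto simp: eventually_at_filter\<close>)
  then show ?thesis by simp
qed

text \<open>Dividing \<open>f\<close> by the exponential of a holomorphic \<open>h\<close> whose
  real part is 0 on the left edge and about ln |f| on the right one gives \<open>G\<close> with |G|
  at most 1 and \<open>G 0 = 1\<close>. So \<open>Re G\<close> cannot increase at 0 along the real
  axis, which compares \<open>Re d\<close> with \<open>Re (h' 0)\<close>. The shift by \<epsilon>
  keeps the logarithm finite where \<open>f\<close> vanishes.\<close>

lemma exp_sum_derivative_le:
  assumes f: "exp_sum f" and f0: "f 0 = 1"
    and left: "\<And>t. norm (f (\<i> * of_real t)) \<le> 1"
    and deriv: "((\<lambda>x. f (of_real x)) has_vector_derivative d) (at 0)"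
    and \<epsilon>: "\<epsilon> > 0"
  shows "2 * Re d \<le> (LINT t|lborel. \<beta>\<^sub>0 t * ln ((norm (f (1 + \<i> * of_real t)))\<^sup>2 + \<epsilon>))"
    and "integrable lborel (\<lambda>t. \<beta>\<^sub>0 t * ln ((norm (f (1 + \<i> * of_real t)))\<^sup>2 + \<epsilon>))"
proof -
  define S where "S t = (norm (f (1 + \<i> * of_real t)))\<^sup>2 + \<epsilon>" for t
  \<comment> \<open>The exponential sum that restricts to \<open>S\<close> on the imaginary axis;
    the right edge of the strip has been moved there.\<close>
  define s where "s z = f (1 + z) * cnj (f (1 + - cnj z)) + of_real \<epsilon>" for z
  have s: "exp_sum s"
    unfolding s_def
    by (intro exp_sum_add exp_sum_mult exp_sum_const exp_sum_shift[OF f] exp_sum_cnj[OF exp_sum_shift[OF f]])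
  have s_eq: "s (\<i> * of_real t) = of_real (S t)" for t
    using complex_norm_square[of "f (1 + \<i> * of_real t)"] by (simp add: s_def S_def)
  obtain B where B: "\<And>z. 0 \<le> Re z \<Longrightarrow> Re z \<le> 1 \<Longrightarrow> norm (f z) \<le> B"
    using exp_sum_bounded[OF f] by blast
  define M where "M = B\<^sup>2 + \<epsilon>"
  have S_bounds: "S t \<in> {\<epsilon>..M}" for t
    using B[of "1 + \<i> * of_real t"] by (simp add: S_def M_def power_mono)
  have cont_f: "continuous_on A f" for A
    using exp_sum_holomorphic[OF f] by (rule holomorphic_on_imp_continuous_on)
  have cont_S: "continuous_on UNIV S"
    unfolding S_def
    by (intro continuous_intros continuous_on_compose2[OF cont_f[of UNIV]]) auto
  have S_pos: "S t > 0" for t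
    using S_bounds[of t] \<epsilon> by auto
  have int_ln: "integrable lborel (\<lambda>t. \<beta>\<^sub>0 t * ln (S t))"
  proof -
    have "norm (ln (S t)) \<le> \<bar>ln \<epsilon>\<bar> + \<bar>ln M\<bar>" for t
    proof -
      have "ln \<epsilon> \<le> ln (S t)" "ln (S t) \<le> ln M"
        using S_bounds[of t] \<epsilon> by auto
      then show ?thesis by auto
    qed
    moreover have "continuous_on UNIV (\<lambda>t. ln (S t))"
      using S_pos by (intro continuous_intros cont_S) (auto simp: less_imp_neq[symmetric])
    ultimately show ?thesis
      using integrable_\<beta>\<^sub>0_bounded[of "\<lambda>t. ln (S t)" "\<bar>ln \<epsilon>\<bar> + \<bar>ln M\<bar>"] by simp
  qed
  \<comment> \<open>One \<delta> pays for the factor \<open>exp (- \<delta> z)\<close> in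
    \<open>E\<close>, the other for replacing the polynomial by \<open>ln x / 2\<close> under the
    integral.\<close>
  have approx: "Re d \<le> (LINT t|lborel. \<beta>\<^sub>0 t * ln (S t)) / 2 + 2 * \<delta>" if \<delta>: "\<delta> > 0" for \<delta> :: real
  proof -
    \<comment> \<open>A polynomial in the exponential sum \<open>s\<close> is again an exponential
      sum, so its harmonic extension is available; the logarithm of \<open>s\<close> is not of this
      kind.\<close>
    have "continuous_on {\<epsilon>..M} (\<lambda>x. ln x / 2)"
      using \<epsilon> by (intro continuous_intros) auto
    then obtain p where p: "real_polynomial_function p"
      and p_approx: "\<And>x. x \<in> {\<epsilon>..M} \<Longrightarrow> \<bar>ln x / 2 - p x\<bar> < \<delta>"
      using Stone_Weierstrass_real_polynomial_function[OF compact_Icc _ \<delta>] by metis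
    obtain b n where p_eq: "p = (\<lambda>x. \<Sum>i\<le>n. b i * x ^ i)"
      using p real_polynomial_function_iff_sum by blast
    define k where "k z = (\<Sum>i\<le>n. of_real (b i) * s z ^ i)" for z
    have k: "exp_sum k"
      unfolding k_def by (intro exp_sum_sum exp_sum_cmult exp_sum_power s)
    have k_eq: "k (\<i> * of_real t) = of_real (p (S t))" for t
      by (simp add: k_def p_eq s_eq)
    from exp_sum_extension[OF k] obtain h e C where h: "h holomorphic_on UNIV" "h 0 = 0"
      and h_deriv: "(h has_field_derivative e) (at 0)"
      and h_left: "\<And>t. Re (h (\<i> * of_real t)) = 0"
      and h_right: "\<And>t. Re (h (1 + \<i> * of_real t)) = p (S t)"
      and h_bounded: "\<And>z. 0 \<le> Re z \<Longrightarrow> Re z \<le> 1 \<Longrightarrow> \<bar>Re (h z)\<bar> \<le> C"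
      and int_p: "integrable lborel (\<lambda>t. \<beta>\<^sub>0 t * p (S t))"
      and e: "Re e = (LINT t|lborel. \<beta>\<^sub>0 t * p (S t))"
      unfolding k_eq by auto
    \<comment> \<open>The term \<open>\<delta> z\<close> has modulus-one effect on the left edge and
      contributes \<open>exp (- \<delta>)\<close> on the right edge, just enough to absorb the
      approximation error of \<open>p\<close>.\<close>
    define E where "E z = exp (- h z - of_real \<delta> * z)" for z
    define G where "G z = f z * E z" for z
    have line0: "w = \<i> * of_real (Im w)" if "Re w = 0" for w
      using that by (simp add: complex_eq_iff)
    have line1: "w = 1 + \<i> * of_real (Im w)" if "Re w = 1" for w
      using that by (simp add: complex_eq_iff)
    have G_le: "norm (G z) \<le> 1" if "0 \<le> Re z" "Re z \<le> 1" for z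
    proof (rule strip_max_principle[where G = G])
      show "G holomorphic_on UNIV"
        unfolding G_def E_def by (intro holomorphic_intros exp_sum_holomorphic f h)
      show "norm (G w) \<le> B * exp C" if "0 \<le> Re w" "Re w \<le> 1" for w
      proof -
        have "- Re (h w) \<le> C"
          using h_bounded[OF that] by linarith
        moreover have "0 \<le> \<delta> * Re w" using that \<delta> by simp
        ultimately have "norm (E w) \<le> exp C"
          by (simp add: E_def)
        moreover have "0 \<le> B"
          using B[OF that] norm_ge_zero order_trans by blast
        ultimately show ?thesis
          using B[OF that] by (simp add: G_def norm_mult mult_mono)
      qed
      show "norm (G w) \<le> 1" if "Re w = 0" for w
      proof -
        have "norm (f w) \<le> 1" "Re (h w) = 0"
          using left[of "Im w"] h_left[of "Im w"] line0[OF that] by simp_all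
        then show ?thesis
          using that by (simp add: G_def E_def norm_mult)
      qed
      show "norm (G w) \<le> 1" if w: "Re w = 1" for w
      proof -
        let ?t = "Im w"
        have hw: "Re (h w) = p (S ?t)" and fw: "(norm (f w))\<^sup>2 \<le> S ?t"
          using h_right[of ?t] \<epsilon> line1[OF w] by (simp_all add: S_def)
        have "norm (f w) \<le> sqrt (S ?t)"
          using fw by (simp add: real_le_rsqrt)
        also have "\<dots> = exp (ln (S ?t) / 2)"
          using S_pos[of ?t] by (simp add: ln_sqrt[symmetric])
        finally have "norm (G w) \<le> exp (ln (S ?t) / 2) * exp (- p (S ?t) - \<delta>)"
          using w by (simp add: G_def E_def norm_mult hw)
        also have "\<dots> = exp (ln (S ?t) / 2 - p (S ?t) - \<delta>)"
          by (simp flip: exp_add)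
        also have "\<dots> \<le> 1"
          using p_approx[OF S_bounds, of ?t] by simp
        finally show ?thesis .
      qed
    qed (use that in auto)
    have "((\<lambda>x. E (of_real x)) has_vector_derivative - e - of_real \<delta>) (at 0)"
    proof (rule has_vector_derivative_real_field)
      show "(E has_field_derivative - e - of_real \<delta>) (at (of_real 0))"
        unfolding E_def using h_deriv by (auto intro!: derivative_eq_intros simp: h(2))
    qed
    then have "((\<lambda>x. G (of_real x)) has_vector_derivative f (of_real 0) * (- e - of_real \<delta>) + d * E (of_real 0)) (at 0)"
      unfolding G_def using deriv by (intro has_vector_derivative_mult)
    then have "((\<lambda>x. G (of_real x)) has_vector_derivative d - e - of_real \<delta>) (at 0)"
      by (simp add: f0 E_def h(2) algebra_simps)
    from bounded_linear.has_vector_derivative[OF bounded_linear_Re this]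
    have G_deriv: "DERIV (\<lambda>x. Re (G (of_real x))) 0 :> Re (d - e - of_real \<delta>)"
      by (simp add: has_real_derivative_iff_has_vector_derivative)
    have "Re (d - e - of_real \<delta>) \<le> 0"
    proof (rule ccontr)
      assume "\<not> Re (d - e - of_real \<delta>) \<le> 0"
      then obtain r where r: "r > 0" "\<And>x. x > 0 \<Longrightarrow> x < r \<Longrightarrow> Re (G (of_real 0)) < Re (G (of_real (0 + x)))"
        using DERIV_pos_inc_right[OF G_deriv] by (auto simp: not_le)
      define x where "x = min (r / 2) 1"
      have "Re (G (of_real 0)) < Re (G (of_real x))"
        using r(1) r(2)[of x] by (simp add: x_def min_less_iff_disj)
      also have "\<dots> \<le> norm (G (of_real x))" by (rule complex_Re_le_cmod)
      also have "\<dots> \<le> 1" using r(1) by (intro G_le) (auto simp: x_def)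
      finally show False by (simp add: G_def E_def f0 h(2))
    qed
    then have "Re d \<le> (LINT t|lborel. \<beta>\<^sub>0 t * p (S t)) + \<delta>"
      using e by simp
    also have "(LINT t|lborel. \<beta>\<^sub>0 t * p (S t)) \<le> (LINT t|lborel. \<beta>\<^sub>0 t * ln (S t) / 2 + \<delta> * \<beta>\<^sub>0 t)"
    proof (rule integral_mono)
      show "integrable lborel (\<lambda>t. \<beta>\<^sub>0 t * ln (S t) / 2 + \<delta> * \<beta>\<^sub>0 t)"
        using int_ln integrable_\<beta>\<^sub>0 by auto
      fix t
      have "p (S t) \<le> ln (S t) / 2 + \<delta>"
        using p_approx[OF S_bounds, of t] by simp
      then have "\<beta>\<^sub>0 t * p (S t) \<le> \<beta>\<^sub>0 t * (ln (S t) / 2 + \<delta>)"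
        using \<beta>\<^sub>0_pos[of t] by (intro mult_left_mono) auto
      then show "\<beta>\<^sub>0 t * p (S t) \<le> \<beta>\<^sub>0 t * ln (S t) / 2 + \<delta> * \<beta>\<^sub>0 t"
        by (simp add: algebra_simps)
    qed (rule int_p)
    also have "\<dots> = (LINT t|lborel. \<beta>\<^sub>0 t * ln (S t)) / 2 + \<delta>"
      using int_ln integrable_\<beta>\<^sub>0 by (subst Bochner_Integration.integral_add) (auto simp: integral_\<beta>\<^sub>0)
    finally show ?thesis by simp
  qed
  have "Re d \<le> (LINT t|lborel. \<beta>\<^sub>0 t * ln (S t)) / 2"
  proof (rule field_le_epsilon)
    fix \<epsilon>' :: real assume "\<epsilon>' > 0"
    then show "Re d \<le> (LINT t|lborel. \<beta>\<^sub>0 t * ln (S t)) / 2 + \<epsilon>'"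
      using approx[of "\<epsilon>' / 2"] by simp
  qed
  then show "2 * Re d \<le> (LINT t|lborel. \<beta>\<^sub>0 t * ln ((norm (f (1 + \<i> * of_real t)))\<^sup>2 + \<epsilon>))"
    by (simp add: S_def)
  show "integrable lborel (\<lambda>t. \<beta>\<^sub>0 t * ln ((norm (f (1 + \<i> * of_real t)))\<^sup>2 + \<epsilon>))"
    using int_ln by (simp add: S_def)
qed

subsection \<open>Complex matrices\<close>

abbreviation cscale :: "complex \<Rightarrow> 'n::finite op \<Rightarrow> 'n op" (infixr "*\<^sub>C" 75) where
  "c *\<^sub>C A \<equiv> map_matrix ((*) c) A"

lemma op_eqI: "(\<And>i j. A $ i $ j = B $ i $ j) \<Longrightarrow> A = (B :: 'n::finite op)"
  by (simp add: vec_eq_iff)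

lemma cadj_nth [simp]: "cadj A $ i $ j = cnj (A $ j $ i)"
  by (simp add: cadj_def transpose_def)

lemma cadj_cadj [simp]: "cadj (cadj A) = A"
  and cadj_add: "cadj (A + B) = cadj A + cadj B"
  and cadj_diff: "cadj (A - B) = cadj A - cadj B"
  and cadj_zero [simp]: "cadj 0 = 0"
  and cadj_cscale: "cadj (c *\<^sub>C A) = cnj c *\<^sub>C cadj A"
  and cadj_mat_1 [simp]: "cadj (mat 1) = mat 1"
  by (auto intro!: op_eqI simp: mat_def)

lemma cadj_scaleR: "cadj (r *\<^sub>R A) = r *\<^sub>R cadj A"
  by (auto intro!: op_eqI)

lemma cadj_mult: "cadj (A ** B) = cadj B ** cadj A"
  by (auto intro!: op_eqI simp: matrix_matrix_mult_def cnj_sum mult.commute)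

lemma cadj_sum: "cadj (sum f S) = (\<Sum>x\<in>S. cadj (f x))"
  by (induction S rule: infinite_finite_induct) (auto simp: cadj_add)

lemma cscale_mult_left: "(c *\<^sub>C A) ** B = c *\<^sub>C (A ** B)"
  and cscale_mult_right: "A ** (c *\<^sub>C B) = c *\<^sub>C (A ** B)"
  by (auto intro!: op_eqI simp: matrix_matrix_mult_def sum_distrib_left mult_ac)

lemma cscale_cscale [simp]: "c *\<^sub>C (d *\<^sub>C A) = (c * d) *\<^sub>C A"
  and cscale_1 [simp]: "1 *\<^sub>C A = A"
  and cscale_0_left [simp]: "0 *\<^sub>C A = 0"
  and cscale_0_right [simp]: "c *\<^sub>C (0 :: 'n::finite op) = 0"
  and cscale_add_left: "(c + d) *\<^sub>C A = c *\<^sub>C A + d *\<^sub>C A"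
  and cscale_of_real: "complex_of_real r *\<^sub>C A = r *\<^sub>R A"
  by (auto intro!: op_eqI simp: algebra_simps scaleR_conv_of_real[symmetric])

lemma cscale_sum_right: "c *\<^sub>C sum f S = (\<Sum>x\<in>S. c *\<^sub>C f x)"
  by (auto intro!: op_eqI simp: sum_distrib_left)

lemma matrix_mult_add_left: "(A + B) ** C = A ** C + B ** C"
  and matrix_mult_diff_left: "(A - B) ** C = A ** C - B ** C"
  and matrix_mult_diff_right: "C ** (A - B) = C ** A - C ** B"
  for A B C :: "'n::finite op"
  by (auto intro!: op_eqI simp: matrix_matrix_mult_def algebra_simps sum.distrib sum_subtractf)

lemma matrix_mult_zero [simp]: "0 ** A = 0" "A ** 0 = 0" for A :: "'n::finite op"
  by (simp_all add: vec_eq_iff matrix_matrix_mult_def)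

lemma trace_zero [simp]: "trace (0 :: 'n::finite op) = 0"
  by (simp add: trace_def)

lemma matrix_mult_sum_left: "sum f S ** B = (\<Sum>x\<in>S. f x ** B)"
  and matrix_mult_sum_right: "B ** sum f S = (\<Sum>x\<in>S. B ** f x)"
  for B :: "'n::finite op"
  by (induction S rule: infinite_finite_induct)
     (auto simp: matrix_mult_add_left matrix_add_ldistrib)

lemma matrix_vector_mult_sum_left: "sum f S *v x = (\<Sum>i\<in>S. f i *v x)" for f :: "_ \<Rightarrow> 'n::finite op"
  by (induction S rule: infinite_finite_induct) (auto simp: matrix_vector_mult_add_rdistrib)

lemma trace_cscale: "trace (c *\<^sub>C A) = c * trace A"
  by (simp add: trace_def sum_distrib_left)

lemma trace_sum: "trace (sum f S) = (\<Sum>x\<in>S. trace (f x))" for f :: "_ \<Rightarrow> 'n::finite op"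
  by (induction S rule: infinite_finite_induct) (auto simp: trace_add)

lemma trace_cadj: "trace (cadj A) = cnj (trace A)"
  by (simp add: trace_def)

text \<open>The Euclidean structure on matrices is the real part of the Hilbert-Schmidt inner
  product; \<open>norm\<close> on operators therefore always means the Hilbert-Schmidt norm.\<close>

lemma inner_op_eq_trace: "A \<bullet> B = Re (trace (cadj A ** B))" for A B :: "'n::finite op"
proof -
  have "A \<bullet> B = (\<Sum>i\<in>UNIV. \<Sum>j\<in>UNIV. Re (cnj (A $ i $ j) * B $ i $ j))"
    by (simp add: inner_vec_def inner_complex_def)
  also have "\<dots> = (\<Sum>j\<in>UNIV. \<Sum>i\<in>UNIV. Re (cnj (A $ i $ j) * B $ i $ j))"
    by (rule sum.swap)
  finally show ?thesis
    by (simp add: trace_def matrix_matrix_mult_def)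
qed

lemma power2_norm_op: "(norm A)\<^sup>2 = Re (trace (cadj A ** A))" for A :: "'n::finite op"
  by (simp add: power2_norm_eq_inner inner_op_eq_trace)

text \<open>The real Cauchy-Schwarz inequality suffices: multiplying \<open>B\<close> by the phase
  \<open>u\<close> makes the trace equal to its modulus without changing the norm.\<close>

lemma norm_trace_mult_le: "norm (trace (cadj A ** B)) \<le> norm A * norm B" for A B :: "'n::finite op"
proof -
  define c where "c = trace (cadj A ** B)"
  define u where "u = (if c = 0 then 1 else cnj c / norm c)"
  have u: "norm u = 1"
    by (simp add: u_def norm_divide)
  have "cnj c * c = (of_real (norm c))\<^sup>2"
    unfolding complex_norm_square[symmetric] mult.commute[of "cnj c"] by simp
  then have "u * c = complex_of_real (norm c)"
    by (simp add: u_def power2_eq_square)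
  then have "norm c = Re (u * c)" by simp
  also have "\<dots> = A \<bullet> (u *\<^sub>C B)"
    by (simp add: inner_op_eq_trace cscale_mult_right trace_cscale c_def)
  also have "\<dots> \<le> norm A * norm (u *\<^sub>C B)"
    by (rule norm_cauchy_schwarz)
  also have "norm (u *\<^sub>C B) = norm B"
    by (simp add: norm_vec_def norm_mult u)
  finally show ?thesis by (simp add: c_def)
qed

lemma inner_mult_vec: "v \<bullet> (A *v w) = (cadj A *v v) \<bullet> w" for A :: "'n::finite op"
proof -
  have inner: "x \<bullet> y = (\<Sum>i\<in>UNIV. Re (cnj (x $ i) * y $ i))" for x y :: "complex^'n"
    by (simp add: inner_vec_def inner_complex_def)
  have "v \<bullet> (A *v w) = (\<Sum>i\<in>UNIV. \<Sum>j\<in>UNIV. Re (cnj (v $ i) * (A $ i $ j * w $ j)))"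
    unfolding inner by (simp only: matrix_vector_mult_def vec_lambda_beta sum_distrib_left Re_sum)
  also have "\<dots> = (\<Sum>j\<in>UNIV. \<Sum>i\<in>UNIV. Re (cnj (v $ i) * (A $ i $ j * w $ j)))"
    by (rule sum.swap)
  also have "\<dots> = (\<Sum>j\<in>UNIV. Re (cnj ((cadj A *v v) $ j) * w $ j))"
    by (simp only: matrix_vector_mult_def vec_lambda_beta cnj_sum sum_distrib_right Re_sum
        complex_cnj_mult cadj_nth complex_cnj_cnj) (simp only: mult_ac)
  also have "\<dots> = (cadj A *v v) \<bullet> w"
    by (rule inner[symmetric])
  finally show ?thesis .
qed

lemma psd_iff: "psd A \<longleftrightarrow> cadj A = A \<and> (\<forall>v. 0 \<le> v \<bullet> (A *v v))"
proof -
  have "Re (\<Sum>i\<in>UNIV. cnj (v $ i) * (A *v v) $ i) = v \<bullet> (A *v v)" for v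
    by (simp add: inner_vec_def inner_complex_def)
  then show ?thesis by (simp add: psd_def)
qed

lemma linear_mult_vec: "linear ((*v) A)" for A :: "'n::finite op"
  by (rule linearI, simp add: matrix_vector_right_distrib)
     (auto simp: matrix_vector_right_distrib vec_eq_iff matrix_vector_mult_def scaleR_sum_right
       scaleR_vec_def)

lemma mult_vec_scaleR: "A *v (r *\<^sub>R x) = r *\<^sub>R (A *v x)" for A :: "'n::finite op"
  by (rule linear_scale[OF linear_mult_vec])

lemma scaleR_mult_vec: "(r *\<^sub>R A) *v x = r *\<^sub>R (A *v x)" for A :: "'n::finite op"
  by (simp add: vec_eq_iff matrix_vector_mult_def scaleR_sum_right)

lemma mult_scaleR_left: "(r *\<^sub>R A) ** B = r *\<^sub>R (A ** B)"
  and mult_scaleR_right: "A ** (r *\<^sub>R B) = r *\<^sub>R (A ** B)" for A :: "'n::finite op"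
  by (simp_all add: vec_eq_iff matrix_matrix_mult_def scaleR_sum_right)

subsection \<open>The spectral theorem\<close>

text \<open>The maximiser of the Rayleigh quotient on \<open>W\<close> is an eigenvector.\<close>

lemma ex_eigenvector:
  fixes A :: "'n::finite op"
  assumes herm: "cadj A = A" and W: "subspace W" and x: "x \<in> W" "x \<noteq> 0"
    and inv: "\<And>w. w \<in> W \<Longrightarrow> A *v w \<in> W"
  obtains l v where "v \<in> W" "v \<noteq> 0" "A *v v = l *\<^sub>R v"
proof -
  let ?K = "W \<inter> sphere 0 1"
  have K: "compact ?K"
    using closed_subspace[OF W] by (simp add: closed_Int_compact)
  have "x /\<^sub>R norm x \<in> ?K"
    using x W by (simp add: subspace_scale)
  then have ne: "?K \<noteq> {}" by blast
  have bl: "bounded_linear ((*v) A)"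
    using linear_mult_vec[of A] by (simp add: linear_conv_bounded_linear)
  have "continuous_on ?K (\<lambda>v. v \<bullet> (A *v v))"
    by (rule continuous_on_inner[OF continuous_on_id linear_continuous_on[OF bl]])
  from continuous_attains_sup[OF K ne this] obtain v where v: "v \<in> ?K"
    and max: "\<And>w. w \<in> ?K \<Longrightarrow> w \<bullet> (A *v w) \<le> v \<bullet> (A *v v)"
    by blast
  define l where "l = v \<bullet> (A *v v)"
  \<comment> \<open>Nonnegative on \<open>W\<close> by maximality and zero at \<open>v\<close>. So
    \<open>v\<close> minimises \<open>g\<close>, and its variation in the direction of the residual
    \<open>u\<close> must vanish.\<close>
  define g where "g w = l * (w \<bullet> w) - w \<bullet> (A *v w)" for w
  have g_nonneg: "0 \<le> g w" if "w \<in> W" for w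
  proof (cases "w = 0")
    case False
    let ?u = "w /\<^sub>R norm w"
    have "?u \<in> ?K"
      using that False W by (simp add: subspace_scale)
    from max[OF this] have "inverse (norm w) * (inverse (norm w) * (w \<bullet> (A *v w))) \<le> l"
      unfolding l_def mult_vec_scaleR inner_scaleR_left inner_scaleR_right .
    then have "w \<bullet> (A *v w) \<le> l * (norm w * norm w)"
      using False by (simp add: field_simps)
    then show ?thesis
      by (simp add: g_def power2_norm_eq_inner[symmetric] power2_eq_square)
  qed (simp add: g_def)
  define u where "u = l *\<^sub>R v - A *v v"
  have vW: "v \<in> W" and vv: "v \<bullet> v = 1"
    using v by (auto simp: dot_square_norm)
  have uW: "u \<in> W"
    using vW W inv by (simp add: u_def subspace_diff subspace_scale)
  have gv: "g v = 0"
    by (simp add: g_def l_def vv)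
  have expand: "g (v + s *\<^sub>R u) = s * (2 * (u \<bullet> u) + s * g u)" for s
  proof -
    have sym: "v \<bullet> (A *v u) = u \<bullet> (A *v v)"
      using inner_mult_vec[of v A u] herm by (simp add: inner_commute)
    have vu: "v \<bullet> u = u \<bullet> v"
      by (rule inner_commute)
    have "g (v + s *\<^sub>R u) = g v + 2 * s * (l * (u \<bullet> v) - u \<bullet> (A *v v)) + s\<^sup>2 * g u"
      unfolding g_def matrix_vector_right_distrib mult_vec_scaleR inner_add_left inner_add_right
        inner_scaleR_left inner_scaleR_right sym vu
      by (simp add: algebra_simps power2_eq_square)
    also have "l * (u \<bullet> v) - u \<bullet> (A *v v) = u \<bullet> u"
      by (simp add: u_def inner_diff_right)
    finally show ?thesis
      by (simp add: gv algebra_simps power2_eq_square)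
  qed
  have "u = 0"
  proof (rule ccontr)
    assume "u \<noteq> 0"
    then have uu: "u \<bullet> u > 0" by simp
    \<comment> \<open>Negative, yet so small that \<open>s * g u\<close> stays above
      \<open>- (u \<bullet> u)\<close>; then \<open>g (v + s *\<^sub>R u)\<close> would be
      negative.\<close>
    define s where "s = - (u \<bullet> u) / (1 + g u)"
    have gu: "0 \<le> g u" by (rule g_nonneg[OF uW])
    then have s: "s < 0"
      using uu by (simp add: s_def divide_neg_pos)
    have "(u \<bullet> u) * (g u / (1 + g u)) \<le> (u \<bullet> u) * 1"
      using gu uu by (intro mult_left_mono) (auto simp: divide_le_eq)
    then have "s * g u \<ge> - (u \<bullet> u)"
      by (simp add: s_def)
    then have "0 < 2 * (u \<bullet> u) + s * g u"
      using uu by linarith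
    with s have "s * (2 * (u \<bullet> u) + s * g u) < 0"
      by (rule mult_neg_pos)
    moreover have "0 \<le> g (v + s *\<^sub>R u)"
      using vW uW W by (intro g_nonneg) (simp add: subspace_add subspace_scale)
    ultimately show False by (simp add: expand)
  qed
  then show thesis
    using vW vv by (intro that[of v l]) (auto simp: u_def)
qed

text \<open>The range of \<open>Q\<close> is invariant because \<open>Q\<close> commutes with
  \<open>A\<close>. This is the means of showing \<open>Q = 0\<close>, used for products of linear
  factors and for the defect of completeness.\<close>

lemma ex_eigenvector_range:
  fixes A :: "'n::finite op"
  assumes "cadj A = A" "A ** Q = Q ** A" "Q \<noteq> 0"
  obtains l v where "Q *v v \<noteq> 0" "A *v (Q *v v) = l *\<^sub>R (Q *v v)"
proof -
  let ?W = "range ((*v) Q)"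
  have W: "subspace ?W"
    using linear_subspace_image[OF linear_mult_vec, of UNIV Q] by simp
  obtain x where x: "Q *v x \<noteq> 0"
    using assms(3) matrix_eq[of Q 0] by auto
  have inv: "A *v w \<in> ?W" if "w \<in> ?W" for w
  proof -
    from that obtain y where "w = Q *v y" by auto
    then have "A *v w = Q *v (A *v y)"
      by (simp add: matrix_vector_mul_assoc assms(2))
    then show ?thesis by simp
  qed
  obtain l w where "w \<in> ?W" "w \<noteq> 0" "A *v w = l *\<^sub>R w"
    by (rule ex_eigenvector[OF assms(1) W rangeI x inv])
  then show thesis using that by auto
qed

lemma finite_real_spectrum:
  fixes A :: "'n::finite op"
  assumes herm: "cadj A = A"
  shows "finite (real_spectrum A)"
proof -
  \<comment> \<open>One eigenvector per eigenvalue: these are nonzero and pairwise orthogonal, and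
    an orthogonal family in finite dimension is finite.\<close>
  define ev where "ev l = (SOME v. v \<noteq> 0 \<and> A *v v = l *\<^sub>R v)" for l
  have ev: "ev l \<noteq> 0" "A *v ev l = l *\<^sub>R ev l" if "l \<in> real_spectrum A" for l
    using that someI_ex[of "\<lambda>v. v \<noteq> 0 \<and> A *v v = l *\<^sub>R v"]
    by (auto simp: real_spectrum_def ev_def)
  have orth: "ev l \<bullet> ev m = 0" if "l \<in> real_spectrum A" "m \<in> real_spectrum A" "l \<noteq> m" for l m
  proof -
    have "l * (ev l \<bullet> ev m) = m * (ev l \<bullet> ev m)"
      using inner_mult_vec[of "ev l" A "ev m"] ev that herm by simp
    with that(3) show ?thesis by simp
  qed
  have inj: "inj_on ev (real_spectrum A)"
  proof (rule inj_onI)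
    fix l m assume *: "l \<in> real_spectrum A" "m \<in> real_spectrum A" "ev l = ev m"
    then have "l *\<^sub>R ev l = m *\<^sub>R ev l"
      using ev(2) by metis
    with ev(1)[OF *(1)] show "l = m" by simp
  qed
  have "pairwise orthogonal (ev ` real_spectrum A)"
    using orth by (auto simp: pairwise_def orthogonal_def)
  then have "finite (ev ` real_spectrum A)"
    by (rule pairwise_orthogonal_imp_finite)
  with inj show ?thesis by (simp add: finite_image_iff)
qed

text \<open>\<open>Q l = 0\<close> is allowed, so \<open>S\<close> may be larger than the spectrum.
  Images of spectral projections under a homomorphism can thus be used without proving
  injectivity.\<close>

definition resolution :: "real set \<Rightarrow> (real \<Rightarrow> 'n::finite op) \<Rightarrow> bool" where
  "resolution S Q \<longleftrightarrow> finite S \<and> (\<forall>l\<in>S. cadj (Q l) = Q l)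
     \<and> (\<forall>l\<in>S. \<forall>m\<in>S. Q l ** Q m = (if l = m then Q l else 0)) \<and> sum Q S = mat 1"

text \<open>The polynomial with roots \<open>ls\<close>, evaluated at \<open>A\<close>. A list fixes
  the order of the factors, as the matrix product is not commutative.\<close>

definition lin_factors :: "'n::finite op \<Rightarrow> real list \<Rightarrow> 'n op" where
  "lin_factors A ls = foldr (\<lambda>l B. (A - mat (complex_of_real l)) ** B) ls (mat 1)"

lemma mat_of_real: "mat (complex_of_real l) = l *\<^sub>R (mat 1 :: 'n::finite op)"
  by (simp add: vec_eq_iff mat_def of_real_def)

lemma shift_mult_left: "(A - mat (complex_of_real l)) ** B = A ** B - l *\<^sub>R B" for A B :: "'n::finite op"
  by (simp add: mat_of_real matrix_mult_diff_left mult_scaleR_left)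

lemma lin_factors_Nil [simp]: "lin_factors A [] = mat 1"
  and lin_factors_Cons [simp]:
    "lin_factors A (l # ls) = A ** lin_factors A ls - l *\<^sub>R lin_factors A ls"
  by (simp_all add: lin_factors_def shift_mult_left)

lemma lin_factors_commute: "A ** lin_factors A ls = lin_factors A ls ** A"
proof (induction ls)
  case (Cons l ls)
  have "(A ** lin_factors A ls) ** A = A ** (A ** lin_factors A ls)"
    by (simp add: Cons matrix_mul_assoc)
  then show ?case
    by (simp add: matrix_mult_diff_left matrix_mult_diff_right mult_scaleR_left mult_scaleR_right Cons)
qed simp

lemma cadj_lin_factors: "cadj A = A \<Longrightarrow> cadj (lin_factors A ls) = lin_factors A ls"
proof (induction ls)
  case (Cons l ls)
  then show ?case
    by (simp add: cadj_diff cadj_mult lin_factors_commute cadj_scaleR)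
qed simp

lemma lin_factors_eigen_vec:
  "A *v v = l *\<^sub>R v \<Longrightarrow> lin_factors A ls *v v = (\<Prod>m\<leftarrow>ls. l - m) *\<^sub>R v"
proof (induction ls)
  case (Cons m ls)
  then show ?case
    by (simp add: matrix_vector_mult_diff_rdistrib scaleR_mult_vec mult_vec_scaleR left_diff_distrib
        scaleR_diff_left mult.commute flip: matrix_vector_mul_assoc)
qed simp

lemma lin_factors_eigen:
  "A ** Y = l *\<^sub>R Y \<Longrightarrow> lin_factors A ls ** Y = (\<Prod>m\<leftarrow>ls. l - m) *\<^sub>R Y" for Y :: "'n::finite op"
proof (induction ls)
  case (Cons m ls)
  then show ?case
    by (simp add: matrix_mult_diff_left mult_scaleR_left mult_scaleR_right left_diff_distrib
        scaleR_diff_left mult.commute flip: matrix_mul_assoc)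
qed simp

text \<open>A nonzero product would have an eigenvector of \<open>A\<close> in its range. The
  product annihilates that vector, its eigenvalue being a root; but a Hermitian matrix annihilates
  no nonzero vector of its own range.\<close>

lemma lin_factors_eq_0:
  fixes A :: "'n::finite op"
  assumes herm: "cadj A = A" and "real_spectrum A \<subseteq> set ls"
  shows "lin_factors A ls = 0"
proof (rule ccontr)
  let ?B = "lin_factors A ls"
  assume "?B \<noteq> 0"
  then obtain l v where v: "?B *v v \<noteq> 0" "A *v (?B *v v) = l *\<^sub>R (?B *v v)"
    by (rule ex_eigenvector_range[OF herm lin_factors_commute])
  then have "l \<in> set ls"
    using assms(2) by (auto simp: real_spectrum_def)
  then have "(\<Prod>m\<leftarrow>ls. l - m) = 0"
    by (auto simp: prod_list_zero_iff)
  then have "?B *v (?B *v v) = 0"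
    using lin_factors_eigen_vec[OF v(2), of ls] by simp
  moreover have "(?B *v v) \<bullet> (?B *v v) = v \<bullet> (?B *v (?B *v v))"
    using inner_mult_vec[of v ?B "?B *v v"] by (simp add: cadj_lin_factors[OF herm])
  ultimately show False
    using v(1) by simp
qed

text \<open>The Lagrange interpolation formula for the spectral projections.\<close>

lemma ex_spectral_resolution:
  fixes A :: "'n::finite op"
  assumes herm: "cadj A = A"
  obtains P where "resolution (real_spectrum A) P" "A = (\<Sum>l\<in>real_spectrum A. l *\<^sub>R P l)"
proof -
  let ?S = "real_spectrum A"
  have fin: "finite ?S" by (rule finite_real_spectrum[OF herm])
  define others where "others l = sorted_list_of_set (?S - {l})" for l
  define c where "c l = (\<Prod>m\<leftarrow>others l. l - m)" for l
  define P where "P l = inverse (c l) *\<^sub>R lin_factors A (others l)" for l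
  have c: "c l \<noteq> 0" for l
    using fin by (auto simp: c_def others_def prod_list_zero_iff)
  have AP: "A ** P l = l *\<^sub>R P l" if "l \<in> ?S" for l
  proof -
    have "lin_factors A (l # others l) = 0"
      using fin that by (intro lin_factors_eq_0[OF herm]) (auto simp: others_def)
    then have "A ** lin_factors A (others l) = l *\<^sub>R lin_factors A (others l)"
      by simp
    then show ?thesis by (simp add: P_def mult_scaleR_right)
  qed
  have cadj_P: "cadj (P l) = P l" for l
    by (simp add: P_def cadj_scaleR cadj_lin_factors[OF herm])
  have P_A: "P l ** A = A ** P l" for l
    by (simp add: P_def mult_scaleR_left mult_scaleR_right lin_factors_commute)
  have PP: "P l ** P m = (if l = m then P l else 0)" if "l \<in> ?S" "m \<in> ?S" for l m
  proof (cases "l = m")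
    case True
    have "lin_factors A (others l) ** P l = c l *\<^sub>R P l"
      unfolding c_def using that AP by (intro lin_factors_eigen) auto
    then have "P l ** P l = P l"
      using c[of l] by (subst (1) P_def) (simp add: mult_scaleR_left)
    with True show ?thesis by simp
  next
    case False
    have "l *\<^sub>R (P l ** P m) = (P l ** A) ** P m"
      using that by (simp add: P_A AP mult_scaleR_left)
    also have "\<dots> = m *\<^sub>R (P l ** P m)"
      using that by (simp add: AP mult_scaleR_right flip: matrix_mul_assoc)
    finally show ?thesis using False by simp
  qed
  \<comment> \<open>Completeness: a nonzero defect \<open>Q\<close> would contain an eigenvector in
    its range. The Lagrange polynomial \<open>P l\<close> fixes that vector, whereas
    \<open>P l ** Q = 0\<close>.\<close>
  define Q where "Q = mat 1 - sum P ?S"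
  have "Q = 0"
  proof (rule ccontr)
    assume "Q \<noteq> 0"
    have "A ** Q = Q ** A"
      by (simp add: Q_def matrix_mult_diff_right matrix_mult_diff_left matrix_mult_sum_left
          matrix_mult_sum_right P_A)
    then obtain l v where v: "Q *v v \<noteq> 0" "A *v (Q *v v) = l *\<^sub>R (Q *v v)"
      using \<open>Q \<noteq> 0\<close> by (rule ex_eigenvector_range[OF herm])
    then have l: "l \<in> ?S" by (auto simp: real_spectrum_def)
    have "P l *v (Q *v v) = Q *v v"
      using lin_factors_eigen_vec[OF v(2), of "others l"] c[of l]
      by (simp add: P_def c_def scaleR_mult_vec)
    moreover have "P l ** Q = 0"
    proof -
      have "P l ** sum P ?S = (\<Sum>m\<in>?S. if l = m then P l else 0)"
        unfolding matrix_mult_sum_right using l PP by (intro sum.cong) auto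
      then show ?thesis
        using l fin by (simp add: Q_def matrix_mult_diff_right)
    qed
    ultimately show False
      using v(1) by (simp add: matrix_vector_mul_assoc)
  qed
  then have one: "sum P ?S = mat 1" by (simp add: Q_def)
  have "A = A ** sum P ?S" by (simp add: one)
  also have "\<dots> = (\<Sum>l\<in>?S. l *\<^sub>R P l)"
    unfolding matrix_mult_sum_right using AP by (intro sum.cong) auto
  finally show thesis
    using that fin cadj_P PP one by (auto simp: resolution_def)
qed

text \<open>Equal ranges give \<open>Q ** P = P\<close> and \<open>P ** Q = Q\<close>, and the
  adjoint turns one product into the other. This justifies the definite description in
  \<open>eigproj\<close>.\<close>

lemma projection_unique:
  fixes P Q :: "'n::finite op"
  assumes P: "cadj P = P" "P ** P = P" and Q: "cadj Q = Q" "Q ** Q = Q"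
    and range: "range ((*v) P) = range ((*v) Q)"
  shows "P = Q"
proof -
  have absorb: "P' ** Q' = Q'" if idem: "P' ** P' = P'" and eq: "range ((*v) P') = range ((*v) Q')" for P' Q' :: "'n op"
  proof -
    have "(P' ** Q') *v x = Q' *v x" for x
    proof -
      obtain y where y: "Q' *v x = P' *v y" using eq by blast
      have "(P' ** Q') *v x = (P' ** P') *v y"
        using y by (simp flip: matrix_vector_mul_assoc)
      with y idem show ?thesis by simp
    qed
    then show ?thesis by (subst matrix_eq) blast
  qed
  have "P = cadj (Q ** P)"
    using absorb[OF Q(2) range[symmetric]] P by simp
  also have "\<dots> = Q"
    using absorb[OF P(2) range] P Q by (simp add: cadj_mult)
  finally show ?thesis .
qed

lemma eigenspace_resolution:
  assumes res: "resolution S Q" and A: "A = (\<Sum>l\<in>S. l *\<^sub>R Q l)"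
  shows "l \<in> S \<Longrightarrow> {v. A *v v = l *\<^sub>R v} = range ((*v) (Q l))"
    and "l \<notin> S \<Longrightarrow> {v. A *v v = l *\<^sub>R v} = {0}"
proof -
  have fin: "finite S" and QQ: "\<And>l m. l \<in> S \<Longrightarrow> m \<in> S \<Longrightarrow> Q l ** Q m = (if l = m then Q l else 0)"
    and one: "sum Q S = mat 1"
    using res by (auto simp: resolution_def)
  have QA: "Q m ** A = m *\<^sub>R Q m" if "m \<in> S" for m
  proof -
    have "Q m ** A = (\<Sum>l\<in>S. if m = l then m *\<^sub>R Q m else 0)"
      unfolding A matrix_mult_sum_right using that
      by (intro sum.cong) (auto simp: mult_scaleR_right QQ)
    then show ?thesis using fin that by simp
  qed
  have AQ: "A ** Q m = m *\<^sub>R Q m" if "m \<in> S" for m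
  proof -
    have "A ** Q m = (\<Sum>l\<in>S. if l = m then m *\<^sub>R Q m else 0)"
      unfolding A matrix_mult_sum_left using that
      by (intro sum.cong) (auto simp: mult_scaleR_left QQ)
    then show ?thesis using fin that by simp
  qed
  have zero: "Q m *v v = 0" if "A *v v = l *\<^sub>R v" "m \<in> S" "m \<noteq> l" for l m v
  proof -
    have "l *\<^sub>R (Q m *v v) = Q m *v (A *v v)"
      by (simp add: that(1) mult_vec_scaleR)
    also have "\<dots> = m *\<^sub>R (Q m *v v)"
      using that(2) by (simp add: matrix_vector_mul_assoc QA scaleR_mult_vec)
    finally show ?thesis using that(3) by simp
  qed
  have expand: "(\<Sum>m\<in>S. Q m *v v) = v" for v
    using matrix_vector_mult_sum_left[of Q S v] by (simp add: one)
  show "{v. A *v v = l *\<^sub>R v} = range ((*v) (Q l))" if l: "l \<in> S"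
  proof (intro subset_antisym subsetI)
    fix v assume "v \<in> {v. A *v v = l *\<^sub>R v}"
    then have "(\<Sum>m\<in>S. Q m *v v) = (\<Sum>m\<in>S. if m = l then Q l *v v else 0)"
      using zero by (intro sum.cong) auto
    with expand[of v] fin l have "v = Q l *v v" by simp
    then show "v \<in> range ((*v) (Q l))" by (metis rangeI)
  next
    fix v assume "v \<in> range ((*v) (Q l))"
    then obtain w where "v = Q l *v w" by auto
    then show "v \<in> {v. A *v v = l *\<^sub>R v}"
      by (simp add: matrix_vector_mul_assoc AQ[OF l] scaleR_mult_vec)
  qed
  show "{v. A *v v = l *\<^sub>R v} = {0}" if l: "l \<notin> S"
  proof -
    have "v = 0" if "A *v v = l *\<^sub>R v" for v
    proof -
      have "(\<Sum>m\<in>S. Q m *v v) = 0"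
        using zero[OF that] l by (intro sum.neutral) auto
      with expand[of v] show ?thesis by simp
    qed
    then show ?thesis by auto
  qed
qed

lemma eigproj_resolution:
  assumes res: "resolution S Q" and A: "A = (\<Sum>l\<in>S. l *\<^sub>R Q l)" and l: "l \<in> S"
  shows "eigproj A l = Q l"
  unfolding eigproj_def
proof (rule the_equality)
  have Q: "cadj (Q l) = Q l" "Q l ** Q l = Q l"
    using res l unfolding resolution_def by metis+
  have range: "{v. A *v v = l *\<^sub>R v} = range ((*v) (Q l))"
    by (rule eigenspace_resolution(1)[OF res A l])
  show "cadj (Q l) = Q l \<and> Q l ** Q l = Q l \<and> range ((*v) (Q l)) = {v. A *v v = l *\<^sub>R v}"
    unfolding range using Q by blast
  fix P assume P: "cadj P = P \<and> P ** P = P \<and> range ((*v) P) = {v. A *v v = l *\<^sub>R v}"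
  show "P = Q l"
    by (rule projection_unique) (use P Q in \<open>simp_all only: range\<close>)
qed

lemma real_spectrum_resolution:
  assumes res: "resolution S Q" and A: "A = (\<Sum>l\<in>S. l *\<^sub>R Q l)"
  shows "real_spectrum A = {l\<in>S. Q l \<noteq> 0}"
proof -
  have "l \<in> real_spectrum A \<longleftrightarrow> l \<in> S \<and> Q l \<noteq> 0" for l
  proof -
    have "l \<in> real_spectrum A \<longleftrightarrow> \<not> {v. A *v v = l *\<^sub>R v} \<subseteq> {0}"
      by (auto simp: real_spectrum_def)
    moreover have "range ((*v) (Q l)) \<subseteq> {0} \<longleftrightarrow> Q l = 0"
      using matrix_eq[of "Q l" 0] by auto
    ultimately show ?thesis
      using eigenspace_resolution[OF res A, of l] by (cases "l \<in> S") simp_all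
  qed
  then show ?thesis by blast
qed

lemma herm_fun_resolution:
  assumes res: "resolution S Q" and A: "A = (\<Sum>l\<in>S. l *\<^sub>R Q l)"
  shows "herm_fun f A = (\<Sum>l\<in>S. f l *\<^sub>C Q l)"
proof -
  have "finite S" using res by (simp add: resolution_def)
  have "herm_fun f A = (\<Sum>l\<in>{l\<in>S. Q l \<noteq> 0}. f l *\<^sub>C Q l)"
    unfolding herm_fun_def real_spectrum_resolution[OF res A]
    by (intro sum.cong) (auto simp: eigproj_resolution[OF res A])
  also have "\<dots> = (\<Sum>l\<in>S. f l *\<^sub>C Q l)"
    using \<open>finite S\<close> by (intro sum.mono_neutral_left) auto
  finally show ?thesis .
qed

lemma resolution_eigproj:
  assumes "cadj A = A"
  shows "resolution (real_spectrum A) (eigproj A)" "(\<Sum>l\<in>real_spectrum A. l *\<^sub>R eigproj A l) = A"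
proof -
  obtain P where P: "resolution (real_spectrum A) P" "A = (\<Sum>l\<in>real_spectrum A. l *\<^sub>R P l)"
    by (rule ex_spectral_resolution[OF assms])
  then have eq: "eigproj A l = P l" if "l \<in> real_spectrum A" for l
    using that by (rule eigproj_resolution)
  have "sum (eigproj A) (real_spectrum A) = sum P (real_spectrum A)"
    by (intro sum.cong) (auto simp: eq)
  with P(1) eq show "resolution (real_spectrum A) (eigproj A)"
    by (auto simp: resolution_def)
  have "(\<Sum>l\<in>real_spectrum A. l *\<^sub>R eigproj A l) = (\<Sum>l\<in>real_spectrum A. l *\<^sub>R P l)"
    by (intro sum.cong) (auto simp: eq)
  with P(2) show "(\<Sum>l\<in>real_spectrum A. l *\<^sub>R eigproj A l) = A" by simp
qed

subsection \<open>Functional calculus\<close>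

lemma herm_fun_eq: "herm_fun f A = (\<Sum>l\<in>real_spectrum A. f l *\<^sub>C eigproj A l)"
  by (simp add: herm_fun_def)

lemma herm_fun_cong: "(\<And>l. l \<in> real_spectrum A \<Longrightarrow> f l = g l) \<Longrightarrow> herm_fun f A = herm_fun g A"
  unfolding herm_fun_eq by (intro sum.cong) auto

lemma herm_fun_add: "herm_fun (\<lambda>l. f l + g l) A = herm_fun f A + herm_fun g A"
  by (simp add: herm_fun_eq cscale_add_left sum.distrib)

lemma herm_fun_one: "cadj A = A \<Longrightarrow> herm_fun (\<lambda>_. 1) A = mat 1"
  using resolution_eigproj(1)[of A] by (simp add: herm_fun_eq resolution_def)

lemma herm_fun_of_real: "cadj A = A \<Longrightarrow> herm_fun complex_of_real A = A"
  using resolution_eigproj(2)[of A] by (simp add: herm_fun_eq cscale_of_real)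

lemma herm_fun_mult:
  assumes "cadj A = A"
  shows "herm_fun f A ** herm_fun g A = herm_fun (\<lambda>l. f l * g l) A"
proof -
  note res = resolution_eigproj(1)[OF assms]
  then have fin: "finite (real_spectrum A)"
    and PP: "\<And>l m. l \<in> real_spectrum A \<Longrightarrow> m \<in> real_spectrum A \<Longrightarrow>
      eigproj A l ** eigproj A m = (if l = m then eigproj A l else 0)"
    by (auto simp: resolution_def)
  have "herm_fun f A ** herm_fun g A
      = (\<Sum>l\<in>real_spectrum A. \<Sum>m\<in>real_spectrum A. (f l * g m) *\<^sub>C (eigproj A l ** eigproj A m))"
    unfolding herm_fun_eq matrix_mult_sum_left
    unfolding matrix_mult_sum_right cscale_mult_left cscale_mult_right cscale_cscale
    by (simp only: mult.commute)
  also have "\<dots> = (\<Sum>l\<in>real_spectrum A. \<Sum>m\<in>real_spectrum A. if l = m then (f l * g l) *\<^sub>C eigproj A l else 0)"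
    by (intro sum.cong) (auto simp: PP)
  also have "\<dots> = herm_fun (\<lambda>l. f l * g l) A"
    using fin by (simp add: herm_fun_eq)
  finally show ?thesis .
qed

lemma cadj_herm_fun:
  assumes "cadj A = A"
  shows "cadj (herm_fun f A) = herm_fun (\<lambda>l. cnj (f l)) A"
proof -
  have "cadj (herm_fun f A) = (\<Sum>l\<in>real_spectrum A. cnj (f l) *\<^sub>C cadj (eigproj A l))"
    by (simp add: herm_fun_eq cadj_sum cadj_cscale)
  also have "\<dots> = herm_fun (\<lambda>l. cnj (f l)) A"
    using resolution_eigproj(1)[OF assms] unfolding herm_fun_eq
    by (intro sum.cong) (auto simp: resolution_def)
  finally show ?thesis .
qed

text \<open>Completing \<open>f\<close> by \<open>sqrt (1 - |f|^2)\<close> gives matrices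
  \<open>?F\<close>, \<open>?G\<close> with \<open>cadj ?F ** ?F + cadj ?G ** ?G = mat 1\<close>,
  hence a Pythagorean identity for the Hilbert-Schmidt norms.\<close>

lemma herm_fun_contraction:
  fixes A Y :: "'n::finite op"
  assumes herm: "cadj A = A" and f: "\<And>l. l \<in> real_spectrum A \<Longrightarrow> norm (f l) \<le> 1"
  shows "norm (herm_fun f A ** Y) \<le> norm Y"
proof -
  let ?F = "herm_fun f A" and ?G = "herm_fun (\<lambda>l. complex_of_real (sqrt (1 - (norm (f l))\<^sup>2))) A"
  have "cadj ?F ** ?F + cadj ?G ** ?G = herm_fun (\<lambda>_. 1) A"
    unfolding cadj_herm_fun[OF herm] herm_fun_mult[OF herm] herm_fun_add[symmetric]
  proof (rule herm_fun_cong)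
    fix l assume "l \<in> real_spectrum A"
    then have "(norm (f l))\<^sup>2 \<le> 1"
      using f by (simp add: power_le_one)
    then have "complex_of_real (sqrt (1 - (norm (f l))\<^sup>2)) * complex_of_real (sqrt (1 - (norm (f l))\<^sup>2))
        = of_real (1 - (norm (f l))\<^sup>2)"
      by (simp flip: of_real_mult)
    then show "cnj (f l) * f l + cnj (complex_of_real (sqrt (1 - (norm (f l))\<^sup>2))) *
        complex_of_real (sqrt (1 - (norm (f l))\<^sup>2)) = 1"
      using complex_norm_square[of "f l"] by (simp add: mult.commute)
  qed
  then have sum: "cadj ?F ** ?F + cadj ?G ** ?G = mat 1"
    by (simp add: herm_fun_one[OF herm])
  have "(norm (?F ** Y))\<^sup>2 + (norm (?G ** Y))\<^sup>2
      = Re (trace (cadj Y ** ((cadj ?F ** ?F + cadj ?G ** ?G) ** Y)))"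
    by (simp add: power2_norm_op cadj_mult matrix_mult_add_left matrix_add_ldistrib trace_add matrix_mul_assoc)
  also have "\<dots> = (norm Y)\<^sup>2"
    by (simp add: sum power2_norm_op)
  finally have "(norm (?F ** Y))\<^sup>2 \<le> (norm Y)\<^sup>2"
    by (metis le_add_same_cancel1 zero_le_power2)
  then show ?thesis by (rule power2_le_imp_le) simp
qed

subsection \<open>Positive semidefinite matrices\<close>

lemma psd_herm: "psd A \<Longrightarrow> cadj A = A"
  by (simp add: psd_def)

lemma psd_cadj_mult: "psd (cadj B ** B)"
  unfolding psd_iff
proof (intro conjI allI)
  show "cadj (cadj B ** B) = cadj B ** B" by (simp add: cadj_mult)
  show "0 \<le> v \<bullet> ((cadj B ** B) *v v)" for v
    using inner_mult_vec[of v "cadj B" "B *v v"] by (simp flip: matrix_vector_mul_assoc)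
qed

lemma psd_spectrum_nonneg:
  assumes "psd A" "l \<in> real_spectrum A"
  shows "0 \<le> l"
proof -
  obtain v where v: "v \<noteq> 0" "A *v v = l *\<^sub>R v"
    using assms(2) by (auto simp: real_spectrum_def)
  have "0 \<le> v \<bullet> (A *v v)"
    using assms(1) by (auto simp: psd_iff)
  with v show ?thesis
    by (simp add: zero_le_mult_iff) (metis inner_gt_zero_iff less_le_not_le)
qed

lemma op_sqrt_mult_self:
  assumes "psd A"
  shows "op_sqrt A ** op_sqrt A = A"
proof -
  have "op_sqrt A ** op_sqrt A = herm_fun complex_of_real A"
    unfolding op_sqrt_def herm_fun_mult[OF psd_herm[OF assms]]
    by (rule herm_fun_cong) (use psd_spectrum_nonneg[OF assms] in \<open>simp flip: of_real_mult\<close>)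
  then show ?thesis by (simp add: herm_fun_of_real psd_herm assms)
qed

lemma cadj_op_sqrt: "psd A \<Longrightarrow> cadj (op_sqrt A) = op_sqrt A"
  by (simp add: op_sqrt_def cadj_herm_fun psd_herm)

lemma psd_root:
  assumes "psd A"
  obtains B where "A = cadj B ** B"
  using op_sqrt_mult_self[OF assms] cadj_op_sqrt[OF assms] that by metis

lemma psd_trace_nonneg:
  assumes "psd M"
  shows "0 \<le> Re (trace (cadj Y ** M ** Y))"
proof -
  obtain B where "M = cadj B ** B" using psd_root[OF assms] .
  then have "cadj Y ** M ** Y = cadj (B ** Y) ** (B ** Y)"
    by (simp add: cadj_mult matrix_mul_assoc)
  then show ?thesis
    by (simp flip: power2_norm_op)
qed

lemma psd_trace_Cauchy_Schwarz:
  assumes "psd M"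
  shows "norm (trace (cadj X ** M ** Y))
    \<le> sqrt (Re (trace (cadj X ** M ** X))) * sqrt (Re (trace (cadj Y ** M ** Y)))"
proof -
  obtain B where B: "M = cadj B ** B" using psd_root[OF assms] .
  have eq: "cadj X ** M ** Y = cadj (B ** X) ** (B ** Y)" for X Y
    by (simp add: B cadj_mult matrix_mul_assoc)
  show ?thesis
    unfolding eq power2_norm_op[symmetric] using norm_trace_mult_le[of "B ** X" "B ** Y"] by simp
qed

lemma psd_trace_mult_nonneg:
  assumes "psd A" "psd M"
  shows "0 \<le> Re (trace (A ** M))"
proof -
  obtain B where B: "A = cadj B ** B" using psd_root[OF assms(1)] .
  have "trace (A ** M) = trace (cadj (cadj B) ** M ** cadj B)"
    using trace_mul_sym[of "cadj B" "B ** M"] by (simp add: B matrix_mul_assoc)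
  then show ?thesis using psd_trace_nonneg[OF assms(2), of "cadj B"] by simp
qed

text \<open>For \<open>A = cadj B ** B\<close> and \<open>M = cadj C ** C\<close> the trace is the
  squared norm of \<open>C ** cadj B\<close>.\<close>

lemma psd_mult_eq_0:
  assumes "psd A" "psd M" "Re (trace (A ** M)) = 0"
  shows "A ** M = 0"
proof -
  obtain B where B: "A = cadj B ** B" using psd_root[OF assms(1)] .
  obtain C where C: "M = cadj C ** C" using psd_root[OF assms(2)] .
  have "trace (A ** M) = trace (cadj (C ** cadj B) ** (C ** cadj B))"
    using trace_mul_sym[of "cadj B" "B ** cadj C ** C"] by (simp add: B C matrix_mul_assoc cadj_mult)
  then have "(norm (C ** cadj B))\<^sup>2 = 0"
    using assms(3) by (simp add: power2_norm_op)
  then have "cadj (C ** cadj B) = 0" by simp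
  then have "B ** cadj C = 0" by (simp add: cadj_mult)
  then have "cadj B ** (B ** cadj C) ** C = 0" by simp
  then show ?thesis by (simp add: B C matrix_mul_assoc)
qed

text \<open>Valid for singular \<open>A\<close> as well: at the eigenvalue 0 both sides vanish. So
  \<open>op_power A 0\<close> is the support projection, and opposite exponents multiply to
  it.\<close>

lemma op_power_add:
  "psd A \<Longrightarrow> op_power A z ** op_power A w = op_power A (z + w)"
  by (simp add: op_power_def herm_fun_mult psd_herm powr_add)

lemma cadj_op_power:
  assumes "psd A"
  shows "cadj (op_power A z) = op_power A (cnj z)"
  unfolding op_power_def cadj_herm_fun[OF psd_herm[OF assms]]
  by (rule herm_fun_cong) (use psd_spectrum_nonneg[OF assms] in \<open>simp add: cnj_powr\<close>)

lemma op_power_1: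
  assumes "psd A"
  shows "op_power A 1 = A"
proof -
  have "op_power A 1 = herm_fun complex_of_real A"
    unfolding op_power_def by (rule herm_fun_cong) (auto simp: powr_def)
  then show ?thesis by (simp add: herm_fun_of_real psd_herm assms)
qed

text \<open>Positive eigenvalues give phases and the eigenvalue 0 gives 0: a partial isometry rather
  than a unitary, which is why this is an inequality.\<close>

lemma op_power_imaginary_contraction:
  fixes A Y :: "'n::finite op"
  assumes "psd A" "Re z = 0"
  shows "norm (op_power A z ** Y) \<le> norm Y"
  unfolding op_power_def
proof (rule herm_fun_contraction[OF psd_herm[OF assms(1)]])
  fix l assume "l \<in> real_spectrum A"
  then have "0 \<le> l" by (rule psd_spectrum_nonneg[OF assms(1)])
  then show "norm (complex_of_real l powr z) \<le> 1"
    using assms(2) by (cases "l = 0") (auto simp: norm_powr_real_powr)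
qed

text \<open>The matrix is the projection onto the kernel of \<open>A\<close>, the functional
  calculus of the indicator of 0.\<close>

lemma psd_one_minus_support:
  assumes "psd A"
  shows "psd (mat 1 - op_power A 0)"
proof -
  have herm: "cadj A = A" by (rule psd_herm[OF assms])
  let ?f = "\<lambda>l. if l = 0 then 1 else 0 :: complex"
  have "op_power A 0 + herm_fun ?f A = herm_fun (\<lambda>_. 1) A"
    unfolding op_power_def herm_fun_add[symmetric] by (rule herm_fun_cong) auto
  then have "mat 1 - op_power A 0 = herm_fun ?f A"
    by (simp add: herm_fun_one[OF herm] algebra_simps)
  also have "\<dots> = cadj (herm_fun ?f A) ** herm_fun ?f A"
    unfolding cadj_herm_fun[OF herm] herm_fun_mult[OF herm] by (rule herm_fun_cong) auto
  finally show ?thesis by (simp add: psd_cadj_mult)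
qed

text \<open>Each eigenvalue \<open>l > 0\<close> contributes the frequency \<open>c * ln l\<close>,
  and the eigenvalue 0 contributes nothing.\<close>

lemma exp_sum_op_power:
  assumes "psd A"
  shows "exp_sum (\<lambda>z. op_power A (of_real c * z + of_real d) $ i $ j)"
proof -
  have summand: "exp_sum (\<lambda>z. complex_of_real l powr (of_real c * z + of_real d) * eigproj A l $ i $ j)"
    if "l \<in> real_spectrum A" for l
  proof (cases "l = 0")
    case True
    then show ?thesis using exp_sum_const[of 0] by simp
  next
    case False
    then have "l > 0" using psd_spectrum_nonneg[OF assms that] by simp
    then have "(\<lambda>z. complex_of_real l powr (of_real c * z + of_real d) * eigproj A l $ i $ j)
        = (\<lambda>z. (exp (of_real (d * ln l)) * eigproj A l $ i $ j) * exp (of_real (c * ln l) * z))"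
      by (auto simp: fun_eq_iff powr_def Ln_of_real ring_distribs exp_add mult_ac)
    then show ?thesis by (simp only: exp_sum_term)
  qed
  have "(\<lambda>z. op_power A (of_real c * z + of_real d) $ i $ j)
      = (\<lambda>z. \<Sum>l\<in>real_spectrum A. complex_of_real l powr (of_real c * z + of_real d) * eigproj A l $ i $ j)"
    by (simp add: op_power_def herm_fun_eq)
  then show ?thesis using exp_sum_sum[of "real_spectrum A", OF summand] by simp
qed

lemma bounded_linear_cscale: "bounded_linear (\<lambda>c. c *\<^sub>C A)"
proof -
  have "linear (\<lambda>c. c *\<^sub>C A)"
    by (rule linearI) (auto intro!: op_eqI simp: algebra_simps)
  then show ?thesis by (simp add: linear_conv_bounded_linear)
qed

text \<open>Used with \<open>d = 0\<close>, where the derivative is the logarithm on the support,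
  and with \<open>d = 1\<close>, where it is \<open>A\<close> times its logarithm.\<close>

lemma op_power_has_derivative:
  assumes "psd A"
  shows "((\<lambda>x. op_power A (of_real c * of_real x + of_real d)) has_vector_derivative
    c *\<^sub>R herm_fun (\<lambda>l. of_real l powr of_real d * of_real (ln l)) A) (at 0)"
proof -
  have scalar: "((\<lambda>x. complex_of_real l powr (of_real c * of_real x + of_real d)) has_vector_derivative
      of_real c * (of_real l powr of_real d * of_real (ln l))) (at 0)" if "l \<in> real_spectrum A" for l
  proof (cases "l = 0")
    case False
    then have l: "l > 0" using psd_spectrum_nonneg[OF assms that] by simp
    show ?thesis
    proof (rule has_vector_derivative_real_field)
      show "((\<lambda>z. complex_of_real l powr (of_real c * z + of_real d)) has_field_derivative
          of_real c * (of_real l powr of_real d * of_real (ln l))) (at (of_real 0))"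
        using l by (auto intro!: derivative_eq_intros simp: Ln_of_real powr_def)
    qed
  qed simp
  have "((\<lambda>x. \<Sum>l\<in>real_spectrum A. (complex_of_real l powr (of_real c * of_real x + of_real d)) *\<^sub>C eigproj A l)
      has_vector_derivative
      (\<Sum>l\<in>real_spectrum A. (of_real c * (of_real l powr of_real d * of_real (ln l))) *\<^sub>C eigproj A l)) (at 0)"
    by (intro has_vector_derivative_sum bounded_linear.has_vector_derivative[OF bounded_linear_cscale] scalar)
  then show ?thesis
    by (simp add: op_power_def herm_fun_eq cscale_of_real[symmetric] cscale_sum_right)
qed

lemma bounded_bilinear_matrix_mult: "bounded_bilinear ((**) :: 'n::finite op \<Rightarrow> 'n op \<Rightarrow> 'n op)"
proof -
  have "bilinear ((**) :: 'n::finite op \<Rightarrow> 'n op \<Rightarrow> 'n op)"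
    unfolding bilinear_def
    by (auto intro!: linearI simp: matrix_mult_add_left matrix_add_ldistrib mult_scaleR_left mult_scaleR_right)
  then show ?thesis by (simp add: bilinear_conv_bounded_bilinear)
qed

lemma bounded_linear_trace: "bounded_linear (trace :: 'n::finite op \<Rightarrow> complex)"
proof -
  have "linear (trace :: 'n::finite op \<Rightarrow> complex)"
    by (rule linearI, rule trace_add) (simp add: trace_def scaleR_sum_right)
  then show ?thesis by (simp add: linear_conv_bounded_linear)
qed

subsection \<open>Unital *-homomorphisms\<close>

text \<open>Reindexing and tensoring with an identity are both of this kind, so powers and
  logarithms of a marginal pass through any composition of such embeddings.\<close>

definition star_hom :: "('n::finite op \<Rightarrow> 'm::finite op) \<Rightarrow> bool" where
  "star_hom \<phi> \<longleftrightarrow> (\<forall>A B. \<phi> (A + B) = \<phi> A + \<phi> B) \<and> (\<forall>A B. \<phi> (A ** B) = \<phi> A ** \<phi> B)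
    \<and> (\<forall>c A. \<phi> (c *\<^sub>C A) = c *\<^sub>C \<phi> A) \<and> (\<forall>A. \<phi> (cadj A) = cadj (\<phi> A)) \<and> \<phi> (mat 1) = mat 1"

lemma star_homD:
  assumes "star_hom \<phi>"
  shows "\<phi> (A + B) = \<phi> A + \<phi> B" "\<phi> (A ** B) = \<phi> A ** \<phi> B" "\<phi> (c *\<^sub>C A) = c *\<^sub>C \<phi> A"
    "\<phi> (cadj A) = cadj (\<phi> A)" "\<phi> (mat 1) = mat 1" "\<phi> 0 = 0" "\<phi> (A - B) = \<phi> A - \<phi> B"
proof -
  show add: "\<phi> (A + B) = \<phi> A + \<phi> B" for A B using assms by (simp add: star_hom_def)
  show "\<phi> (A ** B) = \<phi> A ** \<phi> B" "\<phi> (c *\<^sub>C A) = c *\<^sub>C \<phi> A"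
    "\<phi> (cadj A) = cadj (\<phi> A)" "\<phi> (mat 1) = mat 1"
    using assms by (simp_all add: star_hom_def)
  show "\<phi> 0 = 0" using add[of 0 0] by simp
  show "\<phi> (A - B) = \<phi> A - \<phi> B" using add[of "A - B" B] by simp
qed

lemma star_hom_sum: "star_hom \<phi> \<Longrightarrow> \<phi> (sum f S) = (\<Sum>x\<in>S. \<phi> (f x))"
  by (induction S rule: infinite_finite_induct) (auto simp: star_homD)

lemma star_hom_comp: "star_hom \<phi> \<Longrightarrow> star_hom \<psi> \<Longrightarrow> star_hom (\<lambda>A. \<phi> (\<psi> A))"
  by (simp add: star_hom_def)

text \<open>The images of the spectral projections form a resolution for the image of
  \<open>A\<close>, and the functional calculus may be computed from any resolution.\<close>

lemma star_hom_herm_fun: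
  assumes \<phi>: "star_hom \<phi>" and herm: "cadj A = A"
  shows "\<phi> (herm_fun f A) = herm_fun f (\<phi> A)"
proof -
  let ?S = "real_spectrum A" and ?P = "\<lambda>l. \<phi> (eigproj A l)"
  note res = resolution_eigproj[OF herm]
  have "resolution ?S ?P"
    unfolding resolution_def
  proof (intro conjI ballI)
    show "finite ?S" using res(1) by (simp add: resolution_def)
    show "cadj (?P l) = ?P l" if "l \<in> ?S" for l
      using res(1) that by (simp add: resolution_def star_homD(4)[OF \<phi>, symmetric])
    show "?P l ** ?P m = (if l = m then ?P l else 0)" if "l \<in> ?S" "m \<in> ?S" for l m
      using res(1) that by (simp add: resolution_def star_homD(2)[OF \<phi>, symmetric] star_homD(6)[OF \<phi>])
    show "sum ?P ?S = mat 1"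
      using res(1) by (simp add: resolution_def star_hom_sum[OF \<phi>, symmetric] star_homD(5)[OF \<phi>])
  qed
  moreover have "\<phi> A = (\<Sum>l\<in>?S. l *\<^sub>R ?P l)"
    by (subst res(2)[symmetric])
       (simp add: star_hom_sum[OF \<phi>] cscale_of_real[symmetric] star_homD(3)[OF \<phi>])
  ultimately have "herm_fun f (\<phi> A) = (\<Sum>l\<in>?S. f l *\<^sub>C ?P l)"
    by (rule herm_fun_resolution)
  then show ?thesis
    by (simp add: herm_fun_eq star_hom_sum[OF \<phi>] star_homD(3)[OF \<phi>])
qed

lemma star_hom_psd:
  assumes \<phi>: "star_hom \<phi>" and "psd A"
  shows "psd (\<phi> A)"
proof -
  obtain B where "A = cadj B ** B" using psd_root[OF assms(2)] .
  then show ?thesis by (simp add: star_homD[OF \<phi>] psd_cadj_mult)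
qed

lemma star_hom_op_power: "star_hom \<phi> \<Longrightarrow> psd A \<Longrightarrow> \<phi> (op_power A z) = op_power (\<phi> A) z"
  and star_hom_op_log: "star_hom \<phi> \<Longrightarrow> psd A \<Longrightarrow> \<phi> (op_log A) = op_log (\<phi> A)"
  by (simp_all add: op_power_def op_log_def star_hom_herm_fun psd_herm)

lemma star_hom_reindex:
  assumes "bij f"
  shows "star_hom (reindex f)"
proof -
  have "(\<Sum>k\<in>UNIV. A $ f i $ k * B $ k $ f j) = (\<Sum>k\<in>UNIV. A $ f i $ f k * B $ f k $ f j)" for A B i j
    using sum.reindex_bij_betw[of f UNIV UNIV "\<lambda>k. A $ f i $ k * B $ k $ f j"] assms by simp
  then show ?thesis
    unfolding star_hom_def reindex_def
    using bij_is_inj[OF assms]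
    by (intro conjI allI op_eqI) (simp_all add: matrix_matrix_mult_def mat_def inj_eq)
qed

lemma sum_prod_UNIV: "(\<Sum>p\<in>UNIV. g p) = (\<Sum>x\<in>UNIV. \<Sum>y\<in>UNIV. g (x, y))"
  for g :: "'x::finite \<times> 'y::finite \<Rightarrow> 'b::comm_monoid_add"
  by (simp add: sum.cartesian_product flip: UNIV_Times_UNIV)

lemma id_tensor_mult:
  fixes A B :: "'y::finite op"
  shows "(id_tensor (A ** B) :: ('x::finite \<times> 'y) op) = id_tensor A ** id_tensor B"
proof (rule op_eqI)
  fix i j :: "'x \<times> 'y"
  have "(id_tensor A ** id_tensor B) $ i $ j = (\<Sum>x\<in>UNIV. if fst i = x then
      (if x = fst j then \<Sum>y\<in>UNIV. A $ snd i $ y * B $ y $ snd j else 0) else 0)"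
    unfolding matrix_matrix_mult_def id_tensor_def vec_lambda_beta sum_prod_UNIV
    by (intro sum.cong) auto
  then show "id_tensor (A ** B) $ i $ j = (id_tensor A ** id_tensor B) $ i $ j"
    by (simp add: id_tensor_def matrix_matrix_mult_def)
qed

lemma star_hom_id_tensor: "star_hom id_tensor"
  unfolding star_hom_def
  by (intro conjI allI id_tensor_mult) (simp_all add: vec_eq_iff id_tensor_def mat_def prod_eq_iff)

text \<open>The duality between the partial trace and tensoring with the identity.\<close>

lemma trace_mult_id_tensor: "trace (M ** id_tensor A) = trace (ptrace1 M ** A)"
proof -
  have "(M ** id_tensor A) $ (x, y) $ (x, y) = (\<Sum>y'\<in>UNIV. M $ (x, y) $ (x, y') * A $ y' $ y)" for x y
  proof -
    have "(M ** id_tensor A) $ (x, y) $ (x, y)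
        = (\<Sum>x'\<in>UNIV. if x' = x then \<Sum>y'\<in>UNIV. M $ (x, y) $ (x, y') * A $ y' $ y else 0)"
      unfolding matrix_matrix_mult_def id_tensor_def vec_lambda_beta sum_prod_UNIV
      by (intro sum.cong) auto
    then show ?thesis by simp
  qed
  then have "trace (M ** id_tensor A) = (\<Sum>x\<in>UNIV. \<Sum>y\<in>UNIV. \<Sum>y'\<in>UNIV. M $ (x, y) $ (x, y') * A $ y' $ y)"
    by (simp add: trace_def sum_prod_UNIV)
  also have "\<dots> = (\<Sum>y\<in>UNIV. \<Sum>x\<in>UNIV. \<Sum>y'\<in>UNIV. M $ (x, y) $ (x, y') * A $ y' $ y)"
    by (rule sum.swap)
  also have "\<dots> = (\<Sum>y\<in>UNIV. \<Sum>y'\<in>UNIV. \<Sum>x\<in>UNIV. M $ (x, y) $ (x, y') * A $ y' $ y)"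
    by (intro sum.cong refl sum.swap)
  also have "\<dots> = trace (ptrace1 M ** A)"
    by (simp add: trace_def matrix_matrix_mult_def ptrace1_def sum_distrib_right)
  finally show ?thesis .
qed

lemma trace_reindex: "bij f \<Longrightarrow> trace (reindex f A) = trace A"
  unfolding trace_def reindex_def
  using sum.reindex_bij_betw[of f UNIV UNIV "\<lambda>k. A $ k $ k"] by simp

subsection \<open>Fidelity and measurements\<close>

lemma norm_cadj [simp]: "norm (cadj A) = norm A" for A :: "'n::finite op"
proof -
  have "(norm (cadj A))\<^sup>2 = (norm A)\<^sup>2"
    unfolding power2_norm_op cadj_cadj by (simp only: trace_mul_sym[of A])
  then show ?thesis by simp
qed

lemma eigproj_props:
  assumes "cadj A = A" "l \<in> real_spectrum A"
  shows "cadj (eigproj A l) = eigproj A l" "eigproj A l ** eigproj A l = eigproj A l"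
    "A ** eigproj A l = l *\<^sub>R eigproj A l"
proof -
  note res = resolution_eigproj[OF assms(1)]
  show P: "cadj (eigproj A l) = eigproj A l" "eigproj A l ** eigproj A l = eigproj A l"
    using res(1) assms(2) unfolding resolution_def by metis+
  have fin: "finite (real_spectrum A)"
    using res(1) unfolding resolution_def by blast
  have orth: "eigproj A m ** eigproj A l = 0" if "m \<in> real_spectrum A" "m \<noteq> l" for m
    using res(1) assms(2) that unfolding resolution_def by metis
  have "(\<Sum>m\<in>real_spectrum A. m *\<^sub>R eigproj A m) ** eigproj A l
      = (\<Sum>m\<in>real_spectrum A. if m = l then l *\<^sub>R eigproj A l else 0)"
    unfolding matrix_mult_sum_left
    by (intro sum.cong refl) (simp add: mult_scaleR_left orth P)
  then show "A ** eigproj A l = l *\<^sub>R eigproj A l"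
    using assms(2) fin by (simp add: res(2))
qed

text \<open>Instead of a polar decomposition, the eigenprojections \<open>P\<close> of
  \<open>cadj X ** X\<close> are inserted. Since \<open>X ** P\<close> has norm
  \<open>sqrt l\<close> times that of \<open>P\<close>, each term is at most \<open>sqrt l\<close>
  times the trace of \<open>P\<close>.\<close>

lemma norm_trace_le_trace_norm:
  fixes W X :: "'n::finite op"
  assumes contr: "\<And>Y :: 'n op. norm (cadj W ** Y) \<le> norm Y"
  shows "norm (trace (W ** X)) \<le> trace_norm X"
proof -
  let ?H = "cadj X ** X"
  let ?S = "real_spectrum ?H" and ?P = "eigproj ?H"
  have psd: "psd ?H" by (rule psd_cadj_mult)
  note herm = psd_herm[OF psd]
  have one: "sum ?P ?S = mat 1"
    using resolution_eigproj(1)[OF herm] by (simp add: resolution_def)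
  have "trace (W ** X) = trace (W ** X ** sum ?P ?S)"
    by (simp add: one)
  also have "\<dots> = (\<Sum>l\<in>?S. trace (W ** X ** ?P l))"
    by (simp add: matrix_mult_sum_right trace_sum)
  finally have "norm (trace (W ** X)) \<le> (\<Sum>l\<in>?S. norm (trace (W ** X ** ?P l)))"
    by (simp add: norm_sum)
  also have "\<dots> \<le> (\<Sum>l\<in>?S. sqrt l * Re (trace (?P l)))"
  proof (rule sum_mono)
    fix l assume l: "l \<in> ?S"
    note P = eigproj_props[OF herm l]
    have l0: "0 \<le> l" by (rule psd_spectrum_nonneg[OF psd l])
    have "trace (W ** X ** ?P l) = trace ((W ** X ** ?P l) ** ?P l)"
      by (simp add: P(2) flip: matrix_mul_assoc)
    also have "\<dots> = trace (?P l ** (W ** X ** ?P l))"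
      by (rule trace_mul_sym)
    also have "\<dots> = trace (cadj (cadj W ** ?P l) ** (X ** ?P l))"
      by (simp add: cadj_mult P(1) matrix_mul_assoc)
    finally have "norm (trace (W ** X ** ?P l)) \<le> norm (cadj W ** ?P l) * norm (X ** ?P l)"
      using norm_trace_mult_le by simp
    also have "\<dots> \<le> norm (?P l) * norm (X ** ?P l)"
      by (intro mult_right_mono contr) simp
    also have "norm (X ** ?P l) = sqrt l * norm (?P l)"
    proof -
      have "(norm (X ** ?P l))\<^sup>2 = Re (trace (?P l ** (?H ** ?P l)))"
        by (simp add: power2_norm_op cadj_mult P(1) matrix_mul_assoc)
      also have "\<dots> = l * Re (trace (?P l ** ?P l))"
        by (simp add: P(3) cscale_mult_right trace_cscale flip: cscale_of_real)
      also have "\<dots> = (sqrt l * norm (?P l))\<^sup>2"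
        using l0 by (simp add: power_mult_distrib power2_norm_op P(1))
      finally show ?thesis using l0 by simp
    qed
    also have "norm (?P l) * (sqrt l * norm (?P l)) = sqrt l * (norm (?P l))\<^sup>2"
      by (simp add: power2_eq_square)
    also have "(norm (?P l))\<^sup>2 = Re (trace (?P l))"
      by (simp add: power2_norm_op P(1,2))
    finally show "norm (trace (W ** X ** ?P l)) \<le> sqrt l * Re (trace (?P l))" .
  qed
  also have "\<dots> = trace_norm X"
    by (simp add: trace_norm_def op_sqrt_def herm_fun_eq trace_sum trace_cscale Re_sum)
  finally show ?thesis .
qed

lemma op_power_half: "op_power A (1 / 2) = op_sqrt A" if "psd A"
  unfolding op_power_def op_sqrt_def
proof (rule herm_fun_cong)
  fix l assume "l \<in> real_spectrum A"
  then have "0 \<le> l" by (rule psd_spectrum_nonneg[OF that])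
  then show "complex_of_real l powr (1 / 2) = complex_of_real (sqrt l)"
    using powr_of_real[of l "1 / 2"] by (simp add: powr_half_sqrt)
qed

text \<open>\<open>K = \<surd>\<sigma> V\<close> with \<open>\<sigma> = K K\<^sup>*\<close> and the partial isometry \<open>V = \<sigma>\<^sup>-\<^sup>1\<^sup>/\<^sup>2 K\<close>.\<close>

lemma norm_trace_le_fidelity:
  fixes \<rho> K :: "'n::finite op"
  assumes \<rho>: "psd \<rho>" and z: "Re z = 0"
  shows "(norm (trace (op_power \<rho> z ** op_sqrt \<rho> ** K)))\<^sup>2 \<le> fidelity \<rho> (K ** cadj K)"
proof -
  let ?\<sigma> = "K ** cadj K"
  have \<sigma>: "psd ?\<sigma>"
    using psd_cadj_mult[of "cadj K"] by simp
  define V where "V = op_power ?\<sigma> (- (1 / 2)) ** K"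
  have cadj_half: "cadj (op_power ?\<sigma> (- (1 / 2))) = op_power ?\<sigma> (- (1 / 2))"
    by (simp add: cadj_op_power[OF \<sigma>])
  \<comment> \<open>The kernel projection \<open>?Q\<close> annihilates \<open>K ** cadj K\<close>,
    so \<open>?Q ** K\<close> times its own adjoint is 0.\<close>
  have K: "op_power ?\<sigma> 0 ** K = K"
  proof -
    let ?Q = "mat 1 - op_power ?\<sigma> 0"
    have "op_power ?\<sigma> 0 ** op_power ?\<sigma> 1 = op_power ?\<sigma> 1"
      by (simp add: op_power_add[OF \<sigma>])
    then have "?Q ** ?\<sigma> = 0"
      by (simp add: op_power_1[OF \<sigma>] matrix_mult_diff_left)
    then have "trace (?Q ** ?\<sigma> ** cadj ?Q) = 0"
      by simp
    moreover have "?Q ** ?\<sigma> ** cadj ?Q = cadj (cadj (?Q ** K)) ** cadj (?Q ** K)"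
      by (simp add: cadj_mult matrix_mul_assoc)
    ultimately have "(norm (cadj (?Q ** K)))\<^sup>2 = 0"
      by (simp only: power2_norm_op) simp
    then have "?Q ** K = 0" by simp
    then show ?thesis by (simp add: matrix_mult_diff_left)
  qed
  have "op_sqrt ?\<sigma> ** op_power ?\<sigma> (- (1 / 2)) = op_power ?\<sigma> 0"
    by (simp add: op_power_add[OF \<sigma>] flip: op_power_half[OF \<sigma>])
  then have K_V: "op_sqrt ?\<sigma> ** V = K"
    by (simp add: V_def matrix_mul_assoc K)
  \<comment> \<open>\<open>V ** cadj V\<close> is the support projection of
    \<open>?\<sigma>\<close>.\<close>
  have V_contr: "norm (cadj V ** Y) \<le> norm Y" for Y :: "'n op"
  proof -
    have "V ** cadj V = op_power ?\<sigma> (- (1 / 2)) ** op_power ?\<sigma> 1 ** op_power ?\<sigma> (- (1 / 2))"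
      by (simp add: V_def cadj_mult cadj_half op_power_1[OF \<sigma>] matrix_mul_assoc)
    also have "\<dots> = op_power ?\<sigma> 0 ** op_power ?\<sigma> 0"
      by (simp add: op_power_add[OF \<sigma>])
    also have "\<dots> = cadj (op_power ?\<sigma> 0) ** op_power ?\<sigma> 0"
      by (simp add: cadj_op_power[OF \<sigma>])
    finally have VV: "V ** cadj V = cadj (op_power ?\<sigma> 0) ** op_power ?\<sigma> 0" .
    have "(norm (cadj V ** Y))\<^sup>2 = Re (trace (cadj Y ** (V ** cadj V) ** Y))"
      by (simp add: power2_norm_op cadj_mult matrix_mul_assoc)
    also have "\<dots> = (norm (op_power ?\<sigma> 0 ** Y))\<^sup>2"
      unfolding VV by (simp add: power2_norm_op cadj_mult matrix_mul_assoc)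
    also have "\<dots> \<le> (norm Y)\<^sup>2"
      using op_power_imaginary_contraction[OF \<sigma>, of 0 Y] by simp
    finally show ?thesis by (rule power2_le_imp_le) simp
  qed
  let ?X = "op_sqrt \<rho> ** op_sqrt ?\<sigma>"
  have "trace (op_power \<rho> z ** op_sqrt \<rho> ** K) = trace ((op_power \<rho> z ** ?X) ** V)"
    using K_V by (metis matrix_mul_assoc)
  also have "\<dots> = trace (V ** (op_power \<rho> z ** ?X))"
    by (rule trace_mul_sym)
  also have "\<dots> = trace ((V ** op_power \<rho> z) ** ?X)"
    by (simp add: matrix_mul_assoc)
  also have "norm \<dots> \<le> trace_norm ?X"
  proof (rule norm_trace_le_trace_norm)
    fix Y :: "'n op"
    have "norm (cadj (V ** op_power \<rho> z) ** Y) = norm (op_power \<rho> (cnj z) ** (cadj V ** Y))"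
      by (simp add: cadj_mult cadj_op_power[OF \<rho>] matrix_mul_assoc)
    also have "\<dots> \<le> norm (cadj V ** Y)"
      using z by (intro op_power_imaginary_contraction[OF \<rho>]) simp
    also have "\<dots> \<le> norm Y" by (rule V_contr)
    finally show "norm (cadj (V ** op_power \<rho> z) ** Y) \<le> norm Y" .
  qed
  finally show ?thesis
    by (simp add: fidelity_def power_mono)
qed

text \<open>Cauchy-Schwarz for the form of each \<open>M k\<close>, then for the sum over
  \<open>k\<close>. Completeness of the POVM collapses the \<open>X\<close> side to the norm of
  \<open>X\<close>; the weights are all put on the \<open>Y\<close> side.\<close>

lemma povm_Cauchy_Schwarz:
  fixes X Y :: "'n::finite op"
  assumes "povm n M"
  shows "(norm (trace (cadj X ** (\<Sum>k<n. w k *\<^sub>C M k) ** Y)))\<^sup>2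
    \<le> (norm X)\<^sup>2 * (\<Sum>k<n. (norm (w k))\<^sup>2 * Re (trace (cadj Y ** M k ** Y)))"
proof -
  have psd: "psd (M k)" if "k < n" for k
    using assms that by (simp add: povm_def)
  define a b where "a k = sqrt (Re (trace (cadj X ** M k ** X)))"
    and "b k = norm (w k) * sqrt (Re (trace (cadj Y ** M k ** Y)))" for k
  have "trace (cadj X ** (\<Sum>k<n. w k *\<^sub>C M k) ** Y) = (\<Sum>k<n. w k * trace (cadj X ** M k ** Y))"
    by (simp add: matrix_mult_sum_left matrix_mult_sum_right cscale_mult_left cscale_mult_right
        trace_sum trace_cscale)
  then have "norm (trace (cadj X ** (\<Sum>k<n. w k *\<^sub>C M k) ** Y))
      \<le> (\<Sum>k<n. norm (w k) * norm (trace (cadj X ** M k ** Y)))"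
    by (simp add: norm_sum[THEN order_trans] norm_mult)
  also have "\<dots> \<le> (\<Sum>k<n. a k * b k)"
  proof (rule sum_mono)
    fix k assume "k \<in> {..<n}"
    then have "norm (trace (cadj X ** M k ** Y))
        \<le> a k * sqrt (Re (trace (cadj Y ** M k ** Y)))"
      unfolding a_def by (intro psd_trace_Cauchy_Schwarz psd) simp
    then have "norm (w k) * norm (trace (cadj X ** M k ** Y))
        \<le> norm (w k) * (a k * sqrt (Re (trace (cadj Y ** M k ** Y))))"
      by (rule mult_left_mono) simp
    then show "norm (w k) * norm (trace (cadj X ** M k ** Y)) \<le> a k * b k"
      by (simp add: b_def mult_ac)
  qed
  finally have "(norm (trace (cadj X ** (\<Sum>k<n. w k *\<^sub>C M k) ** Y)))\<^sup>2 \<le> (\<Sum>k<n. a k * b k)\<^sup>2"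
    by (rule power_mono) simp
  also have "\<dots> \<le> (\<Sum>k<n. (a k)\<^sup>2) * (\<Sum>k<n. (b k)\<^sup>2)"
    by (rule Cauchy_Schwarz_ineq_sum)
  also have "(\<Sum>k<n. (a k)\<^sup>2) = (\<Sum>k<n. Re (trace (cadj X ** M k ** X)))"
    using psd_trace_nonneg[OF psd] by (intro sum.cong) (auto simp: a_def)
  also have "\<dots> = Re (trace (cadj X ** (\<Sum>k<n. M k) ** X))"
    by (simp add: matrix_mult_sum_left matrix_mult_sum_right trace_sum Re_sum)
  also have "\<dots> = (norm X)\<^sup>2"
    using assms by (simp add: povm_def power2_norm_op)
  also have "(\<Sum>k<n. (b k)\<^sup>2) = (\<Sum>k<n. (norm (w k))\<^sup>2 * Re (trace (cadj Y ** M k ** Y)))"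
    using psd_trace_nonneg[OF psd] by (intro sum.cong) (auto simp: b_def power_mult_distrib)
  finally show ?thesis .
qed

subsection \<open>The interpolation argument\<close>

text \<open>The general form of \<open>K(z)\<close> in the overview. The exponents are halved so
  that at Re z = 1 the product of the chain with its adjoint contains full powers.\<close>

fun power_chain :: "(real \<times> 'n::finite op) list \<Rightarrow> complex \<Rightarrow> 'n op" where
  "power_chain [] z = mat 1"
| "power_chain ((s, A) # L) z = op_power A (of_real (s / 2) * z) ** power_chain L z"

lemma exp_sum_matrix_mult:
  fixes F G :: "complex \<Rightarrow> 'n::finite op"
  assumes "\<And>i j. exp_sum (\<lambda>z. F z $ i $ j)" "\<And>i j. exp_sum (\<lambda>z. G z $ i $ j)"
  shows "exp_sum (\<lambda>z. (F z ** G z) $ i $ j)"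
  using assms by (simp add: matrix_matrix_mult_def exp_sum_sum exp_sum_mult)

lemma exp_sum_power_chain:
  "\<forall>p\<in>set L. psd (snd p) \<Longrightarrow> exp_sum (\<lambda>z. power_chain L z $ i $ j)"
proof (induction L arbitrary: i j)
  case Nil
  show ?case by (simp add: exp_sum_const)
next
  case (Cons p L)
  obtain s A where p: "p = (s, A)" by (cases p)
  have "psd A" using Cons.prems p by simp
  then have "exp_sum (\<lambda>z. op_power A (of_real (s / 2) * z) $ i $ j)" for i j
    using exp_sum_op_power[of A "s / 2" 0] by simp
  then show ?case
    using Cons by (auto simp: p intro!: exp_sum_matrix_mult)
qed

lemma power_chain_contraction:
  fixes Y :: "'n::finite op"
  shows "\<forall>p\<in>set L. psd (snd p) \<Longrightarrow> norm (power_chain L (\<i> * of_real t) ** Y) \<le> norm Y"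
proof (induction L)
  case (Cons p L)
  obtain s A where p: "p = (s, A)" by (cases p)
  have "norm (power_chain (p # L) (\<i> * of_real t) ** Y)
      = norm (op_power A (of_real (s / 2) * (\<i> * of_real t)) ** (power_chain L (\<i> * of_real t) ** Y))"
    by (simp add: p matrix_mul_assoc)
  also have "\<dots> \<le> norm (power_chain L (\<i> * of_real t) ** Y)"
    using Cons.prems p by (intro op_power_imaginary_contraction) auto
  also have "\<dots> \<le> norm Y" using Cons by simp
  finally show ?case .
qed simp

text \<open>At 0 every factor is a support projection, and the hypothesis says that each of these
  supports contains that of \<rho>.\<close>

lemma power_chain_absorb:
  "\<forall>p\<in>set L. psd (snd p) \<and> \<rho> ** op_power (snd p) 0 = \<rho> \<Longrightarrow> cadj \<rho> = \<rho> \<Longrightarrow>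
    power_chain L 0 ** \<rho> = \<rho>"
proof (induction L)
  case (Cons p L)
  obtain s A where p: "p = (s, A)" by (cases p)
  have A: "psd A" "\<rho> ** op_power A 0 = \<rho>" using Cons.prems p by auto
  then have "op_power A 0 ** \<rho> = \<rho>"
    using Cons.prems(2) cadj_mult[of \<rho> "op_power A 0"] by (simp add: cadj_op_power)
  moreover have "power_chain L 0 ** \<rho> = \<rho>" using Cons by simp
  ultimately show ?case by (simp add: p flip: matrix_mul_assoc)
qed simp

lemma op_power_has_derivative_log:
  assumes "psd A"
  shows "((\<lambda>x. op_power A (of_real c * of_real x)) has_vector_derivative c *\<^sub>R op_log A) (at 0)"
proof -
  have "herm_fun (\<lambda>l. of_real l powr of_real 0 * of_real (ln l)) A = op_log A"
    unfolding op_log_def by (rule herm_fun_cong) auto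
  then show ?thesis
    using op_power_has_derivative[OF assms, of c 0] by simp
qed

text \<open>In the product rule at 0 the undifferentiated factors are support projections. Under the
  trace with \<rho> they are absorbed from the left or, by cyclicity, from the right, leaving one
  logarithm per factor.\<close>

lemma power_chain_derivative:
  "\<forall>p\<in>set L. psd (snd p) \<and> \<rho> ** op_power (snd p) 0 = \<rho> \<Longrightarrow> cadj \<rho> = \<rho> \<Longrightarrow>
    \<exists>K. ((\<lambda>x. power_chain L (of_real x)) has_vector_derivative K) (at 0) \<and>
      2 * trace (\<rho> ** K) = (\<Sum>(s, A)\<leftarrow>L. of_real s * trace (\<rho> ** op_log A))"
proof (induction L)
  case Nil
  show ?case by (intro exI[of _ 0]) simp
next
  case (Cons p L)
  obtain s A where p: "p = (s, A)" by (cases p)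
  have A: "psd A" "\<rho> ** op_power A 0 = \<rho>" using Cons.prems p by auto
  obtain K where K: "((\<lambda>x. power_chain L (of_real x)) has_vector_derivative K) (at 0)"
    "2 * trace (\<rho> ** K) = (\<Sum>(s, A)\<leftarrow>L. of_real s * trace (\<rho> ** op_log A))"
    using Cons by auto
  have absorb: "power_chain L 0 ** \<rho> = \<rho>"
    using Cons.prems by (intro power_chain_absorb) auto
  let ?K = "op_power A (of_real (s / 2) * of_real 0) ** K + ((s / 2) *\<^sub>R op_log A) ** power_chain L (of_real 0)"
  have "((\<lambda>x. power_chain (p # L) (of_real x)) has_vector_derivative ?K) (at 0)"
    unfolding p power_chain.simps
    by (intro bounded_bilinear.has_vector_derivative[OF bounded_bilinear_matrix_mult]
        op_power_has_derivative_log A(1) K(1))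
  moreover have "2 * trace (\<rho> ** ?K) = (\<Sum>(s, A)\<leftarrow>p # L. of_real s * trace (\<rho> ** op_log A))"
  proof -
    have "trace (\<rho> ** op_log A ** power_chain L 0) = trace (\<rho> ** op_log A)"
      using absorb trace_mul_sym[of "\<rho> ** op_log A" "power_chain L 0"] by (simp add: matrix_mul_assoc)
    moreover have "\<rho> ** ?K = \<rho> ** op_power A 0 ** K + of_real (s / 2) *\<^sub>C (\<rho> ** op_log A ** power_chain L 0)"
      by (simp add: matrix_add_ldistrib mult_scaleR_left mult_scaleR_right cscale_of_real matrix_mul_assoc
          del: of_real_divide)
    ultimately show ?thesis
      using K(2) by (simp add: A(2) trace_add trace_cscale p algebra_simps)
  qed
  ultimately show ?case by blast
qed

lemma trace_cyclic: "trace (A ** B ** C) = trace (B ** C ** A)" for A B C :: "'n::finite op"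
  using trace_mul_sym[of A "B ** C"] by (simp add: matrix_mul_assoc)

lemma continuous_on_op:
  fixes F :: "real \<Rightarrow> 'n::finite op"
  assumes "\<And>i j. continuous_on S (\<lambda>t. F t $ i $ j)"
  shows "continuous_on S F"
proof -
  have "continuous_on S (\<lambda>t. \<chi> i. \<chi> j. F t $ i $ j)"
    by (intro continuous_on_vec_lambda assms)
  then show ?thesis by simp
qed

lemma norm_op_le_sum: "norm A \<le> (\<Sum>i\<in>UNIV. \<Sum>j\<in>UNIV. norm (A $ i $ j))" for A :: "'n::finite op"
proof -
  have le: "norm x \<le> (\<Sum>i\<in>UNIV. norm (x $ i))" for x :: "('b::real_normed_vector)^'n"
    unfolding norm_vec_def by (rule L2_set_le_sum) simp
  show ?thesis
    by (rule order_trans[OF le]) (intro sum_mono le)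
qed

text \<open>The analytic argument uses no tensor structure, only positive operators whose supports
  contain that of \<rho>.\<close>

locale interpolation =
  fixes \<rho> :: "'n::finite op" and L :: "(real \<times> 'n op) list"
  assumes state: "state \<rho>"
    and L: "\<forall>p\<in>set L. psd (snd p) \<and> \<rho> ** op_power (snd p) 0 = \<rho>"
begin

text \<open>For the list of embedded marginals this becomes the conditional multipartite
  information.\<close>

definition info :: real where
  "info = Re (trace (\<rho> ** op_log \<rho>)) - (\<Sum>(s, A)\<leftarrow>L. s * Re (trace (\<rho> ** op_log A)))"

definition chain :: "real \<Rightarrow> 'n op" where
  "chain t = power_chain L (1 + \<i> * of_real t)"

text \<open>The function \<open>f\<close> of the overview. The exponent \<open>1 - z / 2\<close> is
  spelled in the shape \<open>c * z + d\<close> to which the power lemmas apply.\<close>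

definition interp :: "nat \<Rightarrow> (nat \<Rightarrow> 'n op) \<Rightarrow> (nat \<Rightarrow> real) \<Rightarrow> complex \<Rightarrow> complex" where
  "interp n M lam z = trace (op_power \<rho> (of_real (- (1 / 2)) * z + of_real 1)
     ** (\<Sum>k<n. exp (of_real (lam k / 2) * z) *\<^sub>C M k) ** power_chain L z)"

lemma psd: "psd \<rho>" and trace_1: "trace \<rho> = 1"
  using state by (simp_all add: state_def)

lemma psd_L: "\<forall>p\<in>set L. psd (snd p)"
  using L by blast

lemma exp_sum_interp: "exp_sum (interp n M lam)"
proof -
  have W: "exp_sum (\<lambda>z. (\<Sum>k<n. exp (of_real (lam k / 2) * z) *\<^sub>C M k) $ i $ j)" for i j
  proof -
    have "exp_sum (\<lambda>z. \<Sum>k<n. M k $ i $ j * exp (of_real (lam k / 2) * z))"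
      by (intro exp_sum_sum exp_sum_term)
    then show ?thesis by (simp add: mult.commute)
  qed
  have "exp_sum (\<lambda>z. (op_power \<rho> (of_real (- (1 / 2)) * z + of_real 1)
     ** (\<Sum>k<n. exp (of_real (lam k / 2) * z) *\<^sub>C M k) ** power_chain L z) $ i $ j)" for i j
    by (intro exp_sum_matrix_mult exp_sum_op_power psd W exp_sum_power_chain psd_L)
  then show ?thesis
    unfolding interp_def[abs_def] trace_def by (intro exp_sum_sum)
qed

lemma chain_absorb: "power_chain L 0 ** \<rho> = \<rho>"
  by (rule power_chain_absorb[OF L psd_herm[OF psd]])

lemma interp_0:
  assumes "povm n M"
  shows "interp n M lam 0 = 1"
proof -
  have "interp n M lam 0 = trace (\<rho> ** power_chain L 0)"
    using assms by (simp add: interp_def povm_def op_power_1[OF psd])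
  also have "\<dots> = 1"
    using trace_mul_sym[of \<rho>] by (simp add: chain_absorb trace_1)
  finally show ?thesis .
qed

lemma norm_root: "Re z = 1 / 2 \<Longrightarrow> norm (op_power \<rho> z) = 1"
proof -
  assume "Re z = 1 / 2"
  then have "cnj z + z = 1" by (simp add: complex_eq_iff)
  then have "(norm (op_power \<rho> z))\<^sup>2 = 1"
    by (simp add: power2_norm_op cadj_op_power[OF psd] op_power_add[OF psd] op_power_1[OF psd] trace_1)
  then show "norm (op_power \<rho> z) = 1"
    by (simp add: power2_eq_1_iff) (metis norm_ge_zero not_one_le_zero neg_0_le_iff_le)
qed

text \<open>The power of \<rho> splits as \<open>\<rho>^(1/2)\<close> times
  \<open>\<rho>^((1 - it)/2)\<close>, and cyclicity moves the first half behind the chain. Both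
  halves have norm 1, the weights are phases, and the chain is a contraction.\<close>

lemma interp_left:
  assumes povm: "povm n M"
  shows "norm (interp n M lam (\<i> * of_real t)) \<le> 1"
proof -
  define X where "X = op_power \<rho> ((1 + \<i> * of_real t) / 2)"
  define W where "W = (\<Sum>k<n. exp (of_real (lam k / 2) * (\<i> * of_real t)) *\<^sub>C M k)"
  define Y where "Y = power_chain L (\<i> * of_real t) ** op_power \<rho> (1 / 2)"
  have "op_power \<rho> (1 / 2) ** cadj X = op_power \<rho> (of_real (- (1 / 2)) * (\<i> * of_real t) + of_real 1)"
    unfolding X_def cadj_op_power[OF psd] op_power_add[OF psd]
    by (rule arg_cong[where f = "op_power \<rho>"]) (simp add: complex_eq_iff)
  then have "interp n M lam (\<i> * of_real t)
      = trace (op_power \<rho> (1 / 2) ** (cadj X ** W) ** power_chain L (\<i> * of_real t))"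
    by (simp add: interp_def W_def matrix_mul_assoc)
  also have "\<dots> = trace (cadj X ** W ** Y)"
    by (subst trace_cyclic) (simp add: Y_def matrix_mul_assoc)
  finally have eq: "interp n M lam (\<i> * of_real t) = trace (cadj X ** W ** Y)" .
  have "(norm (trace (cadj X ** W ** Y)))\<^sup>2 \<le> (norm X)\<^sup>2 * (\<Sum>k<n.
      (norm (exp (of_real (lam k / 2) * (\<i> * of_real t))))\<^sup>2 * Re (trace (cadj Y ** M k ** Y)))"
    unfolding W_def by (rule povm_Cauchy_Schwarz[OF povm])
  also have "\<dots> = (\<Sum>k<n. Re (trace (cadj Y ** M k ** Y)))"
    by (simp add: X_def norm_root)
  also have "\<dots> = Re (trace (cadj Y ** (\<Sum>k<n. M k) ** Y))"
    by (simp add: matrix_mult_sum_left matrix_mult_sum_right trace_sum Re_sum)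
  also have "\<dots> = (norm Y)\<^sup>2"
    using povm by (simp add: povm_def power2_norm_op)
  also have "\<dots> \<le> 1\<^sup>2"
  proof (rule power_mono)
    show "norm Y \<le> 1"
      using power_chain_contraction[OF psd_L, of t "op_power \<rho> (1 / 2)"]
      by (simp add: Y_def norm_root)
  qed simp
  finally have "(norm (trace (cadj X ** W ** Y)))\<^sup>2 \<le> 1\<^sup>2" .
  then show ?thesis
    unfolding eq by (rule power2_le_imp_le) simp
qed

lemma interp_right_eq:
  "interp n M lam (1 + \<i> * of_real t) = trace (cadj (op_power \<rho> ((1 + \<i> * of_real t) / 2))
    ** (\<Sum>k<n. exp (of_real (lam k / 2) * (1 + \<i> * of_real t)) *\<^sub>C M k) ** chain t)"
proof -
  have "cadj (op_power \<rho> ((1 + \<i> * of_real t) / 2))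
      = op_power \<rho> (of_real (- (1 / 2)) * (1 + \<i> * of_real t) + of_real 1)"
    unfolding cadj_op_power[OF psd]
    by (rule arg_cong[where f = "op_power \<rho>"]) (simp add: complex_eq_iff)
  then show ?thesis by (simp add: interp_def chain_def)
qed

lemma interp_right:
  assumes povm: "povm n M"
  shows "(norm (interp n M lam (1 + \<i> * of_real t)))\<^sup>2
    \<le> (\<Sum>k<n. exp (lam k) * Re (trace (chain t ** cadj (chain t) ** M k)))"
proof -
  let ?X = "op_power \<rho> ((1 + \<i> * of_real t) / 2)"
  have "(norm (interp n M lam (1 + \<i> * of_real t)))\<^sup>2 \<le> (norm ?X)\<^sup>2 * (\<Sum>k<n.
      (norm (exp (of_real (lam k / 2) * (1 + \<i> * of_real t))))\<^sup>2
        * Re (trace (cadj (chain t) ** M k ** chain t)))"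
    unfolding interp_right_eq by (rule povm_Cauchy_Schwarz[OF povm])
  also have "\<dots> = (\<Sum>k<n. exp (lam k) * Re (trace (chain t ** cadj (chain t) ** M k)))"
    using trace_cyclic[of "chain t" "cadj (chain t)"] by (simp add: norm_root exp_double[symmetric])
  finally show ?thesis .
qed

text \<open>\<open>\<rho>^((1 - it)/2)\<close> is the square root of \<rho> times an imaginary
  power; the latter is a contraction, so the variational bound for the fidelity absorbs it.\<close>

lemma interp_right_fidelity:
  "(norm (interp 1 (\<lambda>_. mat 1) (\<lambda>_. 0) (1 + \<i> * of_real t)))\<^sup>2 \<le> fidelity \<rho> (chain t ** cadj (chain t))"
proof -
  let ?z = "- (\<i> * of_real t) / 2"
  have "cadj (op_power \<rho> ((1 + \<i> * of_real t) / 2)) = op_power \<rho> ?z ** op_sqrt \<rho>"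
    unfolding cadj_op_power[OF psd] op_power_half[OF psd, symmetric] op_power_add[OF psd]
    by (rule arg_cong[where f = "op_power \<rho>"]) (simp add: complex_eq_iff)
  then have "interp 1 (\<lambda>_. mat 1) (\<lambda>_. 0) (1 + \<i> * of_real t) = trace (op_power \<rho> ?z ** op_sqrt \<rho> ** chain t)"
    unfolding interp_right_eq by simp
  then show ?thesis
    using norm_trace_le_fidelity[OF psd, of ?z "chain t"] by simp
qed

text \<open>The three factors of the product rule contribute half of - tr (\<rho> log \<rho>), of
  the weighted outcome probabilities and of the signed logarithms of the chain.\<close>

lemma interp_derivative:
  assumes povm: "povm n M"
  obtains d where "((\<lambda>x. interp n M lam (of_real x)) has_vector_derivative d) (at 0)"
    "2 * Re d = (\<Sum>k<n. lam k * Re (trace (\<rho> ** M k))) - info"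
proof -
  obtain K where K: "((\<lambda>x. power_chain L (of_real x)) has_vector_derivative K) (at 0)"
    "2 * trace (\<rho> ** K) = (\<Sum>(s, A)\<leftarrow>L. of_real s * trace (\<rho> ** op_log A))"
    using power_chain_derivative[OF L psd_herm[OF psd]] by blast
  let ?P = "\<lambda>x::real. op_power \<rho> (of_real (- (1 / 2)) * of_real x + of_real 1)"
  let ?W = "\<lambda>x::real. \<Sum>k<n. exp (of_real (lam k / 2) * of_real x) *\<^sub>C M k"
  let ?P' = "(- (1 / 2)) *\<^sub>R (\<rho> ** op_log \<rho>)"
  let ?W' = "\<Sum>k<n. (of_real (lam k / 2)) *\<^sub>C M k"
  have P': "(?P has_vector_derivative ?P') (at 0)"
  proof -
    have "herm_fun (\<lambda>l. of_real l powr of_real 1 * of_real (ln l)) \<rho> = \<rho> ** op_log \<rho>"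
    proof -
      have "\<rho> ** op_log \<rho> = herm_fun complex_of_real \<rho> ** op_log \<rho>"
        by (simp add: herm_fun_of_real psd_herm[OF psd])
      also have "\<dots> = herm_fun (\<lambda>l. of_real l * of_real (ln l)) \<rho>"
        unfolding op_log_def herm_fun_mult[OF psd_herm[OF psd]] ..
      also have "\<dots> = herm_fun (\<lambda>l. of_real l powr of_real 1 * of_real (ln l)) \<rho>"
        by (rule herm_fun_cong) (auto simp: powr_def)
      finally show ?thesis by simp
    qed
    then show ?thesis
      using op_power_has_derivative[OF psd, of "- (1 / 2)" 1] by (simp only:)
  qed
  have W': "(?W has_vector_derivative ?W') (at 0)"
  proof (intro has_vector_derivative_sum bounded_linear.has_vector_derivative[OF bounded_linear_cscale])
    fix k
    show "((\<lambda>x. exp (of_real (lam k / 2) * of_real x)) has_vector_derivative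
        complex_of_real (lam k / 2)) (at 0)"
      by (rule has_vector_derivative_real_field) (auto intro!: derivative_eq_intros)
  qed
  have M_sum: "(\<Sum>k<n. M k) = mat 1"
    using povm by (simp add: povm_def)
  have W0: "?W 0 = mat 1" by (simp add: M_sum)
  have P0: "?P 0 = \<rho>" by (simp add: op_power_1[OF psd])
  let ?D = "(?P 0 ** ?W 0) ** K + (?P 0 ** ?W' + ?P' ** ?W 0) ** power_chain L (of_real 0)"
  have "((\<lambda>x. ?P x ** ?W x ** power_chain L (of_real x)) has_vector_derivative ?D) (at 0)"
    by (intro bounded_bilinear.has_vector_derivative[OF bounded_bilinear_matrix_mult] P' W' K(1))
  from bounded_linear.has_vector_derivative[OF bounded_linear_trace this]
  have deriv: "((\<lambda>x. interp n M lam (of_real x)) has_vector_derivative trace ?D) (at 0)"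
    by (simp only: interp_def)
  have absorb: "trace (\<rho> ** A ** power_chain L 0) = trace (\<rho> ** A)" for A
    using trace_cyclic[of "power_chain L 0" \<rho> A] by (simp add: chain_absorb)
  have "?D = \<rho> ** K + (\<Sum>k<n. of_real (lam k / 2) *\<^sub>C (\<rho> ** M k ** power_chain L 0))
      + of_real (- (1 / 2)) *\<^sub>C (\<rho> ** op_log \<rho> ** power_chain L 0)"
    unfolding W0 P0 cscale_of_real
    by (simp add: matrix_mult_add_left matrix_mult_sum_left matrix_mult_sum_right
        matrix_mult_diff_left mult_scaleR_left mult_scaleR_right)
  then have tr_D: "trace ?D = trace (\<rho> ** K) + (\<Sum>k<n. of_real (lam k / 2) * trace (\<rho> ** M k))
      - (1 / 2) * trace (\<rho> ** op_log \<rho>)"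
    by (simp only: trace_add trace_sum trace_cscale absorb) simp
  have tr_2D: "2 * trace ?D = (\<Sum>(s, A)\<leftarrow>L. of_real s * trace (\<rho> ** op_log A))
      + (\<Sum>k<n. of_real (lam k) * trace (\<rho> ** M k)) - trace (\<rho> ** op_log \<rho>)"
    unfolding tr_D K(2)[symmetric] by (simp add: algebra_simps sum_distrib_left)
  have "2 * Re w = Re (2 * w)" for w by simp
  then have "2 * Re (trace ?D) = Re ((\<Sum>(s, A)\<leftarrow>L. of_real s * trace (\<rho> ** op_log A))
      + (\<Sum>k<n. of_real (lam k) * trace (\<rho> ** M k)) - trace (\<rho> ** op_log \<rho>))"
    by (simp only: tr_2D)
  also have "\<dots> = (\<Sum>k<n. lam k * Re (trace (\<rho> ** M k))) - info"
  proof -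
    have "Re (\<Sum>(s, A)\<leftarrow>L'. of_real s * trace (\<rho> ** op_log A))
        = (\<Sum>(s, A)\<leftarrow>L'. s * Re (trace (\<rho> ** op_log A)))" for L'
      by (induction L') auto
    then show ?thesis by (simp add: info_def Re_sum)
  qed
  finally show thesis using deriv by (intro that)
qed

lemma interp_bound:
  assumes povm: "povm n M" and "\<epsilon> > 0"
  shows "(\<Sum>k<n. lam k * Re (trace (\<rho> ** M k))) - info
      \<le> (LINT t|lborel. \<beta>\<^sub>0 t * ln ((norm (interp n M lam (1 + \<i> * of_real t)))\<^sup>2 + \<epsilon>))"
    and "integrable lborel (\<lambda>t. \<beta>\<^sub>0 t * ln ((norm (interp n M lam (1 + \<i> * of_real t)))\<^sup>2 + \<epsilon>))"
proof -
  obtain d where d: "((\<lambda>x. interp n M lam (of_real x)) has_vector_derivative d) (at 0)"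
    "2 * Re d = (\<Sum>k<n. lam k * Re (trace (\<rho> ** M k))) - info"
    by (rule interp_derivative[OF povm])
  note * = exp_sum_derivative_le[OF exp_sum_interp interp_0[OF povm] interp_left[OF povm] d(1) \<open>\<epsilon> > 0\<close>]
  show "(\<Sum>k<n. lam k * Re (trace (\<rho> ** M k))) - info
      \<le> (LINT t|lborel. \<beta>\<^sub>0 t * ln ((norm (interp n M lam (1 + \<i> * of_real t)))\<^sup>2 + \<epsilon>))"
    using *(1) by (simp add: d(2))
  show "integrable lborel (\<lambda>t. \<beta>\<^sub>0 t * ln ((norm (interp n M lam (1 + \<i> * of_real t)))\<^sup>2 + \<epsilon>))"
    by (rule *(2))
qed

text \<open>Without this the Bochner integral would be the default 0. The entries are exponential
  sums restricted to a vertical line, hence continuous and bounded.\<close>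

lemma integrable_chain: "integrable lborel (\<lambda>t. \<beta>\<^sub>0 t *\<^sub>R (chain t ** cadj (chain t)))"
proof -
  define F where "F i j z = (\<Sum>k\<in>UNIV. power_chain L (1 + z) $ i $ k * cnj (power_chain L (1 + - cnj z) $ j $ k))"
    for i j z
  have F: "exp_sum (F i j)" for i j
    unfolding F_def[abs_def]
    by (intro exp_sum_sum exp_sum_mult exp_sum_shift[where f = "\<lambda>z. power_chain L z $ _ $ _"]
        exp_sum_cnj[where f = "\<lambda>z. power_chain L (1 + z) $ _ $ _"] exp_sum_power_chain psd_L)
  have entry: "(chain t ** cadj (chain t)) $ i $ j = F i j (\<i> * of_real t)" for i j t
    by (simp add: F_def chain_def matrix_matrix_mult_def)
  have "\<forall>i j. \<exists>B. \<forall>z. 0 \<le> Re z \<longrightarrow> Re z \<le> 1 \<longrightarrow> norm (F i j z) \<le> B"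
    using exp_sum_bounded[OF F] by blast
  then obtain B where B: "\<And>i j z. 0 \<le> Re z \<Longrightarrow> Re z \<le> 1 \<Longrightarrow> norm (F i j z) \<le> B i j"
    by metis
  show ?thesis
  proof (rule integrable_\<beta>\<^sub>0_bounded)
    show "continuous_on UNIV (\<lambda>t. chain t ** cadj (chain t))"
    proof (rule continuous_on_op)
      fix i j
      have "continuous_on UNIV (F i j)"
        using exp_sum_holomorphic[OF F] by (rule holomorphic_on_imp_continuous_on)
      then show "continuous_on UNIV (\<lambda>t. (chain t ** cadj (chain t)) $ i $ j)"
        unfolding entry by (rule continuous_on_compose2) (auto intro!: continuous_intros)
    qed
    show "norm (chain t ** cadj (chain t)) \<le> (\<Sum>i\<in>UNIV. \<Sum>j\<in>UNIV. B i j)" for t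
      by (rule order_trans[OF norm_op_le_sum]) (unfold entry, intro sum_mono B, simp_all)
  qed
qed

lemma measured_bound:
  assumes povm: "povm n M" and \<epsilon>: "\<epsilon> > 0"
  defines "q \<equiv> \<lambda>k. Re (trace ((LINT t|lborel. \<beta>\<^sub>0 t *\<^sub>R (chain t ** cadj (chain t))) ** M k))"
  shows "(\<Sum>k<n. lam k * Re (trace (\<rho> ** M k))) - info \<le> ln ((\<Sum>k<n. exp (lam k) * q k) + \<epsilon>)"
    and "\<And>k. k < n \<Longrightarrow> 0 \<le> q k"
proof -
  define r where "r k t = Re (trace (chain t ** cadj (chain t) ** M k))" for k t
  have lin: "bounded_linear (\<lambda>A. Re (trace (A ** M k)))" for k
    by (intro bounded_linear_compose[OF bounded_linear_Re]
        bounded_linear_compose[OF bounded_linear_trace]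
        bounded_bilinear.bounded_linear_left[OF bounded_bilinear_matrix_mult])
  have r_eq: "Re (trace ((\<beta>\<^sub>0 t *\<^sub>R (chain t ** cadj (chain t))) ** M k)) = \<beta>\<^sub>0 t * r k t" for k t
    using linear_scale[OF bounded_linear.linear[OF lin], of "\<beta>\<^sub>0 t" "chain t ** cadj (chain t)"]
    by (simp add: r_def)
  have int_r: "integrable lborel (\<lambda>t. \<beta>\<^sub>0 t * r k t)" for k
    using integrable_bounded_linear[OF lin integrable_chain] by (simp add: r_eq)
  have q: "q k = (LINT t|lborel. \<beta>\<^sub>0 t * r k t)" for k
    unfolding q_def using integral_bounded_linear[OF lin integrable_chain] by (simp add: r_eq)
  have r_nonneg: "0 \<le> r k t" if "k < n" for k t
    unfolding r_def using povm that psd_cadj_mult[of "cadj (chain t)"]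
    by (intro psd_trace_mult_nonneg) (auto simp: povm_def)
  show q_nonneg: "0 \<le> q k" if "k < n" for k
    unfolding q using r_nonneg[OF that] \<beta>\<^sub>0_pos by (intro integral_nonneg_AE) (auto simp: less_imp_le)
  define c where "c = (\<Sum>k<n. exp (lam k) * q k) + \<epsilon>"
  have c: "c > 0"
    unfolding c_def using q_nonneg \<epsilon> by (intro add_nonneg_pos sum_nonneg) auto
  let ?g = "\<lambda>t. (norm (interp n M lam (1 + \<i> * of_real t)))\<^sup>2 + \<epsilon>"
  \<comment> \<open>Jensen's inequality through a tangent line:
    \<open>ln x \<le> ln c - 1 + x / c\<close>, taken at the mean \<open>c\<close> of the upper
    bound. As the density has mass 1, integrating \<open>?h\<close> returns exactly
    \<open>ln c\<close>.\<close>
  let ?h = "\<lambda>t. (ln c - 1 + \<epsilon> / c) * \<beta>\<^sub>0 t + (\<Sum>k<n. exp (lam k) / c * (\<beta>\<^sub>0 t * r k t))"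
  have int_sum: "integrable lborel (\<lambda>t. \<Sum>k<n. exp (lam k) / c * (\<beta>\<^sub>0 t * r k t))"
    by (intro Bochner_Integration.integrable_sum integrable_mult_right int_r)
  have int_h: "integrable lborel ?h"
    by (intro Bochner_Integration.integrable_add integrable_mult_right integrable_\<beta>\<^sub>0 int_sum)
  have "(\<Sum>k<n. lam k * Re (trace (\<rho> ** M k))) - info \<le> (LINT t|lborel. \<beta>\<^sub>0 t * ln (?g t))"
    by (rule interp_bound(1)[OF povm \<epsilon>])
  also have "\<dots> \<le> (LINT t|lborel. ?h t)"
  proof (rule integral_mono[OF interp_bound(2)[OF povm \<epsilon>] int_h])
    fix t
    have g_pos: "?g t > 0" using \<epsilon> by (simp add: add_nonneg_pos)
    have "ln (?g t) - ln c = ln (?g t / c)"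
      using g_pos c by (simp add: ln_div)
    also have "\<dots> \<le> ?g t / c - 1"
      using g_pos c by (intro ln_le_minus_one) simp
    also have "\<dots> \<le> ((\<Sum>k<n. exp (lam k) * r k t) + \<epsilon>) / c - 1"
      using interp_right[OF povm, of lam t] c by (simp add: divide_right_mono r_def)
    finally have "ln (?g t) \<le> ln c - 1 + ((\<Sum>k<n. exp (lam k) * r k t) + \<epsilon>) / c"
      by simp
    then have "\<beta>\<^sub>0 t * ln (?g t) \<le> \<beta>\<^sub>0 t * (ln c - 1 + ((\<Sum>k<n. exp (lam k) * r k t) + \<epsilon>) / c)"
      using \<beta>\<^sub>0_pos[of t] by (intro mult_left_mono) auto
    also have "\<dots> = ?h t"
      by (simp add: add_divide_distrib sum_divide_distrib sum_distrib_left algebra_simps)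
    finally show "\<beta>\<^sub>0 t * ln (?g t) \<le> ?h t" .
  qed
  also have "\<dots> = (ln c - 1 + \<epsilon> / c) + (\<Sum>k<n. exp (lam k) / c * q k)"
    using int_sum integrable_\<beta>\<^sub>0 int_r
    by (simp add: Bochner_Integration.integral_add Bochner_Integration.integral_sum integral_\<beta>\<^sub>0 q)
  also have "\<dots> = ln c - 1 + ((\<Sum>k<n. exp (lam k) * q k) + \<epsilon>) / c"
    by (simp add: add_divide_distrib sum_divide_distrib)
  also have "\<dots> = ln c"
    using c by (simp flip: c_def)
  finally show "(\<Sum>k<n. lam k * Re (trace (\<rho> ** M k))) - info \<le> ln ((\<Sum>k<n. exp (lam k) * q k) + \<epsilon>)"
    by (simp add: c_def)
qed

lemma measured_rel_entropy_le:
  "measured_rel_entropy \<rho> (LINT t|lborel. \<beta>\<^sub>0 t *\<^sub>R (chain t ** cadj (chain t))) \<le> ereal info"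
  unfolding measured_rel_entropy_def
proof (rule Sup_least, clarify)
  fix n and M :: "nat \<Rightarrow> 'n op"
  assume povm: "povm n M"
  define p where "p k = Re (trace (\<rho> ** M k))" for k
  define q where "q k = Re (trace ((LINT t|lborel. \<beta>\<^sub>0 t *\<^sub>R (chain t ** cadj (chain t))) ** M k))" for k
  have p_nonneg: "0 \<le> p k" if "k < n" for k
    unfolding p_def using povm that by (intro psd_trace_mult_nonneg psd) (auto simp: povm_def)
  have q_nonneg: "0 \<le> q k" if "k < n" for k
    unfolding q_def using measured_bound(2)[OF povm zero_less_one that] .
  have p_sum: "(\<Sum>k<n. p k) = 1"
  proof -
    have "(\<Sum>k<n. p k) = Re (trace (\<rho> ** (\<Sum>k<n. M k)))"
      by (simp add: p_def matrix_mult_sum_right trace_sum Re_sum)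
    then show ?thesis using povm by (simp add: povm_def trace_1)
  qed
  have bound: "(\<Sum>k<n. lam k * p k) - info \<le> ln ((\<Sum>k<n. exp (lam k) * q k) + \<epsilon>)" if "\<epsilon> > 0" for lam \<epsilon>
    using measured_bound(1)[OF povm that, of lam] by (simp add: p_def q_def)
  \<comment> \<open>Raising the weight of an outcome with \<open>q k = 0 < p k\<close> increases the
    left side without limit and leaves the right side alone.\<close>
  have abs_cont: "p k = 0" if k: "k < n" and "q k = 0" for k
  proof (rule ccontr)
    assume "p k \<noteq> 0"
    then have pk: "p k > 0" using p_nonneg[OF k] by simp
    define c where "c = ln ((\<Sum>j<n. q j) + 1)"
    define lam where "lam j = (if j = k then (\<bar>info + c\<bar> + 1) / p k else 0)" for j
    have "(\<Sum>j<n. lam j * p j) = (\<Sum>j<n. if j = k then \<bar>info + c\<bar> + 1 else 0)"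
      using pk by (intro sum.cong) (auto simp: lam_def)
    then have "(\<Sum>j<n. lam j * p j) = \<bar>info + c\<bar> + 1"
      using k by simp
    moreover have "(\<Sum>j<n. exp (lam j) * q j) = (\<Sum>j<n. q j)"
      using \<open>q k = 0\<close> by (intro sum.cong) (auto simp: lam_def)
    ultimately have "\<bar>info + c\<bar> + 1 - info \<le> c"
      using bound[of 1 lam] by (simp add: c_def)
    then show False by linarith
  qed
  define kl where "kl k = (if p k = 0 then 0 else p k * ln (p k / q k))" for k
  have "(\<Sum>k<n. kl_term (p k) (q k)) = (\<Sum>k<n. ereal (kl k))"
    using abs_cont by (intro sum.cong) (auto simp: kl_term_def kl_def)
  also have "\<dots> = ereal (\<Sum>k<n. kl k)"
    by (simp add: sum_ereal)
  also have "\<dots> \<le> ereal info"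
  proof -
    define Q where "Q = (\<Sum>k<n. q k)"
    have Q: "0 \<le> Q" unfolding Q_def using q_nonneg by (intro sum_nonneg) auto
    have le: "(\<Sum>k<n. kl k) \<le> info + \<epsilon> * (Q + 1)" if \<epsilon>: "\<epsilon> > 0" for \<epsilon> :: real
    proof -
      \<comment> \<open>The optimal weight for \<open>p k = 0\<close> would be minus infinity;
        \<open>ln \<epsilon>\<close> costs only \<open>\<epsilon> * q k\<close>. Together with the
        regularising \<epsilon> this gives the error \<open>\<epsilon> * (Q + 1)\<close>.\<close>
      define lam where "lam k = (if p k = 0 then ln \<epsilon> else ln (p k / q k))" for k
      have "(\<Sum>k<n. lam k * p k) = (\<Sum>k<n. kl k)"
        by (intro sum.cong) (auto simp: lam_def kl_def)
      moreover have "exp (lam k) * q k \<le> p k + \<epsilon> * q k" if "k < n" for k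
      proof (cases "p k = 0")
        case False
        then have "p k > 0" "q k > 0"
          using p_nonneg[OF that] q_nonneg[OF that] abs_cont[OF that] by (auto simp: less_le)
        then show ?thesis using False \<epsilon> by (simp add: lam_def)
      qed (use \<epsilon> in \<open>simp add: lam_def\<close>)
      then have "(\<Sum>k<n. exp (lam k) * q k) \<le> (\<Sum>k<n. p k + \<epsilon> * q k)"
        by (intro sum_mono) simp
      then have "(\<Sum>k<n. exp (lam k) * q k) + \<epsilon> \<le> 1 + \<epsilon> * (Q + 1)"
        by (simp add: sum.distrib p_sum Q_def sum_distrib_left algebra_simps)
      moreover have "0 \<le> (\<Sum>k<n. exp (lam k) * q k)"
        using q_nonneg by (intro sum_nonneg) auto
      ultimately have "(\<Sum>k<n. kl k) - info \<le> ln (1 + \<epsilon> * (Q + 1))"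
        using bound[OF \<epsilon>, of lam] \<epsilon> by (smt (verit) ln_mono)
      also have "\<dots> \<le> \<epsilon> * (Q + 1)"
        using \<epsilon> Q by (intro ln_add_one_self_le_self) simp
      finally show ?thesis by simp
    qed
    have "(\<Sum>k<n. kl k) \<le> info"
    proof (rule field_le_epsilon)
      fix e :: real assume "e > 0"
      then show "(\<Sum>k<n. kl k) \<le> info + e"
        using le[of "e / (Q + 1)"] Q by simp
    qed
    then show ?thesis by simp
  qed
  finally show "(\<Sum>k<n. kl_term (Re (trace (\<rho> ** M k)))
      (Re (trace ((LINT t|lborel. \<beta>\<^sub>0 t *\<^sub>R (chain t ** cadj (chain t))) ** M k)))) \<le> ereal info"
    by (simp add: p_def q_def)
qed

end

subsection \<open>The logarithm of the fidelity\<close>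

text \<open>
  The fidelity is not known to be measurable in \<open>t\<close>, so additivity of the integral is applied
  only to a continuous minorant \<open>g\<close>.
\<close>

lemma neg_ext_integral_ln_le:
  fixes g F :: "real \<Rightarrow> real"
  assumes cont: "continuous_on UNIV g" and g: "\<And>t. 0 \<le> g t" "\<And>t. g t \<le> B" and F: "\<And>t. g t \<le> F t"
    and int: "\<And>\<epsilon>. \<epsilon> > 0 \<Longrightarrow> integrable lborel (\<lambda>t. \<beta>\<^sub>0 t * ln (g t + \<epsilon>))"
    and bound: "\<And>\<epsilon>. \<epsilon> > 0 \<Longrightarrow> - D \<le> (LINT t|lborel. \<beta>\<^sub>0 t * ln (g t + \<epsilon>))"
  shows "- ext_integral (\<lambda>t. ereal (\<beta>\<^sub>0 t) * ln_ext (F t)) \<le> ereal D"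
proof -
  have g_meas [measurable]: "g \<in> borel_measurable borel"
    using cont by (rule borel_measurable_continuous_onI)
  define pos where "pos t = (if g t = 0 then 0 else ennreal (\<beta>\<^sub>0 t * ln (g t)))" for t
  \<comment> \<open>The case distinction is needed because \<open>ln 0 = 0\<close> in HOL, while
    here a zero of \<open>g\<close> must count as a logarithm of minus infinity.\<close>
  define neg where "neg t = (if g t = 0 then \<infinity> else ennreal (- (\<beta>\<^sub>0 t * ln (g t))))" for t
  have e2_pos: "pos t \<le> e2ennreal (ereal (\<beta>\<^sub>0 t) * ln_ext (F t))" for t
  proof (cases "g t = 0")
    case False
    then have "0 < g t" using g(1)[of t] by simp
    then have "\<beta>\<^sub>0 t * ln (g t) \<le> \<beta>\<^sub>0 t * ln (F t)" "F t \<noteq> 0"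
      using F[of t] \<beta>\<^sub>0_pos[of t] by (auto intro!: mult_left_mono)
    then show ?thesis
      using False by (simp add: pos_def ln_ext_def e2ennreal_ereal ennreal_leI)
  qed (simp add: pos_def)
  have e2_neg: "e2ennreal (- (ereal (\<beta>\<^sub>0 t) * ln_ext (F t))) \<le> neg t" for t
  proof (cases "g t = 0")
    case False
    then have "0 < g t" using g(1)[of t] by simp
    then have "- (\<beta>\<^sub>0 t * ln (F t)) \<le> - (\<beta>\<^sub>0 t * ln (g t))" "F t \<noteq> 0"
      using F[of t] \<beta>\<^sub>0_pos[of t] by (auto intro!: mult_left_mono)
    then show ?thesis
      using False by (simp add: neg_def ln_ext_def e2ennreal_ereal ennreal_leI)
  qed (simp add: neg_def)
  define P N where "P = (\<integral>\<^sup>+t. pos t \<partial>lborel)" and "N = (\<integral>\<^sup>+t. neg t \<partial>lborel)"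
  have pos_meas [measurable]: "pos \<in> borel_measurable borel" and neg_meas [measurable]: "neg \<in> borel_measurable borel"
    unfolding pos_def[abs_def] neg_def[abs_def] by measurable
  \<comment> \<open>An upper bound on \<open>g\<close> makes the positive part integrable, so the
    negative part can be bounded by subtraction.\<close>
  have "P \<le> (\<integral>\<^sup>+t. ennreal (\<bar>B\<bar> * \<beta>\<^sub>0 t) \<partial>lborel)"
    unfolding P_def
  proof (rule nn_integral_mono)
    fix t
    show "pos t \<le> ennreal (\<bar>B\<bar> * \<beta>\<^sub>0 t)"
    proof (cases "g t = 0")
      case False
      then have "ln (g t) \<le> \<bar>B\<bar>"
        using g[of t] ln_le_minus_one[of "g t"] by simp
      then have "\<beta>\<^sub>0 t * ln (g t) \<le> \<bar>B\<bar> * \<beta>\<^sub>0 t"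
        using \<beta>\<^sub>0_pos[of t] by (simp add: mult.commute)
      then show ?thesis using False by (simp add: pos_def ennreal_leI)
    qed (simp add: pos_def)
  qed
  also have "\<dots> = ennreal (LINT t|lborel. \<bar>B\<bar> * \<beta>\<^sub>0 t)"
    using integrable_\<beta>\<^sub>0 \<beta>\<^sub>0_pos by (intro nn_integral_eq_integral) (auto simp: less_imp_le)
  finally have "P < \<infinity>"
    using ennreal_less_top order_le_less_trans by (metis infinity_ennreal_def)
  then obtain r where r: "0 \<le> r" "P = ennreal r"
    by (cases P) auto
  define e where "e k = 1 / real (Suc k)" for k
  have e_pos: "e k > 0" for k by (simp add: e_def)
  have e_lim: "e \<longlonglongrightarrow> 0"
    unfolding e_def[abs_def] using LIMSEQ_inverse_real_of_nat by (simp add: inverse_eq_divide)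
  define neg_k where "neg_k k = (\<integral>\<^sup>+t. ennreal (- (\<beta>\<^sub>0 t * ln (g t + e k))) \<partial>lborel)" for k
  have neg_k: "neg_k k \<le> ennreal (r + D + e k)" and r_D: "0 \<le> r + D + e k" for k
  proof -
    define pos_k where "pos_k = (\<integral>\<^sup>+t. ennreal (\<beta>\<^sub>0 t * ln (g t + e k)) \<partial>lborel)"
    have "pos_k \<le> (\<integral>\<^sup>+t. pos t + ennreal (e k * \<beta>\<^sub>0 t) \<partial>lborel)"
      unfolding pos_k_def
    proof (rule nn_integral_mono)
      fix t
      show "ennreal (\<beta>\<^sub>0 t * ln (g t + e k)) \<le> pos t + ennreal (e k * \<beta>\<^sub>0 t)"
      \<comment> \<open>Above 1, adding \<open>e k\<close> raises the logarithm by at most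
        \<open>e k\<close>. Below 1, \<open>ln (g t + e k) \<le> g t + e k - 1\<close> is already
        below \<open>e k\<close>.\<close>
      proof (cases "g t \<ge> 1")
        case True
        have "ln (g t + e k) = ln (g t) + ln (1 + e k / g t)"
          using True e_pos[of k] by (subst ln_mult_pos[symmetric]) (auto simp: field_simps add_pos_pos)
        also have "ln (1 + e k / g t) \<le> e k / g t"
          using True e_pos[of k] by (intro ln_add_one_self_le_self) simp
        also have "e k / g t \<le> e k"
          using True e_pos[of k] by (simp add: divide_le_eq mult_le_cancel_left1)
        finally have "\<beta>\<^sub>0 t * ln (g t + e k) \<le> \<beta>\<^sub>0 t * (ln (g t) + e k)"
          using \<beta>\<^sub>0_pos[of t] by simp
        then have "ennreal (\<beta>\<^sub>0 t * ln (g t + e k)) \<le> ennreal (\<beta>\<^sub>0 t * ln (g t) + e k * \<beta>\<^sub>0 t)"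
          by (intro ennreal_leI) (simp add: algebra_simps)
        also have "\<dots> = ennreal (\<beta>\<^sub>0 t * ln (g t)) + ennreal (e k * \<beta>\<^sub>0 t)"
          using True e_pos[of k] \<beta>\<^sub>0_pos[of t] by (intro ennreal_plus) auto
        finally show ?thesis using True by (simp add: pos_def)
      next
        case False
        have "ln (g t + e k) \<le> g t + e k - 1"
          using g(1)[of t] e_pos[of k] by (intro ln_le_minus_one) simp
        then have "ln (g t + e k) \<le> e k" using False by simp
        then have "\<beta>\<^sub>0 t * ln (g t + e k) \<le> e k * \<beta>\<^sub>0 t"
          using \<beta>\<^sub>0_pos[of t] by (simp add: mult.commute)
        then have "ennreal (\<beta>\<^sub>0 t * ln (g t + e k)) \<le> ennreal (e k * \<beta>\<^sub>0 t)"
          by (rule ennreal_leI)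
        then show ?thesis by (rule order_trans) simp
      qed
    qed
    also have "\<dots> = P + (\<integral>\<^sup>+t. ennreal (e k * \<beta>\<^sub>0 t) \<partial>lborel)"
      unfolding P_def by (intro nn_integral_add) auto
    also have "(\<integral>\<^sup>+t. ennreal (e k * \<beta>\<^sub>0 t) \<partial>lborel) = ennreal (LINT t|lborel. e k * \<beta>\<^sub>0 t)"
      using integrable_\<beta>\<^sub>0 \<beta>\<^sub>0_pos e_pos[of k] by (intro nn_integral_eq_integral) (auto simp: less_imp_le)
    also have "P + ennreal (LINT t|lborel. e k * \<beta>\<^sub>0 t) = ennreal (r + e k)"
      using r e_pos[of k] by (simp add: integral_\<beta>\<^sub>0)
    finally have "pos_k \<le> ennreal (r + e k)" .
    then have pos_k: "enn2real pos_k \<le> r + e k"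
      using r(1) e_pos[of k] by (intro enn2real_leI) auto
    have "- D \<le> enn2real pos_k - enn2real (neg_k k)"
      using bound[OF e_pos[of k]] real_lebesgue_integral_def[OF int[OF e_pos[of k]]]
      by (simp add: pos_k_def neg_k_def)
    with pos_k have le: "enn2real (neg_k k) \<le> r + D + e k" by simp
    then show "0 \<le> r + D + e k"
      using enn2real_nonneg order_trans by blast
    have "neg_k k \<noteq> \<infinity>"
      unfolding neg_k_def using int[OF e_pos[of k]] by (simp add: real_integrable_def)
    then have "neg_k k = ennreal (enn2real (neg_k k))"
      by (simp add: less_top)
    with le show "neg_k k \<le> ennreal (r + D + e k)"
      by (metis ennreal_leI)
  qed
  have lim: "(\<lambda>k. ennreal (- (\<beta>\<^sub>0 t * ln (g t + e k)))) \<longlonglongrightarrow> neg t" for t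
  proof (cases "g t = 0")
    case True
    have "filterlim (\<lambda>k. \<beta>\<^sub>0 t * ln (real (Suc k))) at_top sequentially"
      by (intro filterlim_tendsto_pos_mult_at_top[OF tendsto_const \<beta>\<^sub>0_pos]
          filterlim_compose[OF ln_at_top] filterlim_compose[OF filterlim_real_sequentially filterlim_Suc])
    then have "filterlim (\<lambda>k. - (\<beta>\<^sub>0 t * ln (g t + e k))) at_top sequentially"
      by (simp add: True e_def ln_div)
    then have "(\<lambda>k. ennreal (- (\<beta>\<^sub>0 t * ln (g t + e k)))) \<longlonglongrightarrow> top"
      by (simp add: ennreal_tendsto_top_eq_at_top)
    then show ?thesis by (simp add: neg_def True)
  next
    case False
    have "(\<lambda>k. - (\<beta>\<^sub>0 t * ln (g t + e k))) \<longlonglongrightarrow> - (\<beta>\<^sub>0 t * ln (g t + 0))"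
      using False by (intro tendsto_intros e_lim) auto
    then show ?thesis
      using False by (simp add: neg_def tendsto_ennrealI)
  qed
  \<comment> \<open>Fatou's lemma removes the regularisation from the negative part, including at
    the zeros of \<open>g\<close>.\<close>
  have "N = (\<integral>\<^sup>+t. liminf (\<lambda>k. ennreal (- (\<beta>\<^sub>0 t * ln (g t + e k)))) \<partial>lborel)"
    unfolding N_def using lim_imp_Liminf[OF sequentially_bot lim] by simp
  also have "\<dots> \<le> liminf neg_k"
    unfolding neg_k_def by (intro nn_integral_liminf) measurable
  also have "\<dots> \<le> liminf (\<lambda>k. ennreal (r + D + e k))"
    by (intro Liminf_mono always_eventually allI neg_k)
  also have "\<dots> = ennreal (r + D)"
  proof -
    have "(\<lambda>k. ennreal (r + D + e k)) \<longlonglongrightarrow> ennreal (r + D + 0)"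
      by (intro tendsto_ennrealI tendsto_intros e_lim)
    then show ?thesis by (intro lim_imp_Liminf) auto
  qed
  finally have N: "N \<le> ennreal (r + D)" .
  \<comment> \<open>\<open>ennreal\<close> truncates at 0, so \<open>ennreal (r + D)\<close>
    represents \<open>r + D\<close> only with this sign.\<close>
  have "0 \<le> r + D"
  proof -
    have "(\<lambda>k. r + D + e k) \<longlonglongrightarrow> r + D + 0"
      by (intro tendsto_intros e_lim)
    then show ?thesis
      using LIMSEQ_le_const[of "\<lambda>k. r + D + e k" "r + D" 0] r_D by simp
  qed
  have "- ereal D = enn2ereal (ennreal r) - enn2ereal (ennreal (r + D))"
    using r(1) \<open>0 \<le> r + D\<close> by (simp add: enn2ereal_ennreal)
  also have "\<dots> \<le> enn2ereal (\<integral>\<^sup>+t. e2ennreal (ereal (\<beta>\<^sub>0 t) * ln_ext (F t)) \<partial>lborel)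
      - enn2ereal (\<integral>\<^sup>+t. e2ennreal (- (ereal (\<beta>\<^sub>0 t) * ln_ext (F t))) \<partial>lborel)"
  proof (rule ereal_minus_mono)
    have "P \<le> (\<integral>\<^sup>+t. e2ennreal (ereal (\<beta>\<^sub>0 t) * ln_ext (F t)) \<partial>lborel)"
      unfolding P_def by (intro nn_integral_mono e2_pos)
    then show "enn2ereal (ennreal r) \<le> enn2ereal (\<integral>\<^sup>+t. e2ennreal (ereal (\<beta>\<^sub>0 t) * ln_ext (F t)) \<partial>lborel)"
      by (simp add: r(2) less_eq_ennreal.rep_eq)
    have "(\<integral>\<^sup>+t. e2ennreal (- (ereal (\<beta>\<^sub>0 t) * ln_ext (F t))) \<partial>lborel) \<le> N"
      unfolding N_def by (intro nn_integral_mono e2_neg)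
    also note N
    finally show "enn2ereal (\<integral>\<^sup>+t. e2ennreal (- (ereal (\<beta>\<^sub>0 t) * ln_ext (F t))) \<partial>lborel) \<le> enn2ereal (ennreal (r + D))"
      by (simp add: less_eq_ennreal.rep_eq)
  qed
  finally show ?thesis
    unfolding ext_integral_def by (simp add: ereal_uminus_le_reorder)
qed

lemma (in interpolation) mean_log_fidelity_le:
  "- ext_integral (\<lambda>t. ereal (\<beta>\<^sub>0 t) * ln_ext (fidelity \<rho> (chain t ** cadj (chain t)))) \<le> ereal info"
proof -
  let ?f = "interp 1 (\<lambda>_. mat 1) (\<lambda>_. 0)"
  have povm: "povm 1 (\<lambda>_. mat 1 :: 'n op)"
    using psd_cadj_mult[of "mat 1 :: 'n op"] by (simp add: povm_def)
  obtain B where B: "\<And>z. 0 \<le> Re z \<Longrightarrow> Re z \<le> 1 \<Longrightarrow> norm (?f z) \<le> B"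
    using exp_sum_bounded[OF exp_sum_interp] by blast
  show ?thesis
  proof (rule neg_ext_integral_ln_le[where g = "\<lambda>t. (norm (?f (1 + \<i> * of_real t)))\<^sup>2"])
    have "continuous_on UNIV ?f"
      using exp_sum_holomorphic[OF exp_sum_interp] by (rule holomorphic_on_imp_continuous_on)
    then show "continuous_on UNIV (\<lambda>t. (norm (?f (1 + \<i> * of_real t)))\<^sup>2)"
      by (intro continuous_intros continuous_on_compose2[where f = "\<lambda>t. 1 + \<i> * of_real t" and g = ?f]) auto
    show "(norm (?f (1 + \<i> * of_real t)))\<^sup>2 \<le> B\<^sup>2" for t
      using B[of "1 + \<i> * of_real t"] by (simp add: power_mono)
    show "(norm (?f (1 + \<i> * of_real t)))\<^sup>2 \<le> fidelity \<rho> (chain t ** cadj (chain t))" for t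
      by (rule interp_right_fidelity)
    fix \<epsilon> :: real assume "\<epsilon> > 0"
    from interp_bound[OF povm this, of "\<lambda>_. 0"]
    show "integrable lborel (\<lambda>t. \<beta>\<^sub>0 t * ln ((norm (?f (1 + \<i> * of_real t)))\<^sup>2 + \<epsilon>))"
      "- info \<le> (LINT t|lborel. \<beta>\<^sub>0 t * ln ((norm (?f (1 + \<i> * of_real t)))\<^sup>2 + \<epsilon>))"
      by simp_all
  qed simp
qed

subsection \<open>Marginals\<close>

text \<open>A marginal described by duality with an embedding of observables. This form composes,
  and positivity, support inclusion and entropies follow from it without computing entries.\<close>

definition marginal_along :: "('n::finite op \<Rightarrow> 'm::finite op) \<Rightarrow> 'm op \<Rightarrow> 'n op \<Rightarrow> bool" where
  "marginal_along \<phi> \<rho> \<sigma> \<longleftrightarrow> star_hom \<phi> \<and> (\<forall>A. trace (\<rho> ** \<phi> A) = trace (\<sigma> ** A))"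

lemma marginal_along_comp:
  "marginal_along \<phi> \<rho> \<sigma> \<Longrightarrow> marginal_along \<psi> \<sigma> \<tau> \<Longrightarrow> marginal_along (\<lambda>A. \<phi> (\<psi> A)) \<rho> \<tau>"
  by (simp add: marginal_along_def star_hom_comp)

lemma marginal_along_psd:
  assumes marg: "marginal_along \<phi> \<rho> \<sigma>" and psd: "psd \<rho>"
  shows "psd \<sigma>"
proof -
  note hom = marg[unfolded marginal_along_def, THEN conjunct1]
  have tr: "trace (\<sigma> ** A) = trace (\<rho> ** \<phi> A)" for A
    using marg by (simp add: marginal_along_def)
  have "trace (cadj \<sigma> ** A) = trace (\<sigma> ** A)" for A
  proof -
    have "trace (cadj \<sigma> ** A) = trace (cadj (cadj A ** \<sigma>))"
      by (simp add: cadj_mult)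
    also have "\<dots> = cnj (trace (\<sigma> ** cadj A))"
      by (simp only: trace_cadj trace_mul_sym[of "cadj A" \<sigma>])
    also have "\<dots> = trace (cadj (\<rho> ** \<phi> (cadj A)))"
      by (simp only: tr trace_cadj)
    also have "\<dots> = trace (\<phi> A ** \<rho>)"
      by (simp add: cadj_mult star_homD(4)[OF hom] psd_herm[OF psd])
    also have "\<dots> = trace (\<sigma> ** A)"
      by (simp only: tr trace_mul_sym[of \<rho>])
    finally show ?thesis .
  qed
  then have "trace ((cadj \<sigma> - \<sigma>) ** A) = 0" for A
    by (simp add: matrix_mult_diff_left trace_sub)
  \<comment> \<open>Testing against the adjoint of the skew part itself makes the trace its squared
    norm.\<close>
  from this[of "cadj (cadj \<sigma> - \<sigma>)"] have "(norm (cadj (cadj \<sigma> - \<sigma>)))\<^sup>2 = 0"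
    by (simp only: power2_norm_op cadj_cadj) simp
  then have herm: "cadj \<sigma> = \<sigma>" by simp
  have "0 \<le> Re (\<Sum>i\<in>UNIV. cnj (v $ i) * (\<sigma> *v v) $ i)" for v
  proof -
    \<comment> \<open>A single nonzero row, in an arbitrary position, so that
      \<open>cadj C ** C\<close> is the rank-one operator of \<open>v\<close>.\<close>
    define C :: "'a op" where "C = (\<chi> i j. if i = undefined then cnj (v $ j) else 0)"
    have C: "(cadj C ** C) $ i $ j = v $ i * cnj (v $ j)" for i j
      by (simp add: C_def matrix_matrix_mult_def if_distrib if_distribR cong: if_cong)
    have "0 \<le> Re (trace (\<sigma> ** (cadj C ** C)))"
      unfolding tr by (intro psd_trace_mult_nonneg psd star_hom_psd[OF hom] psd_cadj_mult)
    also have "trace (\<sigma> ** (cadj C ** C)) = (\<Sum>i\<in>UNIV. cnj (v $ i) * (\<sigma> *v v) $ i)"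
      unfolding trace_def matrix_matrix_mult_def[of \<sigma>] matrix_vector_mult_def vec_lambda_beta C
      by (simp add: sum_distrib_left mult_ac)
    finally show ?thesis .
  qed
  with herm show ?thesis by (simp add: psd_def)
qed

text \<open>By duality \<rho> has trace 0 against the embedded kernel projection of \<sigma>; both
  operators are psd, so their product vanishes.\<close>

lemma marginal_along_support:
  assumes marg: "marginal_along \<phi> \<rho> \<sigma>" and psd: "psd \<rho>"
  shows "\<rho> ** op_power (\<phi> \<sigma>) 0 = \<rho>"
    and "trace (\<rho> ** op_log (\<phi> \<sigma>)) = trace (\<sigma> ** op_log \<sigma>)"
proof -
  note hom = marg[unfolded marginal_along_def, THEN conjunct1]
  have tr: "trace (\<rho> ** \<phi> A) = trace (\<sigma> ** A)" for A
    using marg by (simp add: marginal_along_def)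
  have \<sigma>: "psd \<sigma>" by (rule marginal_along_psd[OF marg psd])
  let ?Q = "mat 1 - op_power \<sigma> 0"
  have "op_power \<sigma> 1 ** op_power \<sigma> 0 = op_power \<sigma> 1"
    by (simp add: op_power_add[OF \<sigma>])
  then have "\<sigma> ** ?Q = 0"
    by (simp add: op_power_1[OF \<sigma>] matrix_mult_diff_right)
  then have "\<rho> ** \<phi> ?Q = 0"
    by (intro psd_mult_eq_0 psd star_hom_psd[OF hom] psd_one_minus_support \<sigma>) (simp add: tr)
  then show "\<rho> ** op_power (\<phi> \<sigma>) 0 = \<rho>"
    by (simp add: star_homD[OF hom] star_hom_op_power[OF hom \<sigma>] matrix_mult_diff_right)
  show "trace (\<rho> ** op_log (\<phi> \<sigma>)) = trace (\<sigma> ** op_log \<sigma>)"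
    by (simp add: tr flip: star_hom_op_log[OF hom \<sigma>])
qed

lemma marginal_along_id_tensor: "marginal_along id_tensor \<rho> (ptrace1 \<rho>)"
  by (simp add: marginal_along_def star_hom_id_tensor trace_mult_id_tensor)

lemma marginal_along_reindex:
  assumes "bij f" and inv: "\<And>x. g (f x) = x" "\<And>y. f (g y) = y"
  shows "marginal_along (reindex f) \<rho> (reindex g \<rho>)"
proof -
  have "bij g" using inv by (metis bij_betw_byWitness[of UNIV f g UNIV] o_bij comp_def id_apply ext)
  have "trace (\<rho> ** reindex f A) = trace (reindex g \<rho> ** A)" for A
  proof -
    have "reindex g (reindex f A) = A"
      by (simp add: reindex_def vec_eq_iff inv)
    then show ?thesis
      using trace_reindex[OF \<open>bij g\<close>, of "\<rho> ** reindex f A"]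
      by (simp add: star_homD[OF star_hom_reindex[OF \<open>bij g\<close>]])
  qed
  then show ?thesis
    by (simp add: marginal_along_def star_hom_reindex[OF \<open>bij f\<close>])
qed

text \<open>Here \<open>'s\<close> collects the systems other than the last one, \<open>'a\<close>.
  For four parties, \<open>marg_ac \<rho>\<close>, \<open>marg_ac (marg_sc \<rho>)\<close> and
  \<open>marg_sc (marg_sc \<rho>)\<close> are the marginals on A3 C, A2 C and A1 C.\<close>

definition embed_ac :: "('a::finite \<times> 'c::finite) op \<Rightarrow> (('s::finite \<times> 'a) \<times> 'c) op" where
  "embed_ac A = reindex (\<lambda>((s, a), c). (s, (a, c))) (id_tensor A)"

definition embed_sc :: "('s::finite \<times> 'c::finite) op \<Rightarrow> (('s \<times> 'a::finite) \<times> 'c) op" where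
  "embed_sc A = reindex (\<lambda>((s, a), c). (a, (s, c))) (id_tensor A)"

definition marg_ac :: "(('s::finite \<times> 'a::finite) \<times> 'c::finite) op \<Rightarrow> ('a \<times> 'c) op" where
  "marg_ac \<rho> = ptrace1 (reindex (\<lambda>(s, (a, c)). ((s, a), c)) \<rho>)"

definition marg_sc :: "(('s::finite \<times> 'a::finite) \<times> 'c::finite) op \<Rightarrow> ('s \<times> 'c) op" where
  "marg_sc \<rho> = ptrace1 (reindex (\<lambda>(a, (s, c)). ((s, a), c)) \<rho>)"

lemma marginal_along_embed_ac: "marginal_along embed_ac \<rho> (marg_ac \<rho>)"
proof -
  have "bij (\<lambda>((s, a), c). (s, (a, c)))"
    by (rule o_bij[where g = "\<lambda>(s, (a, c)). ((s, a), c)"]) (auto simp: fun_eq_iff)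
  then have "marginal_along (\<lambda>A. reindex (\<lambda>((s, a), c). (s, (a, c))) (id_tensor A)) \<rho> (marg_ac \<rho>)"
    unfolding marg_ac_def
    by (intro marginal_along_comp[OF marginal_along_reindex marginal_along_id_tensor]) auto
  then show ?thesis by (simp add: embed_ac_def[abs_def])
qed

lemma marginal_along_embed_sc: "marginal_along embed_sc \<rho> (marg_sc \<rho>)"
proof -
  have "bij (\<lambda>((s, a), c). (a, (s, c)))"
    by (rule o_bij[where g = "\<lambda>(a, (s, c)). ((s, a), c)"]) (auto simp: fun_eq_iff)
  then have "marginal_along (\<lambda>A. reindex (\<lambda>((s, a), c). (a, (s, c))) (id_tensor A)) \<rho> (marg_sc \<rho>)"
    unfolding marg_sc_def
    by (intro marginal_along_comp[OF marginal_along_reindex marginal_along_id_tensor]) auto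
  then show ?thesis by (simp add: embed_sc_def[abs_def])
qed

lemmas star_hom_embed = marginal_along_embed_ac[unfolded marginal_along_def, THEN conjunct1]
  marginal_along_embed_sc[unfolded marginal_along_def, THEN conjunct1]

lemma ptrace1_marg_sc: "ptrace1 (marg_sc \<rho>) = ptrace1 \<rho>"
  by (simp add: vec_eq_iff ptrace1_def marg_sc_def reindex_def sum_prod_UNIV)

lemma ptrace1_marg_ac: "ptrace1 (marg_ac \<rho>) = ptrace1 \<rho>"
  by (auto simp: vec_eq_iff ptrace1_def marg_ac_def reindex_def sum_prod_UNIV intro: sum.swap)

lemma cond_mutual_info_eq:
  "cond_mutual_info \<rho> = vn_entropy (marg_sc \<rho>) + vn_entropy (marg_ac \<rho>)
     - vn_entropy \<rho> - vn_entropy (ptrace1 \<rho>)"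
  by (simp add: cond_mutual_info_def marg_sc_def marg_ac_def)

text \<open>The entropy of A1 A2 C cancels between the two summands. What is left is symmetric in
  the three systems, and each marginal entropy in it corresponds to factors of the chain.\<close>

lemma cond_multi_info_eq:
  "cond_multi_info \<rho> = vn_entropy (marg_sc (marg_sc \<rho>)) + vn_entropy (marg_ac (marg_sc \<rho>))
     + vn_entropy (marg_ac \<rho>) - vn_entropy \<rho> - 2 * vn_entropy (ptrace1 \<rho>)"
proof -
  have eq: "(\<lambda>(a3, ((a1, a2), c)). (((a1, a2), a3), c)) = (\<lambda>(a, (s, c)). ((s, a), c))"
    by (auto simp: fun_eq_iff)
  have "cond_multi_info \<rho> = cond_mutual_info (marg_sc \<rho>) + cond_mutual_info \<rho>"
    unfolding cond_multi_info_def marg_sc_def eq ..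
  then show ?thesis by (simp add: cond_mutual_info_eq ptrace1_marg_sc)
qed

subsection \<open>The recovered states\<close>

text \<open>The two exponents are complex conjugates, so the map is a conjugation and sends squares
  \<open>Y ** cadj Y\<close> to squares. This allows the two recovery maps to be iterated at the
  level of square roots.\<close>

lemma recovery_square:
  fixes \<sigma> :: "('a::finite \<times> 'c::finite) op" and Y :: "('s::finite \<times> 'c) op"
  assumes \<sigma>: "psd \<sigma>" and C: "psd (ptrace1 \<sigma>)"
  defines "z t \<equiv> (1 + \<i> * of_real t) / 2"
  defines "G t \<equiv> embed_ac (op_power \<sigma> (z t)) ** (embed_sc (id_tensor (op_power (ptrace1 \<sigma>) (- z t))) ** embed_sc Y)"
  shows "recovery \<sigma> t (Y ** cadj Y) = G t ** cadj (G t)"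
proof -
  have w: "cnj (z t) = (1 - \<i> * of_real t) / 2" by (simp add: z_def complex_eq_iff)
  have "recovery \<sigma> t (Y ** cadj Y) = embed_ac (op_power \<sigma> (z t))
      ** embed_sc (id_tensor (op_power (ptrace1 \<sigma>) (- z t)) ** (Y ** cadj Y)
        ** id_tensor (op_power (ptrace1 \<sigma>) (- cnj (z t)))) ** embed_ac (op_power \<sigma> (cnj (z t)))"
    unfolding w by (simp add: recovery_def z_def embed_ac_def embed_sc_def Let_def)
  also have "op_power \<sigma> (cnj (z t)) = cadj (op_power \<sigma> (z t))"
    by (simp add: cadj_op_power[OF \<sigma>])
  also have "op_power (ptrace1 \<sigma>) (- cnj (z t)) = cadj (op_power (ptrace1 \<sigma>) (- z t))"
    by (simp add: cadj_op_power[OF C])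
  finally show ?thesis
    by (simp add: G_def cadj_mult star_homD[OF star_hom_embed(1)] star_homD[OF star_hom_embed(2)]
        star_homD[OF star_hom_id_tensor] matrix_mul_assoc)
qed

text \<open>Listed in the order of the product \<open>K(z)\<close>. The marginal on C occurs twice,
  embedded along the route on which each recovery step meets it.\<close>

definition marginal_factors ::
  "((('a1::finite \<times> 'a2::finite) \<times> 'a3::finite) \<times> 'c::finite) op
    \<Rightarrow> (real \<times> ((('a1 \<times> 'a2) \<times> 'a3) \<times> 'c) op) list" where
  "marginal_factors \<rho> =
     [(1, embed_ac (marg_ac \<rho>)),
      (- 1, embed_sc (id_tensor (ptrace1 \<rho>))),
      (1, embed_sc (embed_ac (marg_ac (marg_sc \<rho>)))),
      (- 1, embed_sc (embed_sc (id_tensor (ptrace1 \<rho>)))),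
      (1, embed_sc (embed_sc (marg_sc (marg_sc \<rho>))))]"

lemma marginal_along_factors:
  fixes \<rho> :: "((('a1::finite \<times> 'a2::finite) \<times> 'a3::finite) \<times> 'c::finite) op"
  shows "marginal_along embed_ac \<rho> (marg_ac \<rho>)"
    "marginal_along (\<lambda>A. embed_sc (id_tensor A)) \<rho> (ptrace1 \<rho>)"
    "marginal_along (\<lambda>A. embed_sc (embed_ac A)) \<rho> (marg_ac (marg_sc \<rho>))"
    "marginal_along (\<lambda>A. embed_sc (embed_sc (id_tensor A))) \<rho> (ptrace1 \<rho>)"
    "marginal_along (\<lambda>A. embed_sc (embed_sc A)) \<rho> (marg_sc (marg_sc \<rho>))"
proof -
  show "marginal_along embed_ac \<rho> (marg_ac \<rho>)"
    by (rule marginal_along_embed_ac)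
  show "marginal_along (\<lambda>A. embed_sc (id_tensor A)) \<rho> (ptrace1 \<rho>)"
    using marginal_along_comp[OF marginal_along_embed_sc marginal_along_id_tensor, of \<rho>]
    by (simp add: ptrace1_marg_sc)
  show "marginal_along (\<lambda>A. embed_sc (embed_ac A)) \<rho> (marg_ac (marg_sc \<rho>))"
    by (rule marginal_along_comp[OF marginal_along_embed_sc marginal_along_embed_ac])
  show two: "marginal_along (\<lambda>A. embed_sc (embed_sc A)) \<rho> (marg_sc (marg_sc \<rho>))"
    by (rule marginal_along_comp[OF marginal_along_embed_sc marginal_along_embed_sc])
  show "marginal_along (\<lambda>A. embed_sc (embed_sc (id_tensor A))) \<rho> (ptrace1 \<rho>)"
    using marginal_along_comp[OF two marginal_along_id_tensor] by (simp add: ptrace1_marg_sc)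
qed

lemma recovered_eq_chain:
  fixes \<rho> :: "((('a1::finite \<times> 'a2::finite) \<times> 'a3::finite) \<times> 'c::finite) op"
  assumes psd: "psd \<rho>"
  defines "K t \<equiv> power_chain (marginal_factors \<rho>) (1 + \<i> * of_real t)"
  shows "recovered \<rho> t = K t ** cadj (K t)"
proof -
  define m1 m2 m3 c where "m1 = marg_sc (marg_sc \<rho>)" and "m2 = marg_ac (marg_sc \<rho>)"
    and "m3 = marg_ac \<rho>" and "c = ptrace1 \<rho>"
  define z where "z = (1 + \<i> * of_real t) / 2"
  have psds: "psd m1" "psd m2" "psd m3" "psd c"
    unfolding m1_def m2_def m3_def c_def
    using marginal_along_factors[of \<rho>] marginal_along_psd psd by blast+
  have c: "ptrace1 m2 = c" "ptrace1 m3 = c"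
    by (simp_all add: m2_def m3_def c_def ptrace1_marg_ac ptrace1_marg_sc)
  have rec: "recovered \<rho> t = recovery m3 t (recovery m2 t m1)"
  proof -
    have "ptrace1 (reindex (\<lambda>((a2, a3), (a1, c)). (((a1, a2), a3), c)) \<rho>) = m1"
      by (simp add: vec_eq_iff ptrace1_def m1_def marg_sc_def reindex_def sum_prod_UNIV)
    moreover have "ptrace1 (reindex (\<lambda>((a1, a3), (a2, c)). (((a1, a2), a3), c)) \<rho>) = m2"
      by (simp add: vec_eq_iff ptrace1_def m2_def marg_sc_def marg_ac_def reindex_def sum_prod_UNIV)
    moreover have "ptrace1 (reindex (\<lambda>((a1, a2), (a3, c)). (((a1, a2), a3), c)) \<rho>) = m3"
      by (simp add: vec_eq_iff ptrace1_def m3_def marg_ac_def reindex_def sum_prod_UNIV)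
    ultimately show ?thesis by (simp add: recovered_def)
  qed
  \<comment> \<open>The imaginary part of the exponent cancels, so the initial marginal is a square
    of a complex power, as the chain at \<open>1 + it\<close> requires.\<close>
  have m1: "m1 = op_power m1 z ** cadj (op_power m1 z)"
  proof -
    have "z + cnj z = 1" by (simp add: z_def complex_eq_iff)
    then show ?thesis
      by (simp add: cadj_op_power[OF psds(1)] op_power_add[OF psds(1)] op_power_1[OF psds(1)])
  qed
  define G where "G = embed_ac (op_power m2 z) ** (embed_sc (id_tensor (op_power c (- z))) ** embed_sc (op_power m1 z))"
  have G: "recovery m2 t m1 = G ** cadj G"
    using recovery_square[of m2 t "op_power m1 z"] psds m1 by (simp add: G_def z_def c)
  define G' where "G' = embed_ac (op_power m3 z) ** (embed_sc (id_tensor (op_power c (- z))) ** embed_sc G)"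
  have "recovery m3 t (G ** cadj G) = G' ** cadj G'"
    using recovery_square[of m3 t G] psds by (simp add: G'_def z_def c)
  moreover have "K t = G'"
  proof -
    note hom = star_hom_embed star_hom_id_tensor
    have half: "of_real (1 / 2) * (1 + \<i> * of_real t) = z" "of_real (- 1 / 2) * (1 + \<i> * of_real t) = - z"
      by (simp_all add: z_def)
    have pull: "op_power (embed_ac m3) z = embed_ac (op_power m3 z)"
      "op_power (embed_sc (id_tensor c)) (- z) = embed_sc (id_tensor (op_power c (- z)))"
      "op_power (embed_sc (embed_ac m2)) z = embed_sc (embed_ac (op_power m2 z))"
      "op_power (embed_sc (embed_sc (id_tensor c))) (- z) = embed_sc (embed_sc (id_tensor (op_power c (- z))))"
      "op_power (embed_sc (embed_sc m1)) z = embed_sc (embed_sc (op_power m1 z))"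
      by (simp_all add: star_hom_op_power star_hom_psd hom psds)
    have "K t = embed_ac (op_power m3 z) ** (embed_sc (id_tensor (op_power c (- z)))
        ** (embed_sc (embed_ac (op_power m2 z)) ** (embed_sc (embed_sc (id_tensor (op_power c (- z))))
        ** embed_sc (embed_sc (op_power m1 z)))))"
      unfolding K_def marginal_factors_def power_chain.simps half matrix_mul_rid
      unfolding m1_def[symmetric] m2_def[symmetric] m3_def[symmetric] c_def[symmetric] pull ..
    also have "\<dots> = G'"
      by (simp add: G'_def G_def star_homD(2)[OF star_hom_embed(2)])
    finally show ?thesis .
  qed
  ultimately show ?thesis by (simp add: rec G)
qed

lemma multi_info_bounds:
  fixes \<rho> :: "((('a1::finite \<times> 'a2::finite) \<times> 'a3::finite) \<times> 'c::finite) op"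
  assumes state: "state \<rho>"
  shows "measured_rel_entropy \<rho> (mean_recovered \<rho>) \<le> ereal (cond_multi_info \<rho>)"
    and "- mean_log_fidelity \<rho> \<le> ereal (cond_multi_info \<rho>)"
proof -
  have psd: "psd \<rho>" using state by (simp add: state_def)
  note margs = marginal_along_factors[of \<rho>]
  note supp = margs[THEN marginal_along_support(1)[OF _ psd]]
  note logs = margs[THEN marginal_along_support(2)[OF _ psd]]
  have psds: "psd (\<phi> \<sigma>)" if "marginal_along \<phi> \<rho> \<sigma>" for \<phi> :: "'m::finite op \<Rightarrow> _" and \<sigma>
    using that marginal_along_psd[OF that psd] star_hom_psd by (auto simp: marginal_along_def)
  interpret interpolation \<rho> "marginal_factors \<rho>"
  proof
    show "\<forall>p\<in>set (marginal_factors \<rho>). psd (snd p) \<and> \<rho> ** op_power (snd p) 0 = \<rho>"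
      using supp margs[THEN psds] by (simp add: marginal_factors_def)
  qed (rule state)
  have chain: "recovered \<rho> t = chain t ** cadj (chain t)" for t
    unfolding chain_def by (rule recovered_eq_chain[OF psd])
  \<comment> \<open>By \<open>logs\<close>, each trace of \<rho> with the logarithm of an embedded
    marginal is minus that marginal's entropy; the signs of the list then match
    \<open>cond_multi_info_eq\<close>.\<close>
  have info: "info = cond_multi_info \<rho>"
    unfolding info_def by (simp add: marginal_factors_def logs cond_multi_info_eq vn_entropy_def)
  show "measured_rel_entropy \<rho> (mean_recovered \<rho>) \<le> ereal (cond_multi_info \<rho>)"
    using measured_rel_entropy_le by (simp add: mean_recovered_def chain info)
  show "- mean_log_fidelity \<rho> \<le> ereal (cond_multi_info \<rho>)"
    using mean_log_fidelity_le by (simp add: mean_log_fidelity_def chain info)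
qed

subsection \<open>Permutations of the systems\<close>

lemma vn_entropy_reindex:
  assumes "bij f" "psd \<rho>"
  shows "vn_entropy (reindex f \<rho>) = vn_entropy \<rho>"
proof -
  note hom = star_hom_reindex[OF assms(1)]
  have "reindex f \<rho> ** op_log (reindex f \<rho>) = reindex f (\<rho> ** op_log \<rho>)"
    by (simp add: star_homD[OF hom] star_hom_op_log[OF hom assms(2)])
  then show ?thesis by (simp add: vn_entropy_def trace_reindex[OF assms(1)])
qed

lemma state_reindex:
  assumes "bij f" "state \<rho>"
  shows "state (reindex f \<rho>)"
  using assms star_hom_psd[OF star_hom_reindex[OF assms(1)]]
  by (simp add: state_def trace_reindex)

text \<open>The transposition exchanges the marginals on A2 C and A3 C and fixes the other terms of
  \<open>cond_multi_info_eq\<close>.\<close>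

lemma order132:
  assumes "state \<rho>"
  shows "state (order132 \<rho>)" "cond_multi_info (order132 \<rho>) = cond_multi_info \<rho>"
proof -
  have bij: "bij (\<lambda>(((a1, a3), a2), c). (((a1, a2), a3), c))"
    by (rule o_bij[where g = "\<lambda>(((a1, a2), a3), c). (((a1, a3), a2), c)"]) (auto simp: fun_eq_iff)
  show "state (order132 \<rho>)"
    unfolding order132_def by (rule state_reindex[OF bij assms])
  have "vn_entropy (order132 \<rho>) = vn_entropy \<rho>"
    unfolding order132_def using assms by (intro vn_entropy_reindex bij) (simp add: state_def)
  moreover have "marg_sc (marg_sc (order132 \<rho>)) = marg_sc (marg_sc \<rho>)"
    by (auto simp: vec_eq_iff marg_sc_def ptrace1_def reindex_def order132_def intro: sum.swap)
  moreover have "marg_ac (marg_sc (order132 \<rho>)) = marg_ac \<rho>"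
    by (simp add: vec_eq_iff marg_sc_def marg_ac_def ptrace1_def reindex_def order132_def sum_prod_UNIV)
  moreover have "marg_ac (order132 \<rho>) = marg_ac (marg_sc \<rho>)"
    by (simp add: vec_eq_iff marg_sc_def marg_ac_def ptrace1_def reindex_def order132_def sum_prod_UNIV)
  moreover have "ptrace1 (order132 \<rho>) = ptrace1 \<rho>"
    by (auto simp: vec_eq_iff ptrace1_def reindex_def order132_def sum_prod_UNIV intro!: sum.cong sum.swap)
  ultimately show "cond_multi_info (order132 \<rho>) = cond_multi_info \<rho>"
    by (simp add: cond_multi_info_eq)
qed

lemma order213:
  assumes "state \<rho>"
  shows "state (order213 \<rho>)" "cond_multi_info (order213 \<rho>) = cond_multi_info \<rho>"
proof -
  have bij: "bij (\<lambda>(((a2, a1), a3), c). (((a1, a2), a3), c))"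
    by (rule o_bij[where g = "\<lambda>(((a1, a2), a3), c). (((a2, a1), a3), c)"]) (auto simp: fun_eq_iff)
  show "state (order213 \<rho>)"
    unfolding order213_def by (rule state_reindex[OF bij assms])
  have "vn_entropy (order213 \<rho>) = vn_entropy \<rho>"
    unfolding order213_def using assms by (intro vn_entropy_reindex bij) (simp add: state_def)
  moreover have "marg_sc (marg_sc (order213 \<rho>)) = marg_ac (marg_sc \<rho>)"
    by (simp add: vec_eq_iff marg_sc_def marg_ac_def ptrace1_def reindex_def order213_def)
  moreover have "marg_ac (marg_sc (order213 \<rho>)) = marg_sc (marg_sc \<rho>)"
    by (simp add: vec_eq_iff marg_sc_def marg_ac_def ptrace1_def reindex_def order213_def)
  moreover have "marg_ac (order213 \<rho>) = marg_ac \<rho>"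
    by (auto simp: vec_eq_iff marg_ac_def ptrace1_def reindex_def order213_def sum_prod_UNIV intro: sum.swap)
  moreover have "ptrace1 (order213 \<rho>) = ptrace1 \<rho>"
    by (auto simp: vec_eq_iff ptrace1_def reindex_def order213_def sum_prod_UNIV intro: sum.swap)
  ultimately show "cond_multi_info (order213 \<rho>) = cond_multi_info \<rho>"
    by (simp add: cond_multi_info_eq)
qed

text \<open>The two adjacent transpositions generate all orderings, so invariance has to be checked
  only for them.\<close>

lemma order_compositions:
  "order231 \<rho> = order132 (order213 \<rho>)"
  "order312 \<rho> = order213 (order132 \<rho>)"
  "order321 \<rho> = order213 (order132 (order213 \<rho>))"
  by (simp_all add: vec_eq_iff order132_def order213_def order231_def order312_def order321_def reindex_def)

theorem proposition14:
  fixes \<rho> :: "((('a1::finite \<times> 'a2::finite) \<times> 'a3::finite) \<times> 'c::finite) op"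
  assumes "state \<rho>"
  shows "ereal (cond_multi_info \<rho>) \<ge> measured_rel_entropy \<rho> (mean_recovered \<rho>)
    \<and> ereal (cond_multi_info \<rho>) \<ge> - mean_log_fidelity \<rho>
    \<and> ereal (cond_multi_info \<rho>) \<ge> measured_rel_entropy (order132 \<rho>) (mean_recovered (order132 \<rho>))
    \<and> ereal (cond_multi_info \<rho>) \<ge> - mean_log_fidelity (order132 \<rho>)
    \<and> ereal (cond_multi_info \<rho>) \<ge> measured_rel_entropy (order213 \<rho>) (mean_recovered (order213 \<rho>))
    \<and> ereal (cond_multi_info \<rho>) \<ge> - mean_log_fidelity (order213 \<rho>)
    \<and> ereal (cond_multi_info \<rho>) \<ge> measured_rel_entropy (order231 \<rho>) (mean_recovered (order231 \<rho>))
    \<and> ereal (cond_multi_info \<rho>) \<ge> - mean_log_fidelity (order231 \<rho>)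
    \<and> ereal (cond_multi_info \<rho>) \<ge> measured_rel_entropy (order312 \<rho>) (mean_recovered (order312 \<rho>))
    \<and> ereal (cond_multi_info \<rho>) \<ge> - mean_log_fidelity (order312 \<rho>)
    \<and> ereal (cond_multi_info \<rho>) \<ge> measured_rel_entropy (order321 \<rho>) (mean_recovered (order321 \<rho>))
    \<and> ereal (cond_multi_info \<rho>) \<ge> - mean_log_fidelity (order321 \<rho>)"
proof -
  have order231: "state (order231 \<rho>)" "cond_multi_info (order231 \<rho>) = cond_multi_info \<rho>"
    unfolding order_compositions by (simp_all add: order132 order213 assms)
  have order312: "state (order312 \<rho>)" "cond_multi_info (order312 \<rho>) = cond_multi_info \<rho>"
    unfolding order_compositions by (simp_all add: order132 order213 assms)
  have order321: "state (order321 \<rho>)" "cond_multi_info (order321 \<rho>) = cond_multi_info \<rho>"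
    unfolding order_compositions by (simp_all add: order132 order213 assms)
  show ?thesis
    using multi_info_bounds[OF assms] multi_info_bounds[OF order132(1)[OF assms]]
      multi_info_bounds[OF order213(1)[OF assms]] multi_info_bounds[OF order231(1)]
      multi_info_bounds[OF order312(1)] multi_info_bounds[OF order321(1)]
    by (simp add: order132(2) order213(2) order231(2) order312(2) order321(2) assms)
qed

end
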